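(* Let $(G,\mu)$ be a countable measured groupoid with unit space $X$. Then $(G,\mu)$ is amenable if and only if there exists a sequence $(F_n)$ of positive definite Borel functions on $G$ such that (i) $(F_n)_{|X}=1$ almost everywhere; (ii) each $F_n$ has a bounded support; (iii) $\lim_nF_n=1$ almost everywhere.
   Context: **Groupoids.** A Borel groupoid is a groupoid $G$ with a standard Borel structure such that range $r$, source $s$, inverse and product are Borel; $X=G^{(0)}$ is its unit space, $G^x=r^{-1}(x)$, $G_x=s^{-1}(x)$. It is countable if all $G^x$ are countable. Given a probability measure $\mu$ on $X$, the $\sigma$-finite measure $\nu$ on $G$ is $\int_G F\,d\nu=\int_X\sum_{s(\gamma)=x}F(\gamma)\,d\mu(x)$; $\mu$ is quasi-invariant if $\nu$ is equivalent to its image under $\gamma\mapsto\gamma^{-1}$. A countable measured groupoid $(G,\mu)$ is a countable Borel groupoid with a quasi-invariant probability measure $\mu$ on $X$. **Positive definite.** A Borel function $F:G\to\mathbb{C}$ is positive definite if there is a $\mu$-null set $N\subset X$ such that for all $x\notin N$ and $\gamma_1,\dots,\gamma_k\in G^x$ the matrix $[F(\gamma_i^{-1}\gamma_j)]$ is positive (semi-definite). **Bounded support.** A Borel subset $Q\subset G$ is bounded if there is $c>0$ such that for almost every $x\in X$, $\sharp(Q\cap G^x)\le c$ and $\sharp(Q\cap G_x)\le c$. A Borel function on $G$ has a bounded support if it vanishes outside a bounded Borel subset of $G$. **Amenability.** $(G,\mu)$ is amenable if there is a sequence $(\xi_n)$ of Borel functions on $G$ such that (i) $\sum_{r(\gamma)=x}|\xi_n(\gamma)|^2=1$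 for almost every $x\in X$; (ii) setting $F_n(\gamma)=\sum_{r(\gamma_1)=r(\gamma)}\overline{\xi_n(\gamma_1)}\,\xi_n(\gamma^{-1}\gamma_1)$, one has $\lim_nF_n=1$ in the weak* topology of $L^\infty(G,\nu)$. *)

theory Defs
  imports "HOL-Probability.Probability"
begin

section \<open>Borel groupoids\<close>

definition polish_topology :: "'a topology \<Rightarrow> bool" where
  "polish_topology T \<longleftrightarrow> completely_metrizable_space T \<and> separable_space T"

text \<open>Only the underlying set and the sigma-algebra of \<open>M\<close> matter here.\<close>

definition standard_borel :: "'a measure \<Rightarrow> bool" where
  "standard_borel M \<longleftrightarrow>
     (\<exists>T. polish_topology T \<and> topspace T = space M \<and>
          sets M = sigma_sets (topspace T) {U. openin T U})"

text \<open>
  The type \<open>'a measure\<close> of the field \<open>arrows\<close> serves to carry the set of arrows together with its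
  Borel structure; its measure component is never used. As usual the unit space is a subset of the
  set of arrows. The total function \<open>mult\<close> is only meaningful on composable pairs.
\<close>

record 'g groupoid_data =
  arrows :: "'g measure"
  units :: "'g set"
  rng :: "'g \<Rightarrow> 'g"
  src :: "'g \<Rightarrow> 'g"
  ginv :: "'g \<Rightarrow> 'g"
  mult :: "'g \<Rightarrow> 'g \<Rightarrow> 'g"

definition composable :: "'g groupoid_data \<Rightarrow> ('g \<times> 'g) set" where
  "composable G =
     {(a, b). a \<in> space (arrows G) \<and> b \<in> space (arrows G) \<and> src G a = rng G b}"

definition range_fiber :: "'g groupoid_data \<Rightarrow> 'g \<Rightarrow> 'g set" where
  "range_fiber G x = {\<gamma> \<in> space (arrows G). rng G \<gamma> = x}"

definition source_fiber :: "'g groupoid_data \<Rightarrow> 'g \<Rightarrow> 'g set" where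
  "source_fiber G x = {\<gamma> \<in> space (arrows G). src G \<gamma> = x}"

locale alg_groupoid =
  fixes G :: "'g groupoid_data"
  assumes units_subset: "units G \<subseteq> space (arrows G)"
    and rng_units: "a \<in> space (arrows G) \<Longrightarrow> rng G a \<in> units G"
    and src_units: "a \<in> space (arrows G) \<Longrightarrow> src G a \<in> units G"
    and rng_unit: "x \<in> units G \<Longrightarrow> rng G x = x"
    and src_unit: "x \<in> units G \<Longrightarrow> src G x = x"
    and mult_closed: "(a, b) \<in> composable G \<Longrightarrow> mult G a b \<in> space (arrows G)"
    and rng_mult: "(a, b) \<in> composable G \<Longrightarrow> rng G (mult G a b) = rng G a"
    and src_mult: "(a, b) \<in> composable G \<Longrightarrow> src G (mult G a b) = src G b"
    and mult_assoc: "(a, b) \<in> composable G \<Longrightarrow> (b, c) \<in> composable G \<Longrightarrow>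
                       mult G (mult G a b) c = mult G a (mult G b c)"
    and rng_mult_left: "a \<in> space (arrows G) \<Longrightarrow> mult G (rng G a) a = a"
    and src_mult_right: "a \<in> space (arrows G) \<Longrightarrow> mult G a (src G a) = a"
    and ginv_closed: "a \<in> space (arrows G) \<Longrightarrow> ginv G a \<in> space (arrows G)"
    and rng_ginv: "a \<in> space (arrows G) \<Longrightarrow> rng G (ginv G a) = src G a"
    and src_ginv: "a \<in> space (arrows G) \<Longrightarrow> src G (ginv G a) = rng G a"
    and ginv_left: "a \<in> space (arrows G) \<Longrightarrow> mult G (ginv G a) a = src G a"
    and ginv_right: "a \<in> space (arrows G) \<Longrightarrow> mult G a (ginv G a) = rng G a"

locale borel_groupoid = alg_groupoid G for G :: "'g groupoid_data" +
  assumes standard_borel_arrows: "standard_borel (arrows G)"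
    and rng_borel: "rng G \<in> measurable (arrows G) (arrows G)"
    and src_borel: "src G \<in> measurable (arrows G) (arrows G)"
    and ginv_borel: "ginv G \<in> measurable (arrows G) (arrows G)"
    and mult_borel: "(\<lambda>(a, b). mult G a b) \<in>
       measurable (restrict_space (arrows G \<Otimes>\<^sub>M arrows G) (composable G)) (arrows G)"

locale countable_borel_groupoid = borel_groupoid G for G :: "'g groupoid_data" +
  assumes countable_range_fiber: "x \<in> units G \<Longrightarrow> countable (range_fiber G x)"

section \<open>Measured groupoids\<close>

text \<open>
  The measure \<open>\<nu>\<close> is given by its values on Borel sets, i.e. by the formula
  \<open>\<integral> F d\<nu> = \<integral> (\<Sum>s(\<gamma>)=x. F \<gamma>) d\<mu>(x)\<close> for \<open>F\<close> an indicator function. On a countable Borel groupoid the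
  integrand is Borel by the Lusin-Novikov theorem, so that the set function is indeed countably
  additive and \<open>measure_of\<close> does not degenerate.
\<close>

definition gpd_measure :: "'g groupoid_data \<Rightarrow> 'g measure \<Rightarrow> 'g measure" where
  "gpd_measure G \<mu> =
     measure_of (space (arrows G)) (sets (arrows G))
       (\<lambda>A. \<integral>\<^sup>+ x. (\<integral>\<^sup>+ \<gamma>. indicator A \<gamma> \<partial>count_space (source_fiber G x)) \<partial>\<mu>)"

definition equivalent_measures :: "'a measure \<Rightarrow> 'a measure \<Rightarrow> bool" where
  "equivalent_measures M N \<longleftrightarrow> absolutely_continuous M N \<and> absolutely_continuous N M"

definition quasi_invariant :: "'g groupoid_data \<Rightarrow> 'g measure \<Rightarrow> bool" where
  "quasi_invariant G \<mu> \<longleftrightarrow>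
     equivalent_measures (gpd_measure G \<mu>) (distr (gpd_measure G \<mu>) (arrows G) (ginv G))"

locale countable_measured_groupoid =
  countable_borel_groupoid G + prob_space \<mu>
  for G :: "'g groupoid_data" and \<mu> :: "'g measure" +
  assumes space_unit_measure: "space \<mu> = units G"
    and sets_unit_measure: "sets \<mu> = sets (restrict_space (arrows G) (units G))"
    and quasi_inv: "quasi_invariant G \<mu>"

section \<open>Positive definite functions and bounded supports\<close>

text \<open>Over the complex numbers, this positivity condition entails that the matrix is Hermitian.\<close>

definition psd_matrix :: "nat \<Rightarrow> (nat \<Rightarrow> nat \<Rightarrow> complex) \<Rightarrow> bool" where
  "psd_matrix k A \<longleftrightarrow>
     (\<forall>c :: nat \<Rightarrow> complex.
        (\<Sum>i<k. \<Sum>j<k. cnj (c i) * A i j * c j) \<in> \<real> \<and>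
        0 \<le> Re (\<Sum>i<k. \<Sum>j<k. cnj (c i) * A i j * c j))"

definition positive_definite ::
    "'g groupoid_data \<Rightarrow> 'g measure \<Rightarrow> ('g \<Rightarrow> complex) \<Rightarrow> bool" where
  "positive_definite G \<mu> F \<longleftrightarrow>
     F \<in> borel_measurable (arrows G) \<and>
     (\<exists>N \<in> null_sets \<mu>. \<forall>x \<in> units G - N. \<forall>k. \<forall>\<gamma> :: nat \<Rightarrow> 'g.
        (\<forall>i<k. \<gamma> i \<in> range_fiber G x) \<longrightarrow>
        psd_matrix k (\<lambda>i j. F (mult G (ginv G (\<gamma> i)) (\<gamma> j))))"

definition bounded_subset :: "'g groupoid_data \<Rightarrow> 'g measure \<Rightarrow> 'g set \<Rightarrow> bool" where
  "bounded_subset G \<mu> Q \<longleftrightarrow>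
     Q \<in> sets (arrows G) \<and>
     (\<exists>c :: real. c > 0 \<and> (AE x in \<mu>.
        finite (Q \<inter> range_fiber G x) \<and> real (card (Q \<inter> range_fiber G x)) \<le> c \<and>
        finite (Q \<inter> source_fiber G x) \<and> real (card (Q \<inter> source_fiber G x)) \<le> c))"

definition has_bounded_support ::
    "'g groupoid_data \<Rightarrow> 'g measure \<Rightarrow> ('g \<Rightarrow> complex) \<Rightarrow> bool" where
  "has_bounded_support G \<mu> F \<longleftrightarrow>
     (\<exists>Q. bounded_subset G \<mu> Q \<and> (\<forall>\<gamma> \<in> space (arrows G) - Q. F \<gamma> = 0))"

section \<open>Amenability\<close>

definition L_infinity :: "'a measure \<Rightarrow> ('a \<Rightarrow> complex) set" where
  "L_infinity M = {f \<in> borel_measurable M. \<exists>C :: real. AE x in M. cmod (f x) \<le> C}"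

text \<open>
  Sequential convergence for the weak* topology of \<open>L_infinity M\<close>, the dual of \<open>L\<^sup>1(M)\<close> for a
  sigma-finite measure \<open>M\<close>.
\<close>

definition weak_star_tendsto ::
    "'a measure \<Rightarrow> (nat \<Rightarrow> 'a \<Rightarrow> complex) \<Rightarrow> ('a \<Rightarrow> complex) \<Rightarrow> bool" where
  "weak_star_tendsto M f g \<longleftrightarrow>
     (\<forall>n. f n \<in> L_infinity M) \<and> g \<in> L_infinity M \<and>
     (\<forall>h :: 'a \<Rightarrow> complex. integrable M h \<longrightarrow>
        (\<lambda>n. integral\<^sup>L M (\<lambda>x. f n x * h x)) \<longlonglongrightarrow> integral\<^sup>L M (\<lambda>x. g x * h x))"

text \<open>
  The series converges absolutely at almost every \<open>\<gamma>\<close> as soon as \<open>\<xi>\<close> is square-summable on almost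
  every fiber; \<open>infsum\<close> takes the value 0 at the other points.
\<close>

definition coefficient :: "'g groupoid_data \<Rightarrow> ('g \<Rightarrow> complex) \<Rightarrow> 'g \<Rightarrow> complex" where
  "coefficient G \<xi> \<gamma> =
     (\<Sum>\<^sub>\<infinity>\<gamma>1 \<in> range_fiber G (rng G \<gamma>). cnj (\<xi> \<gamma>1) * \<xi> (mult G (ginv G \<gamma>) \<gamma>1))"

definition amenable :: "'g groupoid_data \<Rightarrow> 'g measure \<Rightarrow> bool" where
  "amenable G \<mu> \<longleftrightarrow>
     (\<exists>\<xi> :: nat \<Rightarrow> 'g \<Rightarrow> complex.
        (\<forall>n. \<xi> n \<in> borel_measurable (arrows G)) \<and>
        (\<forall>n. AE x in \<mu>. ((\<lambda>\<gamma>. (cmod (\<xi> n \<gamma>))\<^sup>2) has_sum 1) (range_fiber G x)) \<and>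
        weak_star_tendsto (gpd_measure G \<mu>) (\<lambda>n. coefficient G (\<xi> n)) (\<lambda>_. 1))"

end

theory Submission
  imports Defs
begin

text \<open>
  If \<open>G\<close> is amenable, the coefficients \<open>F\<^sub>n\<close> are bounded by 1, so that weak* convergence to 1 forces
  \<open>\<integral> |F\<^sub>n - 1|\<^sup>2 h d\<nu> \<le> 2 \<integral> (1 - Re F\<^sub>n) h d\<nu> \<rightarrow> 0\<close> for an integrable weight \<open>h > 0\<close>; truncating \<open>\<xi>\<^sub>n\<close> to a
  finite union of bisections and normalising gives bounded supports, and a subsequence converges
  almost everywhere. Conversely, a positive definite \<open>F\<close> with bounded support and \<open>F = 1\<close> on units acts
  on each \<open>l\<^sup>2(G\<^sup>x)\<close> by right convolution as an operator \<open>0 \<le> T \<le> c\<close>, and \<open>F\<close> is the coefficient of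
  \<open>T\<^sup>1\<^sup>/\<^sup>2 \<delta>\<^sub>x\<close>. Replacing the square root by \<open>\<surd>c (1 - Y\<^sub>k(1 - T/c))\<close>, with \<open>Y\<^sub>k\<close> a polynomial, keeps all sums finite
  and all functions Borel.

  Both directions need fibrewise sums to be measurable, hence countably many Borel sections of the range
  map. They are only needed up to a null set, where Lusin-Novikov follows from the measurability of
  Souslin sets and a Baire category argument in the countable fibres.
\<close>

section \<open>The Souslin operation\<close>

text \<open>Left translation by an arrow carries the fibre over its source to the fibre over its
  range, so a fibrewise identity valid for almost every unit is useless if some arrow joins a good
  unit to a bad one. Quasi-invariance repairs this: every null set of units enlarges to a null set
  \<open>N\<close> closed under passing between range and source, and off \<open>N\<close> all
  identities are proved at every arrow.

  The approximation of the square root has to be uniform over all arrows, although the operators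
  vary with the fibre. This comes from a choice of polynomials for which
  \<open>(1 - Y_k)^2 - (1 - X)\<close> is exactly \<open>2 (Y_(k+1) - Y_k)\<close>, a polynomial
  with nonnegative coefficients. For a contraction \<open>L\<close>, the entries of
  \<open>D(L) e\<close> are then bounded by the number \<open>D(1)\<close>, so one scalar limit at 1
  controls all fibres at once.

  Polynomials only give coefficients close to \<open>F\<close>, hence vectors of norm close to 1;
  the norm at \<open>x\<close> is itself read off from the coefficient at the unit \<open>x\<close>,
  which makes the normalisation Borel. In the other direction \<nu> need not be finite, which is why
  a strictly positive integrable weight is used as test function.\<close>

definition souslin_op :: "(nat list \<Rightarrow> 'a set) \<Rightarrow> 'a set" where
  "souslin_op H = {z. \<exists>f. \<forall>n. z \<in> H (map f [0..<n])}"

definition souslin_sets :: "'a set set \<Rightarrow> 'a set set" where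
  "souslin_sets \<H> =
{S. \<exists>H. (\<forall>s. H s \<in> \<H>) \<and> S = souslin_op H}"

lemma map_upt_Suc_shift: "map f [0..<Suc n] = f 0 # map (\<lambda>i. f (Suc i)) [0..<n]"
  by (simp only: upt_conv_Cons[of 0 "Suc n"] map_Suc_upt[symmetric] list.map map_map comp_def zero_less_Suc)

lemma souslin_sets_basic:
  assumes "A \<in> \<H>"
  shows "A \<in> souslin_sets \<H>"
  unfolding souslin_sets_def souslin_op_def using assms by (auto intro!: exI[of _ "\<lambda>_. A"])

text \<open>The first letter of a branch selects the scheme and the remaining letters are a branch
  of it. The empty list has not yet selected anything, so it is assigned the largest set
  \<open>\<Omega>\<close>.\<close>

lemma souslin_sets_UN:
  fixes S :: "nat \<Rightarrow> 'a set"
  assumes \<Omega>: "\<Omega> \<in> \<H>" "\<And>A. A \<in> \<H> \<Longrightarrow> A \<subseteq> \<Omega>" and S: "\<And>k. S k \<in> souslin_sets \<H>"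
  shows "(\<Union>k. S k) \<in> souslin_sets \<H>"
proof -
  have "\<forall>k. \<exists>H. (\<forall>s. H s \<in> \<H>) \<and> S k = souslin_op H"
    using S unfolding souslin_sets_def by simp
  then obtain H where H: "\<And>k s. H k s \<in> \<H>" and SH: "\<And>k. S k = souslin_op (H k)"
    by metis
  define J where "J s = (case s of [] \<Rightarrow> \<Omega> | k # t \<Rightarrow> H k t)" for s :: "nat list"
  have J: "J s \<in> \<H>" for s
    by (cases s) (auto simp: J_def \<Omega> H)
  have "z \<in> (\<Union>k. S k) \<longleftrightarrow> (\<exists>f. \<forall>n. z \<in> J (map f [0..<n]))" for z
  proof
    assume "z \<in> (\<Union>k. S k)"
    then obtain k f where f: "\<And>n. z \<in> H k (map f [0..<n])"
      by (auto simp: SH souslin_op_def)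
    have "z \<in> J (map (case_nat k f) [0..<n])" for n
    proof (cases n)
      case 0
      then show ?thesis using f[of 0] \<Omega>(2)[OF H] by (auto simp: J_def)
    next
      case (Suc m)
      then show ?thesis using f[of m] by (simp only: map_upt_Suc_shift) (simp add: J_def)
    qed
    then show "\<exists>f. \<forall>n. z \<in> J (map f [0..<n])" by blast
  next
    assume "\<exists>f. \<forall>n. z \<in> J (map f [0..<n])"
    then obtain f where f: "\<And>n. z \<in> J (map f [0..<n])" by blast
    have "z \<in> H (f 0) (map (\<lambda>i. f (Suc i)) [0..<n])" for n
      using f[of "Suc n"] by (simp only: map_upt_Suc_shift) (simp add: J_def)
    then show "z \<in> (\<Union>k. S k)" by (auto simp: SH souslin_op_def)
  qed
  then have "(\<Union>k. S k) = souslin_op J" unfolding souslin_op_def by blast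
  then show ?thesis unfolding souslin_sets_def using J by blast
qed

text \<open>A list of length \<open>prod_encode (k, n)\<close> thus already contains every entry at
  a position \<open>prod_encode (k, j)\<close> with \<open>j < n\<close>; the interleaving of
  branches below reads exactly these.\<close>

lemma prod_encode_less_snd: "j < n \<Longrightarrow> prod_encode (k, j) < prod_encode (k, n)"
  by (rule lift_Suc_mono_less[where f = "\<lambda>j. prod_encode (k, j)"]) (auto simp: prod_encode_def)

text \<open>One branch interleaves countably many: letter \<open>j\<close> of branch
  \<open>k\<close> is stored at position \<open>prod_encode (k, j)\<close>. A list whose length
  codes \<open>(k, n)\<close> tests the condition at level \<open>n\<close> of scheme
  \<open>k\<close>, so all levels of all schemes are tested along a single branch.\<close>

lemma souslin_sets_INT:
  fixes S :: "nat \<Rightarrow> 'a set"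
  assumes S: "\<And>k. S k \<in> souslin_sets \<H>"
  shows "(\<Inter>k. S k) \<in> souslin_sets \<H>"
proof -
  have "\<forall>k. \<exists>H. (\<forall>s. H s \<in> \<H>) \<and> S k = souslin_op H"
    using S unfolding souslin_sets_def by simp
  then obtain H where H: "\<And>k s. H k s \<in> \<H>" and SH: "\<And>k. S k = souslin_op (H k)"
    by metis
  define J where
    "J s = (case prod_decode (length s) of (k, n) \<Rightarrow> H k (map (\<lambda>j. s ! prod_encode (k, j)) [0..<n]))"
    for s :: "nat list"
  have J: "J s \<in> \<H>" for s
    by (auto simp: J_def H split: prod.splits)
  have Jf: "J (map f [0..<prod_encode (k, n)]) = H k (map (\<lambda>j. f (prod_encode (k, j))) [0..<n])"
    for f k n
    unfolding J_def by (auto simp: prod_encode_less_snd intro!: arg_cong[where f = "H k"])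
  have "z \<in> (\<Inter>k. S k) \<longleftrightarrow> (\<exists>f. \<forall>n. z \<in> J (map f [0..<n]))" for z
  proof
    assume "z \<in> (\<Inter>k. S k)"
    then have "\<forall>k. \<exists>f. \<forall>n. z \<in> H k (map f [0..<n])" by (auto simp: SH souslin_op_def)
    then obtain g where g: "\<And>k n. z \<in> H k (map (g k) [0..<n])" by metis
    define f where "f i = (case prod_decode i of (k, j) \<Rightarrow> g k j)" for i
    have "z \<in> J (map f [0..<n])" for n
      using g Jf[of f "fst (prod_decode n)" "snd (prod_decode n)"] by (simp add: f_def)
    then show "\<exists>f. \<forall>n. z \<in> J (map f [0..<n])" by blast
  next
    assume "\<exists>f. \<forall>n. z \<in> J (map f [0..<n])"
    then obtain f where f: "\<And>n. z \<in> J (map f [0..<n])" by blast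
    have "z \<in> H k (map (\<lambda>j. f (prod_encode (k, j))) [0..<n])" for k n
      using f[of "prod_encode (k, n)"] by (simp add: Jf)
    then have "z \<in> S k" for k unfolding SH souslin_op_def mem_Collect_eq by blast
    then show "z \<in> (\<Inter>k. S k)" by blast
  qed
  then have "(\<Inter>k. S k) = souslin_op J" unfolding souslin_op_def by blast
  then show ?thesis unfolding souslin_sets_def using J by blast
qed

lemma souslin_sets_Un:
  assumes "\<Omega> \<in> \<H>" "\<And>A. A \<in> \<H> \<Longrightarrow> A \<subseteq> \<Omega>" "A \<in> souslin_sets \<H>" "B \<in> souslin_sets \<H>"
  shows "A \<union> B \<in> souslin_sets \<H>"
proof -
  have "case_nat A (\<lambda>_. B) k \<in> souslin_sets \<H>" for k :: nat
    using assms by (cases k) auto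
  then have "(\<Union>n::nat. case_nat A (\<lambda>_. B) n) \<in> souslin_sets \<H>"
    using souslin_sets_UN[where S = "case_nat A (\<lambda>_. B)"] assms(1,2) by blast
  moreover have "(\<Union>n::nat. case_nat A (\<lambda>_. B) n) = A \<union> B"
    by (auto split: nat.splits)
  ultimately show ?thesis by simp
qed

lemma souslin_sets_Int:
  assumes "A \<in> souslin_sets \<H>" "B \<in> souslin_sets \<H>"
  shows "A \<inter> B \<in> souslin_sets \<H>"
proof -
  have "A \<inter> B = (\<Inter>n::nat. case_nat A (\<lambda>_. B) n)"
    by (auto split: nat.splits)
  then show ?thesis
    using souslin_sets_INT[of "case_nat A (\<lambda>_. B)" \<H>] assms by (simp split: nat.splits)
qed

section \<open>Infinite branches obtained from finite lists\<close>

lemma list_chain_limit: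
  fixes s :: "nat \<Rightarrow> 'a list"
  assumes "\<And>k. \<exists>u. u \<noteq> [] \<and> s (Suc k) = s k @ u"
  obtains f where "\<And>k. map f [0..<length (s k)] = s k" "\<And>k. k \<le> length (s k)"
proof -
  have len: "k \<le> length (s k)" for k
  proof (induction k)
    case (Suc k)
    obtain u where "u \<noteq> []" "s (Suc k) = s k @ u" using assms by blast
    then show ?case using Suc by (cases u) auto
  qed simp
  have ext: "\<exists>u. s (k + d) = s k @ u" for k d
  proof (induction d)
    case (Suc d)
    then show ?case using assms[of "k + d"] by force
  qed simp
  have nth: "s k ! i = s l ! i" if "i < length (s k)" "i < length (s l)" for i k l
  proof (cases "k \<le> l")
    case True
    then obtain u where "s l = s k @ u" using ext[of k "l - k"] by auto
    then show ?thesis using that by (simp add: nth_append)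
  next
    case False
    then obtain u where "s k = s l @ u" using ext[of l "k - l"] by auto
    then show ?thesis using that by (simp add: nth_append)
  qed
  \<comment> \<open>The list \<open>s (Suc i)\<close> has at least \<open>Suc i\<close> entries, so
    its entry at \<open>i\<close> exists; by \<open>nth\<close> any other long enough list of the
    chain gives the same entry.\<close>
  define f where "f i = s (Suc i) ! i" for i
  have "map f [0..<length (s k)] = s k" for k
  proof (rule nth_equalityI)
    fix i assume "i < length (map f [0..<length (s k)])"
    then show "map f [0..<length (s k)] ! i = s k ! i"
      using nth[of i "Suc i" k] len[of "Suc i"] by (simp add: f_def)
  qed simp
  then show ?thesis using len that by blast
qed

lemma list_branch:
  assumes "Q []" "\<And>s. Q s \<Longrightarrow> \<exists>k. Q (s @ [k])"
  shows "\<exists>f. \<forall>n. Q (map f [0..<n])"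
proof -
  have "\<exists>t. \<forall>n. (Q (t n) \<and> length (t n) = n) \<and> (\<exists>k. t (Suc n) = t n @ [k])"
    by (rule dependent_nat_choice[where P = "\<lambda>n s. Q s \<and> length s = n"])
      (use assms in \<open>force+\<close>)
  then obtain t where t: "\<And>n. Q (t n)" "\<And>n. length (t n) = n" "\<And>n. \<exists>k. t (Suc n) = t n @ [k]"
    by blast
  obtain f where "\<And>k. map f [0..<length (t k)] = t k"
    using list_chain_limit[of t] t(3) by (metis list.distinct(1))
  then have "\<forall>n. Q (map f [0..<n])" using t(1,2) by metis
  then show ?thesis by blast
qed

section \<open>Exhaustion, envelopes and measurability of Souslin sets\<close>

text \<open>The exhaustion principle: the union of a sequence whose measures approach the supremum
  attains it, and a member of \<open>D\<close> adding positive measure to this union would exceed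
  the supremum.\<close>

lemma (in finite_measure) maximal_set_mod_null:
  assumes D: "D \<subseteq> sets M" "D \<noteq> {}" "\<And>A :: nat \<Rightarrow> 'a set. range A \<subseteq> D \<Longrightarrow> (\<Union>n. A n) \<in> D"
  shows "\<exists>A\<in>D. \<forall>B\<in>D. B - A \<in> null_sets M"
proof -
  define a where "a = Sup (measure M ` D)"
  have bdd: "bdd_above (measure M ` D)"
    using bounded_measure by (intro bdd_aboveI[of _ "measure M (space M)"]) auto
  have "\<exists>A\<in>D. a - 1 / Suc n < measure M A" for n
    using less_cSup_iff[of "measure M ` D" "a - 1 / Suc n"] bdd D(2) by (auto simp: a_def)
  then obtain A where A: "\<And>n. A n \<in> D" "\<And>n. a - 1 / Suc n < measure M (A n)"
    by metis
  define U where "U = (\<Union>n. A n)"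
  have U: "U \<in> D" using A D(3) by (auto simp: U_def)
  have le: "measure M B \<le> a" if "B \<in> D" for B
    unfolding a_def using that bdd by (auto intro: cSup_upper)
  have "a \<le> measure M U"
  proof (rule field_le_epsilon)
    fix e :: real assume "e > 0"
    then obtain n where "1 / Suc n < e" using nat_approx_posE by metis
    moreover have "measure M (A n) \<le> measure M U"
      using U D(1) by (intro finite_measure_mono) (auto simp: U_def)
    ultimately show "a \<le> measure M U + e" using A(2)[of n] by simp
  qed
  have "measure M (B - U) = 0" if "B \<in> D" for B
  proof -
    have BU: "B \<in> sets M" "U \<in> sets M" using that U D(1) by auto
    have "U \<union> B = (\<Union>n::nat. case_nat U (\<lambda>_. B) n)"
      by (auto split: nat.splits)
    then have "U \<union> B \<in> D" using D(3)[of "case_nat U (\<lambda>_. B)"] that U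
      by (simp add: image_subset_iff split: nat.splits)
    then have "measure M (U \<union> B) \<le> a" by (rule le)
    moreover have "measure M (U \<union> B) = measure M U + measure M (B - U)"
      using BU finite_measure_Union[of U "B - U"] by auto
    ultimately show ?thesis using \<open>a \<le> measure M U\<close> measure_nonneg[of M "B - U"] by linarith
  qed
  moreover have "B - U \<in> sets M" if "B \<in> D" for B
    using that U D(1) by auto
  ultimately have "\<forall>B\<in>D. B - U \<in> null_sets M"
    by (simp add: null_sets_def emeasure_eq_measure)
  then show ?thesis using U by blast
qed

text \<open>The envelope is what remains of \<open>B\<close> after removing a measurable set that is
  largest, up to null sets, among those missing \<open>A\<close>.\<close>

lemma (in finite_measure) measurable_envelope:
  assumes "A \<subseteq> B" "B \<in> sets M"
  shows "\<exists>E\<in>sets M. A \<subseteq> E \<and> E \<subseteq> B \<and> (\<forall>C\<in>sets M. C \<subseteq> E - A \<longrightarrow> C \<in> null_sets M)"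
proof -
  define D where "D = {C \<in> sets M. C \<inter> A = {}}"
  have D: "D \<subseteq> sets M" "D \<noteq> {}" "\<And>F :: nat \<Rightarrow> 'a set. range F \<subseteq> D \<Longrightarrow> (\<Union>n. F n) \<in> D"
    by (auto simp: D_def intro!: sets.countable_UN)
  obtain U where U: "U \<in> D" "\<And>C. C \<in> D \<Longrightarrow> C - U \<in> null_sets M"
    using maximal_set_mod_null[OF D] by blast
  have "C \<in> null_sets M" if "C \<in> sets M" "C \<subseteq> B - U - A" for C
  proof -
    have "C - U = C" using that by auto
    moreover have "C \<in> D" using that by (auto simp: D_def)
    ultimately show ?thesis using U(2)[of C] by simp
  qed
  moreover have "B - U \<in> sets M" "A \<subseteq> B - U"
    using U(1) assms by (auto simp: D_def)
  ultimately show ?thesis by blast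
qed

text \<open>
  Replacing each branching set by a measurable envelope loses only countably many null sets.
\<close>

lemma souslin_measurable:
  fixes H :: "nat list \<Rightarrow> 'a set"
  assumes fin: "finite_measure M" and compl: "complete_measure M" and H: "\<And>s. H s \<in> sets M"
  shows "souslin_op H \<in> sets M"
proof -
  interpret finite_measure M by fact
  interpret complete_measure M by fact
  \<comment> \<open>The part of the Souslin set reached by branches through \<open>s\<close>;
    \<open>S []\<close> is the whole set.\<close>
  define S where "S s = {x. \<exists>f. map f [0..<length s] = s \<and> (\<forall>n. x \<in> H (map f [0..<n]))}" for s
  have S_sub: "S s \<subseteq> H s" for s
  proof
    fix x assume "x \<in> S s"
    then obtain f where "map f [0..<length s] = s" "x \<in> H (map f [0..<length s])"
      unfolding S_def by blast
    then show "x \<in> H s" by simp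
  qed
  have "\<forall>s. \<exists>E. E \<in> sets M \<and> S s \<subseteq> E \<and> E \<subseteq> H s \<and> (\<forall>C\<in>sets M. C \<subseteq> E - S s \<longrightarrow> C \<in> null_sets M)"
    using measurable_envelope[OF S_sub H] by (simp add: Bex_def)
  from choice[OF this] obtain E where E': "\<forall>s. E s \<in> sets M \<and> S s \<subseteq> E s \<and> E s \<subseteq> H s \<and>
      (\<forall>C\<in>sets M. C \<subseteq> E s - S s \<longrightarrow> C \<in> null_sets M)" ..
  then have E: "E s \<in> sets M" "S s \<subseteq> E s" "E s \<subseteq> H s"
    "C \<in> sets M \<Longrightarrow> C \<subseteq> E s - S s \<Longrightarrow> C \<in> null_sets M" for s C
    by simp_all
  \<comment> \<open>The part of the envelope at \<open>s\<close> that no envelope of a child covers.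
    Since \<open>S s\<close> is covered by the sets \<open>S\<close> of the children,
    \<open>N s\<close> misses \<open>S s\<close> and is null by minimality of the envelope.\<close>
  define N where "N s = E s - (\<Union>k. E (s @ [k]))" for s
  have S_split: "S s \<subseteq> (\<Union>k. S (s @ [k]))" for s
  proof
    fix x assume "x \<in> S s"
    then obtain f where f: "map f [0..<length s] = s" "\<forall>n. x \<in> H (map f [0..<n])"
      by (auto simp: S_def)
    then have "x \<in> S (s @ [f (length s)])"
      unfolding S_def mem_Collect_eq by (intro exI[of _ f]) simp
    then show "x \<in> (\<Union>k. S (s @ [k]))" by blast
  qed
  have N: "N s \<in> null_sets M" for s
  proof (rule E(4))
    show "N s \<in> sets M" unfolding N_def using E(1) by auto
    show "N s \<subseteq> E s - S s" 
    proof
      fix x assume "x \<in> N s"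
      then have "x \<in> E s" "x \<notin> (\<Union>k. S (s @ [k]))" using E(2) by (auto simp: N_def)
      then show "x \<in> E s - S s" using S_split[of s] by auto
    qed
  qed
  have UN: "(\<Union>s. N s) \<in> null_sets M" using N by (intro null_sets_UN') auto
  \<comment> \<open>A point of \<open>E []\<close> outside every \<open>N s\<close> can always be
    followed to a child, hence along an infinite branch of envelopes. As \<open>E s\<close> lies in
    \<open>H s\<close>, the point belongs to the Souslin set.\<close>
  have "E [] - S [] \<subseteq> (\<Union>s. N s)"
  proof
    fix x assume x: "x \<in> E [] - S []"
    show "x \<in> (\<Union>s. N s)"
    proof (rule ccontr)
      assume no: "x \<notin> (\<Union>s. N s)"
      have "\<exists>f. \<forall>n. x \<in> E (map f [0..<n])"
      proof (rule list_branch)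
        show "x \<in> E []" using x by simp
        show "\<exists>k. x \<in> E (s @ [k])" if "x \<in> E s" for s
          using no that by (auto simp: N_def)
      qed
      then obtain f where "\<forall>n. x \<in> E (map f [0..<n])" ..
      then have "\<forall>n. x \<in> H (map f [0..<n])" using E(3) by blast
      then have "x \<in> S []" unfolding S_def mem_Collect_eq by (intro exI[of _ f]) simp
      then show False using x by simp
    qed
  qed
  then have "E [] - S [] \<in> sets M" using UN by (rule complete)
  then have "E [] - (E [] - S []) \<in> sets M" using E(1)[of "[]"] by (rule sets.Diff[rotated])
  moreover have "E [] - (E [] - S []) = S []" using E(2)[of "[]"] by blast
  ultimately show ?thesis by (simp add: S_def souslin_op_def)
qed

section \<open>Countable-to-one maps almost everywhere\<close>

text \<open>Only a cover of \<open>B\<close> by measurable partial sections is requested, and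
  \<open>B\<close> itself may be arbitrary. This makes the notion hereditary, so it applies to sets
  described by branches whose measurability is unknown.\<close>

definition thin :: "'x measure \<Rightarrow> 'y measure \<Rightarrow> ('y \<Rightarrow> 'x) \<Rightarrow> 'y set \<Rightarrow> bool" where
  "thin \<mu> \<Y> r B \<longleftrightarrow> (\<exists>E Z. (\<forall>n::nat. E n \<in> sets \<Y> \<and> inj_on r (E n)) \<and> Z \<in> null_sets \<mu> \<and>
     (\<forall>y\<in>B. r y \<in> Z \<or> (\<exists>n. y \<in> E n)))"

lemma thin_subset: "thin \<mu> \<Y> r B \<Longrightarrow> A \<subseteq> B \<Longrightarrow> thin \<mu> \<Y> r A"
  unfolding thin_def by (meson subset_iff)

lemma thin_UN:
  fixes B :: "'i::countable \<Rightarrow> 'y set"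
  assumes "\<And>i. thin \<mu> \<Y> r (B i)"
  shows "thin \<mu> \<Y> r (\<Union>i. B i)"
proof -
  have "\<forall>i. \<exists>E Z. (\<forall>n::nat. E n \<in> sets \<Y> \<and> inj_on r (E n)) \<and> Z \<in> null_sets \<mu> \<and>
     (\<forall>y\<in>B i. r y \<in> Z \<or> (\<exists>n. y \<in> E n))"
    using assms unfolding thin_def by blast
  then obtain E :: "'i \<Rightarrow> nat \<Rightarrow> 'y set" and Z
    where E: "\<And>i n. E i n \<in> sets \<Y>" "\<And>i n. inj_on r (E i n)" "\<And>i. Z i \<in> null_sets \<mu>"
      "\<And>i y. y \<in> B i \<Longrightarrow> r y \<in> Z i \<or> (\<exists>n. y \<in> E i n)"
    by metis
  define F where "F k = (case prod_decode k of (i, n) \<Rightarrow> E (from_nat i) n)" for k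
  have "F k \<in> sets \<Y> \<and> inj_on r (F k)" for k
    by (auto simp: F_def E split: prod.splits)
  moreover have "(\<Union>i. Z i) \<in> null_sets \<mu>" using E(3) by (rule null_sets_UN)
  moreover have "r y \<in> (\<Union>i. Z i) \<or> (\<exists>k. y \<in> F k)" if y: "y \<in> (\<Union>i. B i)" for y
  proof -
    obtain i where i: "y \<in> B i" using y by blast
    have "y \<in> E i n \<Longrightarrow> y \<in> F (prod_encode (to_nat i, n))" for n by (simp add: F_def)
    then show ?thesis using E(4)[OF i] by blast
  qed
  ultimately show ?thesis unfolding thin_def by blast
qed

text \<open>Trades sets of the completion for sets of \<open>\<mu>\<close> off one null set common
  to the whole countable family; each of them differs from a set of \<open>\<mu>\<close> only inside
  a null set.\<close>

lemma completion_null_difference: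
  assumes "\<And>i :: 'i :: countable. P i \<in> sets (completion \<mu>)"
  shows "\<exists>Z\<in>null_sets \<mu>. \<forall>i. P i - Z \<in> sets \<mu>"
proof -
  have "\<exists>Z\<in>null_sets \<mu>. P i - Z \<in> sets \<mu>" for i
    using assms[of i]
  proof (rule sets_completionE)
    fix S N N' assume *: "P i = S \<union> N" "N \<subseteq> N'" "N' \<in> null_sets \<mu>" "S \<in> sets \<mu>"
    then have "P i - N' = S - N'" by auto
    then show ?thesis using * by (auto intro!: bexI[of _ N'])
  qed
  then obtain Z where Z: "\<And>i. Z i \<in> null_sets \<mu>" "\<And>i. P i - Z i \<in> sets \<mu>" by metis
  have "(\<Union>i. Z i) \<in> null_sets \<mu>" using Z(1) by (rule null_sets_UN)
  moreover have "P i - (\<Union>i. Z i) \<in> sets \<mu>" for i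
  proof -
    have "P i - (\<Union>i. Z i) = (P i - Z i) - (\<Union>i. Z i)" by auto
    then show ?thesis using Z \<open>(\<Union>i. Z i) \<in> null_sets \<mu>\<close> by auto
  qed
  ultimately show ?thesis by blast
qed

section \<open>Countable-to-one projections coded by branches\<close>

text \<open>Branches code points of the fibres. The conditions \<open>M\<close> concern the base
  point alone, yet a branch satisfying all of them at \<open>x\<close> is guaranteed to lead to a
  point over \<open>x\<close>. Thus the fibre over \<open>x\<close> is parametrised by a closed set
  of branches. By \<open>separate\<close>, two distinct points lie in disjoint cells
  \<open>C\<close> from some level on, whichever codes are used.\<close>

locale souslin_fibration =
  fixes \<mu> :: "'x measure" and \<Y> :: "'y measure" and r :: "'y \<Rightarrow> 'x"
    and M :: "nat list \<Rightarrow> 'x set" and C :: "nat list \<Rightarrow> 'y set"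
  assumes finite_base: "finite_measure \<mu>"
    and r_measurable: "r \<in> measurable \<Y> \<mu>"
    and M_sets: "M s \<in> sets \<mu>"
    and C_sets: "C s \<in> sets \<Y>"
    and C_step: "C (s @ [k]) \<subseteq> C s"
    and separate: "y \<in> space \<Y> \<Longrightarrow> y' \<in> space \<Y> \<Longrightarrow> y \<noteq> y' \<Longrightarrow>
      \<exists>m. \<forall>s s'. m \<le> length s \<longrightarrow> length s = length s' \<longrightarrow> y \<in> C s \<longrightarrow> y' \<in> C s' \<longrightarrow> C s \<inter> C s' = {}"
    and branch_point: "(\<And>n. x \<in> M (map f [0..<n])) \<Longrightarrow>
      \<exists>y\<in>space \<Y>. r y = x \<and> (\<forall>n. y \<in> C (map f [0..<n]))"
    and point_branch: "y \<in> space \<Y> \<Longrightarrow> \<exists>f. \<forall>n. r y \<in> M (map f [0..<n]) \<and> y \<in> C (map f [0..<n])"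
begin

lemma completion_souslin:
  assumes "\<And>s. H s \<in> sets \<mu>"
  shows "souslin_op H \<in> sets (completion \<mu>)"
proof (rule souslin_measurable)
  show "finite_measure (completion \<mu>)"
    using finite_measure.emeasure_finite[OF finite_base]
    by (intro finite_measureI) simp
  show "complete_measure (completion \<mu>)" by (rule completion.complete_measure_axioms)
qed (use assms in auto)

text \<open>By the two branch conditions the image is exactly the Souslin set of \<open>M\<close>,
  although an image of a Borel set need not be Borel.\<close>

lemma image_completion: "r ` space \<Y> \<in> sets (completion \<mu>)"
proof -
  have "r ` space \<Y> = souslin_op M"
  proof (intro set_eqI iffI)
    fix x assume "x \<in> r ` space \<Y>"
    then obtain y where y: "y \<in> space \<Y>" "x = r y" by blast
    then obtain f where "\<forall>n. x \<in> M (map f [0..<n])" using point_branch[OF y(1)] by metis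
    then show "x \<in> souslin_op M" unfolding souslin_op_def mem_Collect_eq by blast
  next
    fix x assume "x \<in> souslin_op M"
    then obtain f where "\<And>n. x \<in> M (map f [0..<n])" unfolding souslin_op_def by blast
    then show "x \<in> r ` space \<Y>" using branch_point[of x f] by auto
  qed
  then show ?thesis using completion_souslin M_sets by simp
qed

definition piece :: "nat list \<Rightarrow> 'x set \<Rightarrow> 'y set" where
  "piece s B = {y \<in> space \<Y>. r y \<in> B \<and>
     (\<exists>f. map f [0..<length s] = s \<and> (\<forall>n. r y \<in> M (map f [0..<n]) \<and> y \<in> C (map f [0..<n])))}"

text \<open>Countable unions of bases preserve thinness, so exhaustion applies. Its purpose is the
  second conjunct: any further base over which the piece at \<open>s\<close> is thin must lie in the
  maximal one up to a null set.\<close>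

lemma maximal_thin_base: "\<exists>A\<in>sets \<mu>. thin \<mu> \<Y> r (piece s A) \<and>
  (\<forall>B\<in>sets \<mu>. thin \<mu> \<Y> r (piece s B) \<longrightarrow> B - A \<in> null_sets \<mu>)"
proof -
  define D where "D = {B \<in> sets \<mu>. thin \<mu> \<Y> r (piece s B)}"
  have "\<exists>A\<in>D. \<forall>B\<in>D. B - A \<in> null_sets \<mu>"
  proof (rule finite_measure.maximal_set_mod_null[OF finite_base])
    have "thin \<mu> \<Y> r (piece s {})"
      unfolding thin_def piece_def by (auto intro!: exI[of _ "\<lambda>_. {}"])
    then show "D \<noteq> {}" by (auto simp: D_def)
    fix A :: "nat \<Rightarrow> 'x set" assume A: "range A \<subseteq> D"
    have "piece s (\<Union>n. A n) = (\<Union>n. piece s (A n))" by (auto simp: piece_def)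
    moreover have "thin \<mu> \<Y> r (\<Union>n. piece s (A n))"
      using A by (intro thin_UN) (auto simp: D_def)
    moreover have "(\<Union>n. A n) \<in> sets \<mu>"
      using A by (intro sets.countable_UN) (auto simp: D_def)
    ultimately show "(\<Union>n. A n) \<in> D" by (simp add: D_def)
  qed (auto simp: D_def)
  then show ?thesis by (auto simp: D_def)
qed

text \<open>The base points that still have a branch through \<open>s\<close> after the bases
  \<open>A\<close> already dealt with are removed at every node; the set of these branches over a
  fixed \<open>x\<close> is closed.\<close>

definition rest :: "(nat list \<Rightarrow> 'x set) \<Rightarrow> nat list \<Rightarrow> 'x set" where
  "rest A s = {x. \<exists>f. map f [0..<length s] = s \<and> (\<forall>n. x \<in> M (map f [0..<n]) - A (map f [0..<n]))}"

text \<open>No two nodes below \<open>s\<close> that are still alive at \<open>x\<close> have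
  disjoint cells. By \<open>separate\<close>, all surviving branches through \<open>s\<close> then
  end at the same point over \<open>x\<close>.\<close>

definition single :: "(nat list \<Rightarrow> 'x set) \<Rightarrow> nat list \<Rightarrow> 'x set" where
  "single A s = rest A s - (\<Union>(u, v)\<in>{(u, v). C (s @ u) \<inter> C (s @ v) = {}}. rest A (s @ u) \<inter> rest A (s @ v))"

lemma rest_sets:
  assumes "\<And>s. A s \<in> sets \<mu>"
  shows "rest A s \<in> sets (completion \<mu>)"
proof -
  \<comment> \<open>The equation between the two \<open>take\<close>s says that one of
    \<open>s\<close> and \<open>t\<close> is a prefix of the other. Lists incompatible with
    \<open>s\<close> get the empty set, so only branches through \<open>s\<close> survive.\<close>
  have "rest A s = souslin_op (\<lambda>t. if take (length t) s = take (length s) t then M t - A t else {})"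
    (is "_ = souslin_op ?H")
  proof (intro set_eqI iffI)
    fix x assume "x \<in> rest A s"
    then obtain f where f: "map f [0..<length s] = s" "\<And>n. x \<in> M (map f [0..<n]) - A (map f [0..<n])"
      unfolding rest_def by blast
    have "take n s = take (length s) (map f [0..<n])" for n
    proof (rule nth_equalityI)
      fix i assume i: "i < length (take n s)"
      have "s ! i = map f [0..<length s] ! i" using f(1) by simp
      then show "take n s ! i = take (length s) (map f [0..<n]) ! i" using i by simp
    qed simp
    then have "\<forall>n. x \<in> ?H (map f [0..<n])" using f(2) by simp
    then show "x \<in> souslin_op ?H" unfolding souslin_op_def mem_Collect_eq by blast
  next
    fix x assume "x \<in> souslin_op ?H"
    then obtain f where f: "\<And>n. x \<in> ?H (map f [0..<n])" unfolding souslin_op_def by blast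
    have f': "take n s = take (length s) (map f [0..<n]) \<and> x \<in> M (map f [0..<n]) - A (map f [0..<n])" for n
      using f[of n] by (simp split: if_splits)
    from f'[of "length s"] have "map f [0..<length s] = s" by simp
    then show "x \<in> rest A s" unfolding rest_def mem_Collect_eq using f' by blast
  qed
  also have "\<dots> \<in> sets (completion \<mu>)" using assms M_sets by (intro completion_souslin) auto
  finally show ?thesis .
qed

lemma map_upt_prefix:
  assumes "map f [0..<length s] = s" "length s \<le> n"
  shows "\<exists>u. map f [0..<n] = s @ u"
proof -
  have "map f [0..<length s + (n - length s)] = s @ map f [length s..<n]"
    using assms by (subst upt_add_eq_append) auto
  then show ?thesis using assms(2) by auto
qed

text \<open>Two distinct points would lie in disjoint cells at some level, with both nodes alive at
  \<open>x\<close>, which \<open>single\<close> excludes. The hypotheses ask for a node at each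
  level rather than for one branch, so that they can be expressed by countable operations.\<close>

lemma single_unique:
  assumes x: "x \<in> single A s"
    and y: "y \<in> space \<Y>" "\<And>n. length s \<le> n \<Longrightarrow> \<exists>u. length (s @ u) = n \<and> y \<in> C (s @ u) \<and> x \<in> rest A (s @ u)"
    and y': "y' \<in> space \<Y>" "\<And>n. length s \<le> n \<Longrightarrow> \<exists>u. length (s @ u) = n \<and> y' \<in> C (s @ u) \<and> x \<in> rest A (s @ u)"
  shows "y = y'"
proof (rule ccontr)
  assume "y \<noteq> y'"
  then obtain m where m: "\<And>t t'. m \<le> length t \<Longrightarrow> length t = length t' \<Longrightarrow> y \<in> C t \<Longrightarrow> y' \<in> C t' \<Longrightarrow> C t \<inter> C t' = {}"
    using separate[OF y(1) y'(1)] by blast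
  define n where "n = max m (length s)"
  have n: "m \<le> n" "length s \<le> n" by (auto simp: n_def)
  obtain u where u: "length (s @ u) = n" "y \<in> C (s @ u)" "x \<in> rest A (s @ u)" using y(2)[OF n(2)] by blast
  obtain u' where u': "length (s @ u') = n" "y' \<in> C (s @ u')" "x \<in> rest A (s @ u')" using y'(2)[OF n(2)] by blast
  have "C (s @ u) \<inter> C (s @ u') = {}" using m[of "s @ u" "s @ u'"] u u' n(1) by simp
  then show False using x u(3) u'(3) unfolding single_def by blast
qed

lemma rest_branch:
  assumes "map f [0..<length s] = s" "\<And>n. x \<in> M (map f [0..<n]) - A (map f [0..<n])"
    "\<And>n. y \<in> C (map f [0..<n])" "length s \<le> n"
  shows "\<exists>u. length (s @ u) = n \<and> y \<in> C (s @ u) \<and> x \<in> rest A (s @ u)"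
proof -
  obtain u where u: "map f [0..<n] = s @ u" using map_upt_prefix[OF assms(1,4)] by blast
  have "length (map f [0..<n]) = n" by simp
  then have len: "length (s @ u) = n" using u by simp
  moreover have "y \<in> C (s @ u)" using assms(3)[of n] u by simp
  moreover have "x \<in> rest A (s @ u)"
    unfolding rest_def mem_Collect_eq using assms(2) u len by (intro exI[of _ f]) simp
  ultimately show ?thesis by blast
qed

text \<open>A point over \<open>single A s\<close> with a code through \<open>s\<close> either meets
  some base \<open>A t\<close> along its code, and then lies in a piece already known to be thin, or
  its code survives to the end. The points of the second kind lie in one measurable set on which
  \<open>r\<close> is injective.\<close>

lemma thin_single:
  assumes A: "\<And>s. A s \<in> sets \<mu>" "\<And>s. thin \<mu> \<Y> r (piece s (A s))"
    and Z: "Z \<in> null_sets \<mu>" "\<And>s. rest A s - Z \<in> sets \<mu>"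
  shows "single A s - Z \<in> sets \<mu>" "thin \<mu> \<Y> r (piece s (single A s - Z))"
proof -
  have eq: "single A s - Z = (rest A s - Z) - (\<Union>(u, v)\<in>{(u, v). C (s @ u) \<inter> C (s @ v) = {}}.
      (rest A (s @ u) - Z) \<inter> (rest A (s @ v) - Z))"
    unfolding single_def by blast
  show S: "single A s - Z \<in> sets \<mu>"
  proof -
    define R where "R t = rest A t - Z" for t
    have "R t \<in> sets \<mu>" for t using Z(2) by (simp add: R_def)
    then show ?thesis
      unfolding eq R_def[symmetric] by (intro sets.Diff sets.countable_UN') auto
  qed
  \<comment> \<open>Quantifying over branches would be an uncountable union. Asking instead for a
    suitable node at each level keeps the set measurable and still suffices for
    \<open>single_unique\<close>.\<close>
  define E where "E = {y \<in> space \<Y>. r y \<in> single A s - Z} \<inter>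
     (\<Inter>n. \<Union>u\<in>{u. length (s @ u) = length s + n}. C (s @ u) \<inter> {y \<in> space \<Y>. r y \<in> rest A (s @ u) - Z})"
  have ms: "{y \<in> space \<Y>. r y \<in> B} \<in> sets \<Y>" if "B \<in> sets \<mu>" for B
    using measurable_sets[OF r_measurable that] by (simp add: vimage_def Int_def conj_commute)
  have "E \<in> sets \<Y>"
    unfolding E_def using ms[OF S] ms[OF Z(2)] C_sets
    by (intro sets.Int sets.countable_INT sets.countable_UN') auto
  have E: "y \<in> space \<Y>" "r y \<in> single A s"
    "\<exists>u. length (s @ u) = n \<and> y \<in> C (s @ u) \<and> r y \<in> rest A (s @ u)"
    if y: "y \<in> E" and "length s \<le> n" for y n
  proof -
    show "y \<in> space \<Y>" "r y \<in> single A s" using y by (auto simp: E_def)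
    have "y \<in> (\<Union>u\<in>{u. length (s @ u) = length s + (n - length s)}. C (s @ u) \<inter> {y \<in> space \<Y>. r y \<in> rest A (s @ u) - Z})"
      using y unfolding E_def by blast
    then show "\<exists>u. length (s @ u) = n \<and> y \<in> C (s @ u) \<and> r y \<in> rest A (s @ u)"
      using \<open>length s \<le> n\<close> by auto
  qed
  have "inj_on r E"
  proof (rule inj_onI)
    fix y y' assume y: "y \<in> E" "y' \<in> E" "r y = r y'"
    show "y = y'"
      by (rule single_unique[of "r y" A s]) (use E[OF y(1)] E[OF y(2)] y(3) in auto)
  qed
  have tE: "thin \<mu> \<Y> r E"
    unfolding thin_def using \<open>E \<in> sets \<Y>\<close> \<open>inj_on r E\<close> by (intro exI[of _ "\<lambda>_. E"] exI[of _ "{}"]) auto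
  \<comment> \<open>The option type indexes one countable family: \<open>None\<close> stands for the
    section \<open>E\<close>, \<open>Some t\<close> for the thin piece at \<open>t\<close>.\<close>
  have "piece s (single A s - Z) \<subseteq> (\<Union>t. case t of None \<Rightarrow> E | Some t \<Rightarrow> piece t (A t))"
  proof
    fix y assume y: "y \<in> piece s (single A s - Z)"
    then obtain f where f: "map f [0..<length s] = s" "\<And>n. r y \<in> M (map f [0..<n]) \<and> y \<in> C (map f [0..<n])"
      and y': "y \<in> space \<Y>" "r y \<in> single A s - Z"
      unfolding piece_def by blast
    show "y \<in> (\<Union>t. case t of None \<Rightarrow> E | Some t \<Rightarrow> piece t (A t))"
    proof (cases "\<exists>n. r y \<in> A (map f [0..<n])")
      case True
      then obtain n where "r y \<in> A (map f [0..<n])" ..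
      then have "y \<in> piece (map f [0..<n]) (A (map f [0..<n]))"
        unfolding piece_def mem_Collect_eq using f y' by (intro conjI exI[of _ f]) simp_all
      then have "y \<in> (case Some (map f [0..<n]) of None \<Rightarrow> E | Some t \<Rightarrow> piece t (A t))" by simp
      then show ?thesis by blast
    next
      case False
      have "\<exists>u. length (s @ u) = length s + n \<and> y \<in> C (s @ u) \<and> r y \<in> rest A (s @ u)" for n
        by (rule rest_branch[OF f(1)]) (use f(2) False in auto)
      then have "y \<in> E" unfolding E_def using y' by auto
      then have "y \<in> (case None of None \<Rightarrow> E | Some t \<Rightarrow> piece t (A t))" by simp
      then show ?thesis by blast
    qed
  qed
  moreover have "thin \<mu> \<Y> r (\<Union>t. case t of None \<Rightarrow> E | Some t \<Rightarrow> piece t (A t))"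
    using tE A(2) by (intro thin_UN) (auto split: option.splits)
  ultimately show "thin \<mu> \<Y> r (piece s (single A s - Z))" by (rule thin_subset[rotated])
qed

text \<open>
  A nonempty closed set of branches with countably many end points has, by the Baire category
  argument, a relatively open part with a single end point.
\<close>

lemma exists_single:
  assumes x: "x \<in> rest A []" and count: "countable {y \<in> space \<Y>. r y = x}"
  shows "\<exists>s. x \<in> single A s"
proof (rule ccontr)
  assume no: "\<nexists>s. x \<in> single A s"
  \<comment> \<open>An enumeration of the fibre. Without a single end point each step can move to a
    longer live node whose cell omits the next point, so the limit branch would end at a point of
    the fibre missed by the enumeration.\<close>
  define yy where "yy = from_nat_into {y \<in> space \<Y>. r y = x}"
  have step: "\<exists>t. x \<in> rest A t \<and> (\<exists>u. u \<noteq> [] \<and> t = s @ u) \<and> yy k \<notin> C t" if s: "x \<in> rest A s" for s k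
  proof -
    obtain u v where uv: "C (s @ u) \<inter> C (s @ v) = {}" "x \<in> rest A (s @ u)" "x \<in> rest A (s @ v)"
      using no s unfolding single_def by blast
    \<comment> \<open>One of two disjoint cells misses the given point.\<close>
    then obtain w where w: "x \<in> rest A (s @ w)" "yy k \<notin> C (s @ w)" by blast
    obtain f where f: "map f [0..<length (s @ w)] = s @ w" "\<And>n. x \<in> M (map f [0..<n]) - A (map f [0..<n])"
      using w(1) unfolding rest_def by blast
    \<comment> \<open>The list \<open>w\<close> may be empty. One more letter along a surviving
      branch makes the extension proper, and \<open>C_step\<close> keeps the point outside the
      smaller cell.\<close>
    define j where "j = f (length (s @ w))"
    have ext: "map f [0..<length (s @ w @ [j])] = s @ w @ [j]"
      using f(1) by (simp add: j_def)
    have "x \<in> rest A (s @ w @ [j])"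
      unfolding rest_def mem_Collect_eq using ext f(2) by blast
    moreover have "yy k \<notin> C (s @ w @ [j])" using w(2) C_step[of "s @ w" j] by auto
    ultimately show ?thesis by (intro exI[of _ "s @ w @ [j]"]) auto
  qed
  have "\<exists>s. \<forall>k. x \<in> rest A (s k) \<and> ((\<exists>u. u \<noteq> [] \<and> s (Suc k) = s k @ u) \<and> yy k \<notin> C (s (Suc k)))"
    by (rule dependent_nat_choice) (use x step in blast)+
  then obtain s where s: "\<And>k. x \<in> rest A (s k)" "\<And>k. \<exists>u. u \<noteq> [] \<and> s (Suc k) = s k @ u"
    "\<And>k. yy k \<notin> C (s (Suc k))" by blast
  obtain f where f: "\<And>k. map f [0..<length (s k)] = s k" "\<And>k. k \<le> length (s k)"
    using list_chain_limit[of s] s(2) by metis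
  have "x \<in> M (map f [0..<n])" for n
  proof -
    obtain g where g: "map g [0..<length (s n)] = s n" "\<And>i. x \<in> M (map g [0..<i]) - A (map g [0..<i])"
      using s(1)[of n] unfolding rest_def by blast
    have "take n (map g [0..<length (s n)]) = take n (map f [0..<length (s n)])" using g(1) f(1) by simp
    then have "map g [0..<n] = map f [0..<n]" using f(2)[of n] by (simp add: take_map)
    then show ?thesis using g(2)[of n] by (metis DiffD1)
  qed
  then obtain y where y: "y \<in> space \<Y>" "r y = x" "\<And>n. y \<in> C (map f [0..<n])"
    using branch_point[of x f] by auto
  then have "\<exists>k. yy k = y"
    unfolding yy_def by (intro from_nat_into_surj[OF count]) simp
  then obtain k where "y = yy k" by auto
  then show False using s(3)[of k] y(3)[of "length (s (Suc k))"] f(1) by simp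
qed

text \<open>The set \<open>single A s\<close> is disjoint from the maximal base \<open>A s\<close>,
  yet the piece over it is thin; maximality makes it null. A point whose code avoids all bases lies
  over some \<open>single A s\<close> because its fibre is countable, hence over a null set, and all
  other points lie in thin pieces.\<close>

lemma thin_space:
  assumes countable_fiber: "\<And>x. countable {y \<in> space \<Y>. r y = x}"
  shows "thin \<mu> \<Y> r (space \<Y>)"
proof -
  have "\<forall>s. \<exists>A. A \<in> sets \<mu> \<and> thin \<mu> \<Y> r (piece s A) \<and>
      (\<forall>B\<in>sets \<mu>. thin \<mu> \<Y> r (piece s B) \<longrightarrow> B - A \<in> null_sets \<mu>)"
    using maximal_thin_base by blast
  from choice[OF this] obtain A where "\<forall>s. A s \<in> sets \<mu> \<and> thin \<mu> \<Y> r (piece s (A s)) \<and>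
      (\<forall>B\<in>sets \<mu>. thin \<mu> \<Y> r (piece s B) \<longrightarrow> B - A s \<in> null_sets \<mu>)" ..
  then have A: "A s \<in> sets \<mu>" "thin \<mu> \<Y> r (piece s (A s))"
    "B \<in> sets \<mu> \<Longrightarrow> thin \<mu> \<Y> r (piece s B) \<Longrightarrow> B - A s \<in> null_sets \<mu>" for s B
    by simp_all
  obtain Z where Z: "Z \<in> null_sets \<mu>" "\<And>s. rest A s - Z \<in> sets \<mu>"
    using completion_null_difference[where P = "rest A", OF rest_sets[OF A(1)]] by blast
  have disj: "single A s - Z - A s = single A s - Z" for s
  proof -
    have "x \<notin> A s" if x: "x \<in> rest A s" for x
    proof -
      obtain f where "map f [0..<length s] = s" "x \<notin> A (map f [0..<length s])"
        using x unfolding rest_def by blast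
      then show ?thesis by simp
    qed
    then show ?thesis unfolding single_def by blast
  qed
  have null: "single A s - Z \<in> null_sets \<mu>" for s
    using A(3)[OF thin_single[OF A(1,2) Z]] unfolding disj .
  define Z2 where "Z2 = Z \<union> (\<Union>s. single A s - Z)"
  have Z2: "Z2 \<in> null_sets \<mu>" unfolding Z2_def using Z null by (intro null_sets.Un null_sets_UN) auto
  have t: "thin \<mu> \<Y> r {y. r y \<in> Z2}"
    unfolding thin_def using Z2 by (intro exI[of _ "\<lambda>_. {}"] exI[of _ Z2]) auto
  have "space \<Y> \<subseteq> (\<Union>t. case t of None \<Rightarrow> {y. r y \<in> Z2} | Some t \<Rightarrow> piece t (A t))"
  proof
    fix y assume y: "y \<in> space \<Y>"
    obtain f where f: "\<And>n. r y \<in> M (map f [0..<n]) \<and> y \<in> C (map f [0..<n])"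
      using point_branch[OF y] by blast
    show "y \<in> (\<Union>t. case t of None \<Rightarrow> {y. r y \<in> Z2} | Some t \<Rightarrow> piece t (A t))"
    proof (cases "\<exists>n. r y \<in> A (map f [0..<n])")
      case True
      then obtain n where "r y \<in> A (map f [0..<n])" ..
      then have "y \<in> piece (map f [0..<n]) (A (map f [0..<n]))"
        unfolding piece_def mem_Collect_eq using f y by (intro conjI exI[of _ f]) simp_all
      then have "y \<in> (case Some (map f [0..<n]) of None \<Rightarrow> {y. r y \<in> Z2} | Some t \<Rightarrow> piece t (A t))" by simp
      then show ?thesis by blast
    next
      case False
      then have "r y \<in> rest A []"
        unfolding rest_def mem_Collect_eq using f by (intro exI[of _ f]) simp
      then obtain s where "r y \<in> single A s" using exists_single[OF _ countable_fiber] by auto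
      then have "r y \<in> Z2" unfolding Z2_def by blast
      then have "y \<in> (case None of None \<Rightarrow> {y. r y \<in> Z2} | Some t \<Rightarrow> piece t (A t))" by simp
      then show ?thesis by blast
    qed
  qed
  moreover have "thin \<mu> \<Y> r (\<Union>t. case t of None \<Rightarrow> {y. r y \<in> Z2} | Some t \<Rightarrow> piece t (A t))"
    using t A(2) by (intro thin_UN) (auto split: option.splits)
  ultimately show ?thesis by (rule thin_subset[rotated])
qed

end

section \<open>Souslin codes for graphs over standard Borel spaces\<close>

lemma polish_topology_metric:
  fixes T :: "'y topology"
  assumes "polish_topology T"
  shows "\<exists>d (q :: nat \<Rightarrow> 'y). Metric_space (topspace T) d \<and> Metric_space.mcomplete (topspace T) d \<and>
    Metric_space.mtopology (topspace T) d = T \<and>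
    (\<forall>y\<in>topspace T. \<forall>e>0. \<exists>k. q k \<in> topspace T \<and> d (q k) y < e)"
proof -
  obtain S d where S: "Metric_space S d" "Metric_space.mcomplete S d" "T = Metric_space.mtopology S d"
    using assms unfolding polish_topology_def completely_metrizable_space_def by blast
  interpret Metric_space S d by fact
  have top: "topspace T = S" using S(3) by simp
  obtain Q where Q: "countable Q" "Q \<subseteq> S" "mtopology closure_of Q = S"
    using assms S(3) unfolding polish_topology_def separable_space_def by auto
  have "\<exists>k. from_nat_into Q k \<in> S \<and> d (from_nat_into Q k) y < e" if "y \<in> S" "e > 0" for y e
  proof -
    have "\<exists>z\<in>Q. z \<in> mball y e"
      using that Q(3) unfolding metric_closure_of by blast
    then obtain z where z: "z \<in> Q" "z \<in> mball y e" ..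
    then obtain k where "from_nat_into Q k = z" using from_nat_into_surj[OF Q(1)] by blast
    then show ?thesis using z by (auto simp: commute intro!: exI[of _ k])
  qed
  then show ?thesis using S top by (intro exI[of _ d] exI[of _ "from_nat_into Q"]) auto
qed

text \<open>The base consists of balls of radius \<open>1 / 2 ^ i\<close> about a dense sequence.
  Separation of points is recorded because it turns an equation between points into countably many
  Borel conditions.\<close>

lemma standard_borel_base:
  fixes \<Y> :: "'y measure"
  assumes "standard_borel \<Y>"
  shows "\<exists>V :: nat \<Rightarrow> 'y set. sets \<Y> = sigma_sets (space \<Y>) (range V) \<and> (\<forall>n. V n \<subseteq> space \<Y>) \<and>
     (\<forall>x\<in>space \<Y>. \<forall>y\<in>space \<Y>. x \<noteq> y \<longrightarrow> (\<exists>n. x \<in> V n \<and> y \<notin> V n))"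
proof -
  obtain T where T: "polish_topology T" "topspace T = space \<Y>" "sets \<Y> = sigma_sets (topspace T) {U. openin T U}"
    using assms unfolding standard_borel_def by blast
  obtain d and q :: "nat \<Rightarrow> 'y" where d: "Metric_space (topspace T) d" "Metric_space.mtopology (topspace T) d = T"
    "\<And>y e. y \<in> topspace T \<Longrightarrow> e > 0 \<Longrightarrow> \<exists>k. q k \<in> topspace T \<and> d (q k) y < e"
    using polish_topology_metric[OF T(1)] by blast
  interpret Metric_space "topspace T" d by fact
  define V where "V n = (case prod_decode n of (k, i) \<Rightarrow> mball (q k) (1 / 2 ^ i))" for n
  have V: "V (prod_encode (k, i)) = mball (q k) (1 / 2 ^ i)" for k i by (simp add: V_def)
  have openV: "openin T (V n)" for n
    using openin_mball d(2) by (auto simp: V_def split: prod.splits)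
  have base: "\<exists>n. y \<in> V n \<and> V n \<subseteq> U" if U: "openin T U" "y \<in> U" for U y
  proof -
    obtain e where e: "e > 0" "mball y e \<subseteq> U"
      using U openin_mtopology[of U] unfolding d(2) by blast
    have y: "y \<in> topspace T" using U openin_subset by blast
    obtain i where i: "(1/2::real) ^ i < e / 2" using real_arch_pow_inv[of "e/2" "1/2"] e by auto
    obtain k where k: "q k \<in> topspace T" "d (q k) y < 1 / 2 ^ i" using d(3)[OF y, of "1 / 2 ^ i"] by auto
    have "mball (q k) (1 / 2 ^ i) \<subseteq> mball y e"
    proof
      fix z assume z: "z \<in> mball (q k) (1 / 2 ^ i)"
      have "d y z \<le> d (q k) y + d (q k) z"
        using triangle[of y "q k" z] commute[of y "q k"] y k z by auto
      then show "z \<in> mball y e" using z y k i by (auto simp: power_one_over)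
    qed
    then show ?thesis using k y e(2) V by (intro exI[of _ "prod_encode (k, i)"]) auto
  qed
  have "sets \<Y> = sigma_sets (space \<Y>) (range V)"
    unfolding T(3) T(2)
  proof (rule sigma_sets_eqI)
    fix U assume "U \<in> {U. openin T U}"
    then have U: "U = (\<Union>n\<in>{n. V n \<subseteq> U}. V n)" using base by blast
    have "(\<Union>n\<in>{n. V n \<subseteq> U}. V n) = \<Union> (V ` {n. V n \<subseteq> U})" by simp
    moreover have "\<Union> (V ` {n. V n \<subseteq> U}) \<in> sigma_sets (space \<Y>) (range V)"
    proof -
      have "\<Union> (V ` {n. V n \<subseteq> U}) = (\<Union>n. if V n \<subseteq> U then V n else {})" by (auto split: if_splits)
      moreover have "\<dots> \<in> sigma_sets (space \<Y>) (range V)"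
        by (intro sigma_sets.Union) (auto intro: sigma_sets.Empty)
      ultimately show ?thesis by simp
    qed
    ultimately show "U \<in> sigma_sets (space \<Y>) (range V)" using U by simp
  next
    fix U assume "U \<in> range V"
    then show "U \<in> sigma_sets (space \<Y>) {U. openin T U}" using openV by auto
  qed
  moreover have "\<exists>n. x \<in> V n \<and> y \<notin> V n" if "x \<in> space \<Y>" "y \<in> space \<Y>" "x \<noteq> y" for x y
  proof -
    have "openin T (mball x (d x y))" using openin_mball d(2) by simp
    moreover have "x \<in> mball x (d x y)" using that mdist_pos_less[of x y] unfolding T(2)[symmetric] by simp
    moreover have "y \<notin> mball x (d x y)" by simp
    ultimately show ?thesis using base by blast
  qed
  moreover have "V n \<subseteq> space \<Y>" for n using openin_subset[OF openV] T(2) by simp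
  ultimately show ?thesis by blast
qed

text \<open>Souslin sets are not closed under complements, so the induction over Borel sets carries
  \<open>B\<close> and its complement together. It starts from open sets, which are countable unions
  of closed sets in a metrizable space.\<close>

lemma borel_rectangle_souslin:
  fixes T :: "'y topology"
  defines "\<H> \<equiv> \<lambda>\<mu>. {A \<times> C | A C. A \<in> sets \<mu> \<and> closedin T C}"
  assumes T: "polish_topology T" and B: "B \<in> sigma_sets (topspace T) {U. openin T U}"
  shows "\<forall>A\<in>sets \<mu>. A \<times> B \<in> souslin_sets (\<H> \<mu>) \<and> A \<times> (topspace T - B) \<in> souslin_sets (\<H> \<mu>)"
proof -
  have \<Omega>: "space \<mu> \<times> topspace T \<in> \<H> \<mu>" unfolding \<H>_def by auto
  have \<Omega>': "R \<subseteq> space \<mu> \<times> topspace T" if "R \<in> \<H> \<mu>" for R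
    using that sets.sets_into_space closedin_subset unfolding \<H>_def by fastforce
  have rect: "A \<times> C \<in> souslin_sets (\<H> \<mu>)" if "A \<in> sets \<mu>" "closedin T C" for A C
    by (rule souslin_sets_basic) (use that in \<open>auto simp: \<H>_def\<close>)
  have met: "metrizable_space T"
    using T completely_metrizable_imp_metrizable_space unfolding polish_topology_def by blast
  from B show ?thesis
  proof induction
    case (Basic U)
    then have U: "openin T U" by simp
    obtain C :: "nat \<Rightarrow> 'y set" where C: "\<And>n. closedin T (C n)" "(\<Union>n. C n) = U"
      using open_imp_fsigma_in[OF met U] unfolding fsigma_in_ascending by blast
    show ?case
    proof (intro ballI conjI)
      fix A assume A: "A \<in> sets \<mu>"
      have "A \<times> U = (\<Union>n. A \<times> C n)" using C(2) by blast
      then show "A \<times> U \<in> souslin_sets (\<H> \<mu>)"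
        using souslin_sets_UN[OF \<Omega> \<Omega>', of "\<lambda>n. A \<times> C n"] rect[OF A C(1)] by simp
      show "A \<times> (topspace T - U) \<in> souslin_sets (\<H> \<mu>)" using A U by (intro rect) auto
    qed
  next
    case Empty
    show ?case using rect[OF _ closedin_empty] rect[OF _ closedin_topspace] by simp
  next
    case (Compl B)
    have "topspace T - (topspace T - B) = B"
      using sigma_sets_into_sp[OF _ Compl.hyps] openin_subset by blast
    then show ?case using Compl.IH by simp
  next
    case (Union B)
    show ?case
    proof (intro ballI conjI)
      fix A assume A: "A \<in> sets \<mu>"
      have "A \<times> (\<Union>n. B n) = (\<Union>n. A \<times> B n)" by blast
      then show "A \<times> (\<Union>n. B n) \<in> souslin_sets (\<H> \<mu>)"
        using souslin_sets_UN[OF \<Omega> \<Omega>', of "\<lambda>n. A \<times> B n"] Union.IH A by simp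
      have "A \<times> (topspace T - (\<Union>n. B n)) = (\<Inter>n. A \<times> (topspace T - B n))" by blast
      then show "A \<times> (topspace T - (\<Union>n. B n)) \<in> souslin_sets (\<H> \<mu>)"
        using souslin_sets_INT[of "\<lambda>n. A \<times> (topspace T - B n)"] Union.IH A by simp
    qed
  qed
qed

text \<open>The graph of \<open>r\<close> over \<open>B\<close> is obtained from measurable
  rectangles by countable operations, hence is Souslin over rectangles whose second side is closed.
  Intersecting these closed sides with shrinking balls lets completeness produce the point at the
  end of a branch. That point lies in the Borel set \<open>B\<close>, which need not be closed,
  because the pair is shown to lie in the graph.\<close>

lemma graph_souslin_fibration:
  fixes \<mu> :: "'x measure" and \<Y> :: "'y measure" and U :: "nat \<Rightarrow> 'x set"
  assumes sb: "standard_borel \<Y>" and fin: "finite_measure \<mu>" and r: "r \<in> measurable \<Y> \<mu>"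
    and U: "\<And>n. U n \<in> sets \<mu>"
    and sep: "\<And>x y. x \<in> space \<mu> \<Longrightarrow> y \<in> space \<mu> \<Longrightarrow> x \<noteq> y \<Longrightarrow> \<exists>n. x \<in> U n \<and> y \<notin> U n"
    and B: "B \<in> sets \<Y>"
  shows "\<exists>M C. souslin_fibration \<mu> (restrict_space \<Y> B) r M C"
proof -
  obtain T where T: "polish_topology T" "topspace T = space \<Y>" "sets \<Y> = sigma_sets (topspace T) {U. openin T U}"
    using sb unfolding standard_borel_def by blast
  obtain d and q :: "nat \<Rightarrow> 'y" where d: "Metric_space (topspace T) d" "Metric_space.mcomplete (topspace T) d"
    "Metric_space.mtopology (topspace T) d = T"
    "\<And>y e. y \<in> topspace T \<Longrightarrow> e > 0 \<Longrightarrow> \<exists>k. q k \<in> topspace T \<and> d (q k) y < e"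
    using polish_topology_metric[OF T(1)] by blast
  interpret Metric_space "topspace T" d by fact
  define \<H> where "\<H> = {A \<times> C | A C. A \<in> sets \<mu> \<and> closedin T C}"
  have \<Omega>: "space \<mu> \<times> topspace T \<in> \<H>" unfolding \<H>_def by auto
  have \<Omega>': "R \<subseteq> space \<mu> \<times> topspace T" if "R \<in> \<H>" for R
    using that sets.sets_into_space closedin_subset unfolding \<H>_def by fastforce
  have rect: "A \<times> D \<in> souslin_sets \<H>" if "A \<in> sets \<mu>" "D \<in> sets \<Y>" for A D
    using borel_rectangle_souslin[OF T(1), of D \<mu>] that T(3) unfolding \<H>_def by auto
  have BY: "B \<subseteq> space \<Y>" using B by (rule sets.sets_into_space)
  have sB: "space (restrict_space \<Y> B) = B" using BY by (auto simp: space_restrict_space)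
  \<comment> \<open>The countable intersection says that \<open>x\<close> and \<open>r y\<close> lie
    in the same sets \<open>U n\<close>, which by \<open>sep\<close> means
    \<open>r y = x\<close>.\<close>
  define P where "P = (space \<mu> \<times> B) \<inter> (\<Inter>n. (U n \<times> (r -` U n \<inter> space \<Y>)) \<union>
      ((space \<mu> - U n) \<times> (r -` (space \<mu> - U n) \<inter> space \<Y>)))"
  have "P \<in> souslin_sets \<H>"
    unfolding P_def
    by (intro souslin_sets_Int souslin_sets_INT souslin_sets_Un[OF \<Omega> \<Omega>'] rect measurable_sets[OF r])
      (use U B in auto)
  then obtain H where H: "\<And>s. H s \<in> \<H>" "P = souslin_op H" unfolding souslin_sets_def by blast
  have P: "(x, y) \<in> P \<longleftrightarrow> y \<in> B \<and> r y = x" for x y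
  proof
    assume xy: "(x, y) \<in> P"
    then have y: "x \<in> space \<mu>" "y \<in> B" unfolding P_def by auto
    then have ry: "r y \<in> space \<mu>" using BY measurable_space[OF r] by blast
    have "\<not> (r y \<in> U n \<and> x \<notin> U n)" for n using xy y BY unfolding P_def by auto
    then have "r y = x" using sep[OF ry y(1)] by blast
    then show "y \<in> B \<and> r y = x" using y by blast
  next
    assume "y \<in> B \<and> r y = x"
    moreover from this have "x \<in> space \<mu>" using BY measurable_space[OF r] by blast
    ultimately show "(x, y) \<in> P" using BY unfolding P_def by auto
  qed
  have "\<forall>s. \<exists>A C. H s = A \<times> C \<and> A \<in> sets \<mu> \<and> closedin T C" using H(1) unfolding \<H>_def by blast
  then obtain A C where AC: "\<And>s. H s = A s \<times> C s" "\<And>s. A s \<in> sets \<mu>" "\<And>s. closedin T (C s)"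
    by metis
  \<comment> \<open>Each letter codes a pair: the first component is a letter for the scheme
    \<open>H\<close>, the second the index of the centre of a ball.\<close>
  define s1 where "s1 s = map (\<lambda>k. fst (prod_decode k)) s" for s
  \<comment> \<open>The closed sides are imposed for all prefixes including \<open>s\<close> itself,
    but the balls only for existing letters; \<open>topspace T\<close> fills the last index.\<close>
  define K where "K s = (\<Inter>i\<in>{..length s}. C (take i (s1 s)) \<inter>
      (if i < length s then mcball (q (snd (prod_decode (s ! i)))) (1 / 2 ^ i) else topspace T))" for s
  \<comment> \<open>Emptying \<open>M s\<close> when \<open>K s\<close> is empty builds nonemptiness
    of the cells into the conditions on \<open>x\<close>. A branch through all \<open>M\<close>
    therefore comes with nested nonempty closed sets of diameter tending to 0.\<close>
  define M where "M s = (if K s = {} then {} else (\<Inter>i\<in>{..length s}. A (take i (s1 s))))" for s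
  define f1 where "f1 f i = fst (prod_decode (f i))" for f and i :: nat
  define f2 where "f2 f i = snd (prod_decode (f i))" for f and i :: nat
  have s1: "take i (s1 (map f [0..<n])) = map (f1 f) [0..<i]" if "i \<le> n" for f i n
    using that by (auto simp: s1_def f1_def take_map comp_def)
  have sub: "C s \<subseteq> topspace T" for s using AC(3) closedin_subset by blast
  have K_iff: "y \<in> K (map f [0..<n]) \<longleftrightarrow> (\<forall>i\<le>n. y \<in> C (map (f1 f) [0..<i])) \<and>
      (\<forall>i<n. y \<in> mcball (q (f2 f i)) (1 / 2 ^ i))" for y f n
  proof -
    have "y \<in> K (map f [0..<n]) \<longleftrightarrow> (\<forall>i\<le>n. y \<in> C (map (f1 f) [0..<i]) \<and>
        (if i < n then y \<in> mcball (q (f2 f i)) (1 / 2 ^ i) else y \<in> topspace T))"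
      unfolding K_def by (auto simp: s1 f2_def simp del: in_mcball)
    then show ?thesis using sub by (auto simp: le_less simp del: in_mcball split: if_splits)
  qed
  have M_iff: "x \<in> M (map f [0..<n]) \<longleftrightarrow> K (map f [0..<n]) \<noteq> {} \<and> (\<forall>i\<le>n. x \<in> A (map (f1 f) [0..<i]))" for x f n
    unfolding M_def using s1 by auto
  have K_closed: "closedin T (K s)" for s
    unfolding K_def using AC(3) closedin_mcball d(3) by (intro closedin_INT closedin_Int) auto
  have K_sub: "K s \<subseteq> topspace T" for s using K_closed closedin_subset by blast
  have K_ball: "K s \<subseteq> mcball (q (snd (prod_decode (s ! i)))) (1 / 2 ^ i)" if "i < length s" for s i
    unfolding K_def using that by (auto split: if_splits dest!: bspec[where x = i])
  have "souslin_fibration \<mu> (restrict_space \<Y> B) r M (\<lambda>s. K s \<inter> B)"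
  proof (rule souslin_fibration.intro)
    show "finite_measure \<mu>" by (rule fin)
  next
    show "r \<in> measurable (restrict_space \<Y> B) \<mu>" using r by (rule measurable_restrict_space1)
  next
    show "M s \<in> sets \<mu>" for s
      unfolding M_def using AC(2) by auto
  next
    fix s
    have "K s \<in> sets \<Y>"
    proof -
      have "topspace T - K s \<in> sets \<Y>" using K_closed[of s] T(3) by auto
      then have "space \<Y> - (topspace T - K s) \<in> sets \<Y>" by (rule sets.compl_sets)
      moreover have "space \<Y> - (topspace T - K s) = K s" using K_sub[of s] T(2) by blast
      ultimately show ?thesis by simp
    qed
    then show "K s \<inter> B \<in> sets (restrict_space \<Y> B)"
      using B BY by (auto simp: sets_restrict_space_iff)
  next
    fix s k
    show "K (s @ [k]) \<inter> B \<subseteq> K s \<inter> B"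
    proof
      fix y assume y: "y \<in> K (s @ [k]) \<inter> B"
      have "y \<in> C (take i (s1 s)) \<inter> (if i < length s then mcball (q (snd (prod_decode (s ! i)))) (1 / 2 ^ i) else topspace T)"
        if "i \<le> length s" for i
      proof -
        have "y \<in> C (take i (s1 (s @ [k]))) \<inter> (if i < length (s @ [k])
            then mcball (q (snd (prod_decode ((s @ [k]) ! i)))) (1 / 2 ^ i) else topspace T)"
          by (rule INT_D[of y _ "{..length (s @ [k])}"]) (use y that in \<open>auto simp only: K_def Int_iff length_append_singleton atMost_iff intro: le_SucI\<close>)
        moreover have "take i (s1 (s @ [k])) = take i (s1 s)" using that by (simp add: s1_def)
        ultimately show ?thesis using sub by (auto simp: nth_append split: if_splits)
      qed
      then show "y \<in> K s \<inter> B" using y unfolding K_def by blast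
    qed
  next
    fix y y' assume "y \<in> space (restrict_space \<Y> B)" "y' \<in> space (restrict_space \<Y> B)" "y \<noteq> y'"
    then have y: "y \<in> topspace T" "y' \<in> topspace T" "d y y' > 0"
      using BY T(2) by (auto simp: space_restrict_space)
    \<comment> \<open>Two balls of radius \<open>1 / 2 ^ i\<close> with a common point, one
      containing \<open>y\<close> and one \<open>y'\<close>, force \<open>d y y'\<close> to be at
      most four radii.\<close>
    obtain i where i: "(1/2::real) ^ i < d y y' / 4" using real_arch_pow_inv[of "d y y' / 4" "1/2"] y by auto
    have "(K s \<inter> B) \<inter> (K s' \<inter> B) = {}"
      if s: "Suc i \<le> length s" "length s = length s'" "y \<in> K s \<inter> B" "y' \<in> K s' \<inter> B" for s s'
    proof (rule ccontr)
      assume "\<not> ?thesis"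
      then obtain z where z: "z \<in> K s" "z \<in> K s'" by blast
      define a where "a = q (snd (prod_decode (s ! i)))"
      define a' where "a' = q (snd (prod_decode (s' ! i)))"
      have 1: "y \<in> mcball a (1 / 2 ^ i)" "z \<in> mcball a (1 / 2 ^ i)"
        using K_ball[of i s] s z by (auto simp: a_def simp del: in_mcball)
      have 2: "y' \<in> mcball a' (1 / 2 ^ i)" "z \<in> mcball a' (1 / 2 ^ i)"
        using K_ball[of i s'] s z by (auto simp: a'_def simp del: in_mcball)
      have "d y z \<le> d a y + d a z" using triangle[of y a z] commute[of y a] 1 by auto
      moreover have "d z y' \<le> d a' z + d a' y'" using triangle[of z a' y'] commute[of z a'] 2 by auto
      moreover have "d y y' \<le> d y z + d z y'" using triangle[of y z y'] 1 2 by auto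
      ultimately show False using 1 2 i by (auto simp: power_one_over)
    qed
    then show "\<exists>m. \<forall>s s'. m \<le> length s \<longrightarrow> length s = length s' \<longrightarrow> y \<in> K s \<inter> B \<longrightarrow> y' \<in> K s' \<inter> B \<longrightarrow>
        (K s \<inter> B) \<inter> (K s' \<inter> B) = {}" by blast
  next
    fix x f assume x: "\<And>n. x \<in> M (map f [0..<n])"
    have "\<Inter> (range (\<lambda>n. K (map f [0..<n]))) \<noteq> {}"
    proof -
      have "decseq (\<lambda>n. K (map f [0..<n]))"
        unfolding decseq_def by (auto simp: K_iff simp del: in_mcball)
      moreover have "\<exists>n a. K (map f [0..<n]) \<subseteq> mcball a e" if e: "e > 0" for e
      proof -
        obtain i where i: "(1/2::real) ^ i < e" using real_arch_pow_inv[of e "1/2"] e by auto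
        have "K (map f [0..<Suc i]) \<subseteq> mcball (q (f2 f i)) (1 / 2 ^ i)"
          by (auto simp: K_iff simp del: in_mcball upt_Suc)
        also have "\<dots> \<subseteq> mcball (q (f2 f i)) e"
          using i by (intro mcball_subset_concentric) (simp add: power_one_over)
        finally show ?thesis by blast
      qed
      moreover have "K (map f [0..<n]) \<noteq> {}" for n using x[of n] unfolding M_iff by blast
      ultimately show ?thesis
        using mcomplete_nest[THEN iffD1, OF d(2), THEN spec, of "\<lambda>n. K (map f [0..<n])"] K_closed
        unfolding d(3) by simp
    qed
    then obtain y where y: "\<And>n. y \<in> K (map f [0..<n])" by auto
    have "(x, y) \<in> H (map (f1 f) [0..<n])" for n
      using x[of n] y[of n] unfolding M_iff K_iff AC(1) by auto
    then have "(x, y) \<in> P" unfolding H(2) souslin_op_def mem_Collect_eq by blast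
    then have "y \<in> B" "r y = x" using P[of x y] by simp_all
    then show "\<exists>y\<in>space (restrict_space \<Y> B). r y = x \<and> (\<forall>n. y \<in> K (map f [0..<n]) \<inter> B)"
      using y unfolding sB by blast
  next
    fix y assume "y \<in> space (restrict_space \<Y> B)"
    then have y: "y \<in> B" "y \<in> topspace T" using T(2) by (auto simp: space_restrict_space)
    then have "(r y, y) \<in> P" using P by blast
    then obtain g where g: "\<And>n. (r y, y) \<in> H (map g [0..<n])"
      unfolding H(2) souslin_op_def mem_Collect_eq by blast
    have "\<exists>k. y \<in> mcball (q k) (1 / 2 ^ i)" for i :: nat
    proof -
      obtain k where "q k \<in> topspace T" "d (q k) y < 1 / 2 ^ i" using d(4)[OF y(2), of "1 / 2 ^ i"] by auto
      then show ?thesis using y by auto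
    qed
    then obtain h where h: "\<And>i. y \<in> mcball (q (h i)) (1 / 2 ^ i)" by metis
    define f where "f i = prod_encode (g i, h i)" for i
    have f: "f1 f = g" "f2 f = h" by (auto simp: f1_def f2_def f_def fun_eq_iff)
    have K: "y \<in> K (map f [0..<n])" for n
      unfolding K_iff f using g h AC(1) by auto
    have M: "r y \<in> M (map f [0..<n])" for n
      unfolding M_iff f using g AC(1) K[of n] by auto
    then show "\<exists>f. \<forall>n. r y \<in> M (map f [0..<n]) \<and> y \<in> K (map f [0..<n]) \<inter> B" 
      using K M y by (intro exI[of _ f]) simp
  qed
  then show ?thesis by blast
qed

lemma image_borel_completion:
  fixes \<mu> :: "'x measure" and \<Y> :: "'y measure" and U :: "nat \<Rightarrow> 'x set"
  assumes "standard_borel \<Y>" "finite_measure \<mu>" "r \<in> measurable \<Y> \<mu>" "\<And>n. U n \<in> sets \<mu>"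
    and "\<And>x y. x \<in> space \<mu> \<Longrightarrow> y \<in> space \<mu> \<Longrightarrow> x \<noteq> y \<Longrightarrow> \<exists>n. x \<in> U n \<and> y \<notin> U n"
    and B: "B \<in> sets \<Y>"
  shows "r ` B \<in> sets (completion \<mu>)"
proof -
  have "space (restrict_space \<Y> B) = B"
    using sets.sets_into_space[OF B] by (auto simp: space_restrict_space)
  then show ?thesis
    using graph_souslin_fibration[OF assms] souslin_fibration.image_completion by metis
qed

text \<open>The Lusin-Novikov theorem up to a null set.\<close>

theorem countable_to_one_decomposition:
  fixes \<mu> :: "'x measure" and \<Y> :: "'y measure" and U :: "nat \<Rightarrow> 'x set"
  assumes sb: "standard_borel \<Y>" and fin: "finite_measure \<mu>" and r: "r \<in> measurable \<Y> \<mu>"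
    and U: "\<And>n. U n \<in> sets \<mu>"
    and sep: "\<And>x y. x \<in> space \<mu> \<Longrightarrow> y \<in> space \<mu> \<Longrightarrow> x \<noteq> y \<Longrightarrow> \<exists>n. x \<in> U n \<and> y \<notin> U n"
    and count: "\<And>x. countable {y \<in> space \<Y>. r y = x}"
  shows "\<exists>(E :: nat \<Rightarrow> 'y set) N. N \<in> null_sets \<mu> \<and> (\<forall>n. E n \<in> sets \<Y>) \<and> disjoint_family E \<and>
    (\<forall>n. inj_on r (E n)) \<and> (\<Union>n. E n) = {y \<in> space \<Y>. r y \<notin> N} \<and>
    (\<forall>n. \<forall>B\<in>sets \<Y>. r ` (E n \<inter> B) \<in> sets \<mu>)"
proof -
  obtain M C where "souslin_fibration \<mu> (restrict_space \<Y> (space \<Y>)) r M C"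
    using graph_souslin_fibration[OF sb fin r U sep sets.top] by auto
  then have "thin \<mu> (restrict_space \<Y> (space \<Y>)) r (space (restrict_space \<Y> (space \<Y>)))"
    using count by (intro souslin_fibration.thin_space) (simp_all add: space_restrict_space)
  moreover have "sets (restrict_space \<Y> (space \<Y>)) = sets \<Y>"
    by (auto simp: sets_restrict_space_iff dest: subsetD[OF sets.sets_into_space])
  ultimately have "thin \<mu> \<Y> r (space \<Y>)"
    by (simp add: thin_def space_restrict_space)
  then obtain F :: "nat \<Rightarrow> 'y set" and Z where "(\<forall>n. F n \<in> sets \<Y> \<and> inj_on r (F n)) \<and> Z \<in> null_sets \<mu> \<and>
     (\<forall>y\<in>space \<Y>. r y \<in> Z \<or> (\<exists>n. y \<in> F n))"
    unfolding thin_def by (elim exE)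
  then have F: "F n \<in> sets \<Y>" "inj_on r (F n)" "Z \<in> null_sets \<mu>"
    "y \<in> space \<Y> \<Longrightarrow> r y \<in> Z \<or> (\<exists>n. y \<in> F n)" for n y
    by simp_all
  obtain V :: "nat \<Rightarrow> 'y set" where V: "sets \<Y> = sigma_sets (space \<Y>) (range V)" "\<And>n. V n \<subseteq> space \<Y>"
    using standard_borel_base[OF sb] by (elim exE conjE) simp
  have VY: "V n \<in> sets \<Y>" for n unfolding V(1) by blast
  define D where "D = disjointed F"
  have D: "D n \<in> sets \<Y>" "inj_on r (D n)" for n
  proof -
    have "range D \<subseteq> sets \<Y>" unfolding D_def by (rule sets.range_disjointed_sets) (use F(1) in auto)
    then show "D n \<in> sets \<Y>" by auto
    show "inj_on r (D n)" unfolding D_def by (rule inj_on_subset[OF F(2) disjointed_subset])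
  qed
  \<comment> \<open>One sequence for all images to be made measurable: \<open>m = 0\<close> codes
    the whole piece \<open>D n\<close>, and \<open>m > 0\<close> its intersection with
    \<open>V (m - 1)\<close>.\<close>
  define S where "S k = (case prod_decode k of (n, m) \<Rightarrow> if m = 0 then r ` (D n) else r ` (D n \<inter> V (m - 1)))" for k
  have "S k \<in> sets (completion \<mu>)" for k
    using D VY image_borel_completion[OF sb fin r U sep]
    by (cases "prod_decode k") (simp add: S_def)
  then obtain Z' where Z': "Z' \<in> null_sets \<mu>" "\<And>k. S k - Z' \<in> sets \<mu>"
    using completion_null_difference[where P = S and \<mu> = \<mu>] by blast
  define N where "N = Z \<union> Z'"
  have N: "N \<in> null_sets \<mu>" using F(3) Z' by (simp add: N_def null_sets.Un)
  define E where "E n = {y \<in> D n. r y \<notin> N}" for n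
  have E_sets: "E n \<in> sets \<Y>" for n
  proof -
    have "E n = D n - (r -` N \<inter> space \<Y>)" using sets.sets_into_space[OF D(1)[of n]] by (auto simp: E_def)
    then show ?thesis using D measurable_sets[OF r] N by auto
  qed
  have inj: "inj_on r (E n)" for n using D(2) by (rule inj_on_subset) (auto simp: E_def)
  have base: "r ` (E n) \<in> sets \<mu>" "r ` (E n \<inter> V m) \<in> sets \<mu>" for n m
  proof -
    have "r ` (E n) = (S (prod_encode (n, 0)) - Z') - N" by (auto simp: S_def E_def N_def)
    then show "r ` (E n) \<in> sets \<mu>" using Z' N by auto
    have "r ` (E n \<inter> V m) = (S (prod_encode (n, Suc m)) - Z') - N" by (auto simp: S_def E_def N_def)
    then show "r ` (E n \<inter> V m) \<in> sets \<mu>" using Z' N by auto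
  qed
  \<comment> \<open>Induction over the Borel sets generated by \<open>V\<close>; injectivity of
    \<open>r\<close> on \<open>E n\<close> is what makes images commute with complements.\<close>
  have img: "r ` (E n \<inter> B) \<in> sets \<mu>" if "B \<in> sets \<Y>" for n B
    using that unfolding V(1)
  proof induction
    case (Basic B)
    then show ?case using base by auto
  next
    case (Compl B)
    have "r ` (E n \<inter> (space \<Y> - B)) = r ` (E n) - r ` (E n \<inter> B)"
      using inj[of n] sets.sets_into_space[OF E_sets[of n]] by (auto dest: inj_onD)
    then show ?case using Compl base by auto
  next
    case (Union B)
    have "r ` (E n \<inter> (\<Union>i. B i)) = (\<Union>i. r ` (E n \<inter> B i))" by blast
    then show ?case using Union by auto
  qed simp
  have "disjoint_family D" unfolding D_def by (rule disjoint_family_disjointed)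
  then have "disjoint_family E" by (rule disjoint_family_on_bisimulation) (auto simp: E_def)
  moreover have "(\<Union>n. E n) = {y \<in> space \<Y>. r y \<notin> N}"
  proof -
    have "(\<Union>n. D n) = (\<Union>n. F n)" unfolding D_def by (rule UN_disjointed_eq)
    moreover have "F n \<subseteq> space \<Y>" for n using F(1) by (rule sets.sets_into_space)
    ultimately have "(\<Union>n. E n) = {y \<in> space \<Y>. (\<exists>n. y \<in> F n) \<and> r y \<notin> N}" unfolding E_def by auto
    moreover have "\<exists>n. y \<in> F n" if "y \<in> space \<Y>" "r y \<notin> N" for y
      using F(4)[OF that(1)] that(2) by (simp add: N_def)
    ultimately show ?thesis by auto
  qed
  ultimately show ?thesis
    using N E_sets inj img by (intro exI[of _ E] exI[of _ N] conjI) simp_all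
qed

section \<open>Groupoid algebra\<close>

context alg_groupoid
begin

lemma ginv_unit:
  assumes "x \<in> units G"
  shows "ginv G x = x"
proof -
  have x: "x \<in> space (arrows G)" using assms units_subset by blast
  have "mult G (ginv G x) x = x" using ginv_left[OF x] src_unit[OF assms] by simp
  moreover have "mult G (ginv G x) x = ginv G x"
    using src_mult_right[OF ginv_closed[OF x]] src_ginv[OF x] rng_unit[OF assms] by simp
  ultimately show ?thesis by simp
qed

lemma ginv_mult_cancel:
  assumes "a \<in> space (arrows G)" "b \<in> space (arrows G)" "rng G a = rng G b"
  shows "mult G a (mult G (ginv G a) b) = b"
proof -
  have "mult G a (mult G (ginv G a) b) = mult G (mult G a (ginv G a)) b"
    using assms by (intro mult_assoc[symmetric]) (auto simp: composable_def ginv_closed rng_ginv src_ginv)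
  then show ?thesis using assms ginv_right rng_mult_left by simp
qed

lemma mult_ginv_cancel:
  assumes "a \<in> space (arrows G)" "b \<in> space (arrows G)" "src G a = rng G b"
  shows "mult G (ginv G a) (mult G a b) = b"
proof -
  have "mult G (ginv G a) (mult G a b) = mult G (mult G (ginv G a) a) b"
    using assms by (intro mult_assoc[symmetric]) (auto simp: composable_def ginv_closed rng_ginv src_ginv)
  then show ?thesis using assms ginv_left rng_mult_left by simp
qed

lemma ginv_unique:
  assumes "a \<in> space (arrows G)" "b \<in> space (arrows G)" "src G a = rng G b" "mult G a b = rng G a"
  shows "b = ginv G a"
proof -
  have "b = mult G (ginv G a) (rng G a)" using mult_ginv_cancel[OF assms(1-3)] assms(4) by simp
  also have "\<dots> = ginv G a" using src_mult_right[OF ginv_closed[OF assms(1)]] src_ginv[OF assms(1)] by simp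
  finally show ?thesis .
qed

lemma ginv_ginv:
  assumes "a \<in> space (arrows G)"
  shows "ginv G (ginv G a) = a"
  using ginv_unique[OF ginv_closed[OF assms] assms] assms src_ginv ginv_left rng_ginv by simp

lemma ginv_mult_closed:
  assumes "a \<in> space (arrows G)" "b \<in> space (arrows G)" "rng G a = rng G b"
  shows "mult G (ginv G a) b \<in> space (arrows G)" "rng G (mult G (ginv G a) b) = src G a"
    "src G (mult G (ginv G a) b) = src G b"
proof -
  have "(ginv G a, b) \<in> composable G" using assms by (simp add: composable_def ginv_closed src_ginv)
  then show "mult G (ginv G a) b \<in> space (arrows G)" "rng G (mult G (ginv G a) b) = src G a"
    "src G (mult G (ginv G a) b) = src G b"
    using mult_closed rng_mult src_mult rng_ginv assms by auto
qed

lemma ginv_ginv_mult: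
  assumes "a \<in> space (arrows G)" "b \<in> space (arrows G)" "rng G a = rng G b"
  shows "ginv G (mult G (ginv G a) b) = mult G (ginv G b) a"
proof (rule ginv_unique[symmetric])
  note ab = ginv_mult_closed[OF assms]
  note ba = ginv_mult_closed[OF assms(2,1) assms(3)[symmetric]]
  show "mult G (ginv G a) b \<in> space (arrows G)" "mult G (ginv G b) a \<in> space (arrows G)"
    using ab ba by auto
  show "src G (mult G (ginv G a) b) = rng G (mult G (ginv G b) a)" using ab ba by simp
  have "mult G (mult G (ginv G a) b) (mult G (ginv G b) a) = mult G (ginv G a) (mult G b (mult G (ginv G b) a))"
    using assms ba by (intro mult_assoc) (auto simp: composable_def ginv_closed src_ginv)
  also have "\<dots> = rng G (mult G (ginv G a) b)"
    using ginv_mult_cancel[OF assms(2,1)] assms ginv_left ab by simp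
  finally show "mult G (mult G (ginv G a) b) (mult G (ginv G b) a) = rng G (mult G (ginv G a) b)" .
qed

text \<open>Left invariance of the product of the inverse of \<open>b\<close> with \<open>c\<close>.
  It is the source of all commutation with left translations, both for coefficients and for the
  convolution operator.\<close>

lemma ginv_mult_translate:
  assumes "a \<in> space (arrows G)" "b \<in> space (arrows G)" "c \<in> space (arrows G)"
    "rng G a = rng G b" "rng G a = rng G c"
  shows "mult G (ginv G (mult G (ginv G a) b)) (mult G (ginv G a) c) = mult G (ginv G b) c"
proof -
  have "mult G (ginv G (mult G (ginv G a) b)) (mult G (ginv G a) c)
      = mult G (mult G (ginv G b) a) (mult G (ginv G a) c)"
    using ginv_ginv_mult assms by simp
  also have "\<dots> = mult G (ginv G b) (mult G a (mult G (ginv G a) c))"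
    using ginv_mult_closed[OF assms(1,3,5)] assms
    by (intro mult_assoc) (auto simp: composable_def ginv_closed src_ginv)
  also have "\<dots> = mult G (ginv G b) c" using ginv_mult_cancel[OF assms(1,3,5)] by simp
  finally show ?thesis .
qed

lemma range_fiberD: "\<gamma> \<in> range_fiber G x \<Longrightarrow> \<gamma> \<in> space (arrows G)" "\<gamma> \<in> range_fiber G x \<Longrightarrow> rng G \<gamma> = x"
  by (auto simp: range_fiber_def)

lemma bij_ginv_fibers: "bij_betw (ginv G) (range_fiber G x) (source_fiber G x)"
  by (rule bij_betwI[where g = "ginv G"])
    (auto simp: range_fiber_def source_fiber_def ginv_closed src_ginv rng_ginv ginv_ginv)

text \<open>The change of variables between the fibres at the two ends of an arrow.\<close>

lemma bij_translate:
  assumes "\<gamma> \<in> space (arrows G)"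
  shows "bij_betw (\<lambda>\<zeta>. mult G (ginv G \<gamma>) \<zeta>) (range_fiber G (rng G \<gamma>)) (range_fiber G (src G \<gamma>))"
proof (rule bij_betwI[where g = "\<lambda>\<eta>. mult G \<gamma> \<eta>"])
  show "(\<lambda>\<zeta>. mult G (ginv G \<gamma>) \<zeta>) \<in> range_fiber G (rng G \<gamma>) \<rightarrow> range_fiber G (src G \<gamma>)"
    using assms ginv_mult_closed by (auto simp: range_fiber_def)
  show "mult G \<gamma> \<in> range_fiber G (src G \<gamma>) \<rightarrow> range_fiber G (rng G \<gamma>)"
    using assms mult_closed rng_mult by (auto simp: range_fiber_def composable_def)
qed (use assms in \<open>auto simp: range_fiber_def ginv_mult_cancel mult_ginv_cancel\<close>)

lemma unit_in_fiber: "x \<in> units G \<Longrightarrow> x \<in> range_fiber G x"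
  using units_subset rng_unit by (auto simp: range_fiber_def)

lemma mult_ginv_unit_iff:
  assumes "a \<in> space (arrows G)" "b \<in> space (arrows G)" "rng G a = rng G b"
  shows "mult G (ginv G a) b \<in> units G \<longleftrightarrow> b = a"
proof
  assume u: "mult G (ginv G a) b \<in> units G"
  have "mult G (ginv G a) b = src G a"
    using rng_unit[OF u] ginv_mult_closed(2)[OF assms] by simp
  then have "b = mult G a (src G a)" using ginv_mult_cancel[OF assms] by simp
  then show "b = a" using src_mult_right assms by simp
next
  assume "b = a"
  then show "mult G (ginv G a) b \<in> units G" using assms ginv_left src_units by simp
qed

lemma ginv_unit_mult:
  assumes "x \<in> units G" "a \<in> range_fiber G x"
  shows "mult G (ginv G x) a = a"
  using assms ginv_unit rng_mult_left range_fiberD by metis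

end

section \<open>Measured groupoids with Borel sections\<close>

context countable_measured_groupoid
begin

text \<open>Units are the fixed points of the Borel map \<open>rng G\<close>, and a countable
  separating family turns the fixed point equation into countably many Borel conditions.\<close>

lemma units_sets: "units G \<in> sets (arrows G)"
proof -
  obtain V :: "nat \<Rightarrow> 'g set" where V: "sets (arrows G) = sigma_sets (space (arrows G)) (range V)"
    "\<forall>x\<in>space (arrows G). \<forall>y\<in>space (arrows G). x \<noteq> y \<longrightarrow> (\<exists>n. x \<in> V n \<and> y \<notin> V n)"
    using standard_borel_base[OF standard_borel_arrows] by (elim exE conjE) simp
  have [measurable]: "V n \<in> sets (arrows G)" for n unfolding V(1) by blast
  note [measurable] = rng_borel
  have "units G = {a \<in> space (arrows G). \<forall>n. a \<in> V n \<longleftrightarrow> rng G a \<in> V n}" (is "_ = ?R")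
  proof (intro set_eqI iffI)
    fix a assume "a \<in> units G" then show "a \<in> ?R" using units_subset rng_unit by auto
  next
    fix a assume a: "a \<in> ?R"
    then have "rng G a \<in> space (arrows G)" using rng_units units_subset by blast
    then have "a = rng G a" using V(2) a by blast
    moreover have "rng G a \<in> units G" using rng_units a by blast
    ultimately show "a \<in> units G" by simp
  qed
  also have "\<dots> \<in> sets (arrows G)" by measurable
  finally show ?thesis .
qed

lemma sets_mu_iff: "B \<in> sets \<mu> \<longleftrightarrow> B \<in> sets (arrows G) \<and> B \<subseteq> units G"
  unfolding sets_unit_measure using units_sets sets.Int_space_eq2
  by (subst sets_restrict_space_iff) auto

lemma sets_mu_arrows: "B \<in> sets \<mu> \<Longrightarrow> B \<in> sets (arrows G)"
  using sets_mu_iff by blast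

lemma measurable_into_mu:
  assumes "f \<in> measurable M (arrows G)" "\<And>x. x \<in> space M \<Longrightarrow> f x \<in> units G"
  shows "f \<in> measurable M \<mu>"
proof (rule measurableI)
  show "f x \<in> space \<mu>" if "x \<in> space M" for x using assms(2) that space_unit_measure by simp
  show "f -` B \<inter> space M \<in> sets M" if "B \<in> sets \<mu>" for B
    using measurable_sets[OF assms(1) sets_mu_arrows[OF that]] .
qed

lemma rng_measurable: "rng G \<in> measurable (arrows G) \<mu>"
  using rng_borel rng_units by (rule measurable_into_mu)

lemma src_measurable: "src G \<in> measurable (arrows G) \<mu>"
  using src_borel src_units by (rule measurable_into_mu)

lemma decomposition:
  "\<exists>(E :: nat \<Rightarrow> 'g set) N. N \<in> null_sets \<mu> \<and> (\<forall>n. E n \<in> sets (arrows G)) \<and> disjoint_family E \<and>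
    (\<forall>n. inj_on (rng G) (E n)) \<and> (\<Union>n. E n) = {y \<in> space (arrows G). rng G y \<notin> N} \<and>
    (\<forall>n. \<forall>B\<in>sets (arrows G). rng G ` (E n \<inter> B) \<in> sets \<mu>)"
proof -
  obtain V :: "nat \<Rightarrow> 'g set" where V: "sets (arrows G) = sigma_sets (space (arrows G)) (range V)"
    "\<forall>x\<in>space (arrows G). \<forall>y\<in>space (arrows G). x \<noteq> y \<longrightarrow> (\<exists>n. x \<in> V n \<and> y \<notin> V n)"
    using standard_borel_base[OF standard_borel_arrows] by (elim exE conjE) simp
  show ?thesis
  proof (rule countable_to_one_decomposition[where U = "\<lambda>n. V n \<inter> units G"])
    show "standard_borel (arrows G)" by (rule standard_borel_arrows)
    show "finite_measure \<mu>" by (rule finite_measure_axioms)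
    show "rng G \<in> measurable (arrows G) \<mu>" by (rule rng_measurable)
    have "V n \<in> sets (arrows G)" for n unfolding V(1) by blast
    then show "V n \<inter> units G \<in> sets \<mu>" for n unfolding sets_mu_iff using units_sets by auto
    show "\<exists>n. x \<in> V n \<inter> units G \<and> y \<notin> V n \<inter> units G" if "x \<in> space \<mu>" "y \<in> space \<mu>" "x \<noteq> y" for x y
    proof -
      have "x \<in> space (arrows G)" "y \<in> space (arrows G)" using that space_unit_measure units_subset by auto
      then have "\<exists>n. x \<in> V n \<and> y \<notin> V n" using V(2) that(3) by blast
      then show ?thesis using that space_unit_measure by auto
    qed
    show "countable {y \<in> space (arrows G). rng G y = x}" for x
    proof (cases "x \<in> units G")
      case True then show ?thesis using countable_range_fiber unfolding range_fiber_def by simp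
    next
      case False
      then have empty: "{y \<in> space (arrows G). rng G y = x} = {}" using rng_units by auto
      show ?thesis unfolding empty by simp
    qed
  qed
qed

end

text \<open>Fixes one choice of disjoint Borel sections of the range map, valid off the null set
  \<open>N0\<close>. Their inverses serve as sections of the source map.\<close>

locale sectioned_groupoid = countable_measured_groupoid G \<mu>
  for G :: "'g groupoid_data" and \<mu> :: "'g measure" +
  fixes E :: "nat \<Rightarrow> 'g set" and N0 :: "'g set"
  assumes N0: "N0 \<in> null_sets \<mu>" and E_sets: "E n \<in> sets (arrows G)" and E_disjoint: "disjoint_family E"
    and E_inj: "inj_on (rng G) (E n)" and E_UN: "(\<Union>n. E n) = {\<gamma> \<in> space (arrows G). rng G \<gamma> \<notin> N0}"
    and E_image: "B \<in> sets (arrows G) \<Longrightarrow> rng G ` (E n \<inter> B) \<in> sets \<mu>"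
begin

definition sdom :: "nat \<Rightarrow> 'g set" where "sdom n = rng G ` E n"

text \<open>Off \<open>sdom n\<close> the value \<open>x\<close> is a default that keeps the map
  total and Borel; sums over sections are guarded by \<open>sdom n\<close>.\<close>

definition sec :: "nat \<Rightarrow> 'g \<Rightarrow> 'g" where
  "sec n x = (if x \<in> sdom n then the_inv_into (E n) (rng G) x else x)"

lemma sdom_sets: "sdom n \<in> sets \<mu>"
proof -
  have "E n \<inter> space (arrows G) = E n" using sets.sets_into_space[OF E_sets[of n]] by blast
  then show ?thesis using E_image[OF sets.top, of n] by (simp add: sdom_def)
qed

lemma sec_in: "x \<in> sdom n \<Longrightarrow> sec n x \<in> E n" and rng_sec: "x \<in> sdom n \<Longrightarrow> rng G (sec n x) = x"
  unfolding sec_def sdom_def using E_inj the_inv_into_into[OF E_inj] f_the_inv_into_f[OF E_inj] by auto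

lemma E_sub: "E n \<subseteq> space (arrows G)"
  using E_sets by (rule sets.sets_into_space)

lemma sec_fiber: "x \<in> sdom n \<Longrightarrow> sec n x \<in> range_fiber G x"
  using sec_in rng_sec E_sub unfolding range_fiber_def by blast

lemma sec_measurable: "sec n \<in> measurable \<mu> (arrows G)"
proof (rule measurableI)
  fix x assume "x \<in> space \<mu>"
  then show "sec n x \<in> space (arrows G)"
    using sec_in[of x n] E_sub[of n] space_unit_measure units_subset by (auto simp: sec_def)
next
  fix B assume B: "B \<in> sets (arrows G)"
  have "sec n -` B \<inter> space \<mu> = rng G ` (E n \<inter> B) \<union> ((B \<inter> units G) - sdom n)" (is "?L = ?R")
  proof (intro set_eqI iffI)
    fix x assume x: "x \<in> ?L"
    show "x \<in> ?R"
    proof (cases "x \<in> sdom n")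
      case True
      then have "x = rng G (sec n x)" "sec n x \<in> E n \<inter> B" using x sec_in rng_sec by auto
      then show ?thesis by blast
    next
      case False
      then show ?thesis using x space_unit_measure by (auto simp: sec_def)
    qed
  next
    fix x assume x: "x \<in> ?R"
    show "x \<in> ?L"
    proof (cases "x \<in> sdom n")
      case True
      then obtain e where e: "e \<in> E n" "e \<in> B" "x = rng G e" using x by auto
      then have "sec n x = e" using sec_in[OF True] rng_sec[OF True] E_inj[of n] by (auto dest: inj_onD)
      then show ?thesis using e E_sub[of n] space_unit_measure rng_units by auto
    next
      case False
      then show ?thesis using x space_unit_measure by (auto simp: sec_def sdom_def)
    qed
  qed
  moreover have "B \<inter> units G \<in> sets \<mu>" using B units_sets unfolding sets_mu_iff by auto
  ultimately show "sec n -` B \<inter> space \<mu> \<in> sets \<mu>" using E_image[OF B] sdom_sets by auto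
qed

lemma sec_bij:
  assumes "x \<in> units G" "x \<notin> N0"
  shows "bij_betw (\<lambda>n. sec n x) {n. x \<in> sdom n} (range_fiber G x)"
  unfolding bij_betw_def
proof
  show "inj_on (\<lambda>n. sec n x) {n. x \<in> sdom n}"
  proof (rule inj_onI)
    fix m n assume "m \<in> {n. x \<in> sdom n}" "n \<in> {n. x \<in> sdom n}" "sec m x = sec n x"
    then have "sec m x \<in> E m \<inter> E n" using sec_in[of x m] sec_in[of x n] by auto
    then show "m = n" using E_disjoint unfolding disjoint_family_on_def by blast
  qed
  show "(\<lambda>n. sec n x) ` {n. x \<in> sdom n} = range_fiber G x"
  proof
    show "(\<lambda>n. sec n x) ` {n. x \<in> sdom n} \<subseteq> range_fiber G x" using sec_fiber by auto
    show "range_fiber G x \<subseteq> (\<lambda>n. sec n x) ` {n. x \<in> sdom n}"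
    proof
      fix \<gamma> assume \<gamma>: "\<gamma> \<in> range_fiber G x"
      then have "\<gamma> \<in> (\<Union>n. E n)" unfolding E_UN using assms by (auto simp: range_fiber_def)
      then obtain n where n: "\<gamma> \<in> E n" by blast
      then have d: "x \<in> sdom n" using \<gamma> by (auto simp: sdom_def range_fiber_def)
      then have "sec n x = \<gamma>"
        using sec_in[OF d] rng_sec[OF d] n \<gamma> E_inj[of n] by (auto dest: inj_onD simp: range_fiber_def)
      then show "\<gamma> \<in> (\<lambda>n. sec n x) ` {n. x \<in> sdom n}" using d by blast
    qed
  qed
qed

section \<open>Measurability of fibrewise sums\<close>

text \<open>Replaces a sum over a varying fibre by a series over section indices, whose terms are
  Borel in \<open>x\<close>. With finitely many nonzero terms the unordered and the ordered sum
  agree.\<close>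

lemma infsum_fiber_suminf:
  fixes f :: "'g \<Rightarrow> 'b :: real_normed_vector"
  assumes x: "x \<in> units G" "x \<notin> N0" and fin: "finite {\<gamma> \<in> range_fiber G x. f \<gamma> \<noteq> 0}"
  shows "(\<Sum>\<^sub>\<infinity>\<gamma>\<in>range_fiber G x. f \<gamma>) = (\<Sum>n. if x \<in> sdom n then f (sec n x) else 0)"
proof -
  let ?J = "{n. x \<in> sdom n \<and> f (sec n x) \<noteq> 0}"
  note bij = sec_bij[OF x]
  have "?J \<subseteq> {n. x \<in> sdom n}" by auto
  have "(\<lambda>n. sec n x) ` ?J \<subseteq> {\<gamma> \<in> range_fiber G x. f \<gamma> \<noteq> 0}" using sec_fiber by auto
  moreover have "inj_on (\<lambda>n. sec n x) ?J"
    using bij_betw_imp_inj_on[OF bij] by (rule inj_on_subset) auto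
  ultimately have J: "finite ?J" using fin by (meson finite_imageD finite_subset)
  have "(\<Sum>\<^sub>\<infinity>\<gamma>\<in>range_fiber G x. f \<gamma>) = (\<Sum>\<^sub>\<infinity>n\<in>{n. x \<in> sdom n}. f (sec n x))"
    using infsum_reindex_bij_betw[OF bij, of f] by simp
  also have "\<dots> = (\<Sum>\<^sub>\<infinity>n\<in>?J. f (sec n x))" by (rule infsum_cong_neutral) auto
  also have "\<dots> = (\<Sum>n\<in>?J. if x \<in> sdom n then f (sec n x) else 0)" using J by (simp add: sum.If_cases)
  also have "\<dots> = (\<Sum>n. if x \<in> sdom n then f (sec n x) else 0)"
    by (rule suminf_finite[symmetric]) (use J in auto)
  finally show ?thesis .
qed

text \<open>The product is Borel only on composable pairs, so measurability is proved on the arrows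
  whose range lies in \<open>sdom n\<close> and extended by the default value
  \<open>\<gamma>\<close>.\<close>

lemma translate_sec_measurable:
  "(\<lambda>\<gamma>. if rng G \<gamma> \<in> sdom n then mult G (ginv G \<gamma>) (sec n (rng G \<gamma>)) else \<gamma>) \<in> measurable (arrows G) (arrows G)"
proof -
  let ?D = "{\<gamma>. rng G \<gamma> \<in> sdom n}"
  have D: "?D \<inter> space (arrows G) \<in> sets (arrows G)"
    using measurable_sets[OF rng_measurable sdom_sets, of n] by (simp add: vimage_def)
  have s: "(\<lambda>\<gamma>. sec n (rng G \<gamma>)) \<in> measurable (arrows G) (arrows G)"
    using measurable_compose[OF rng_measurable sec_measurable] .
  have "(\<lambda>\<gamma>. (ginv G \<gamma>, sec n (rng G \<gamma>))) \<in>
      measurable (restrict_space (arrows G) ?D) (restrict_space (arrows G \<Otimes>\<^sub>M arrows G) (composable G))"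
  proof (rule measurable_restrict_space2)
    show "(\<lambda>\<gamma>. (ginv G \<gamma>, sec n (rng G \<gamma>))) \<in> space (restrict_space (arrows G) ?D) \<rightarrow> composable G"
      using ginv_closed src_ginv rng_sec sec_fiber
      by (auto simp: space_restrict_space composable_def range_fiber_def)
    show "(\<lambda>\<gamma>. (ginv G \<gamma>, sec n (rng G \<gamma>))) \<in> measurable (restrict_space (arrows G) ?D) (arrows G \<Otimes>\<^sub>M arrows G)"
      using ginv_borel s by (intro measurable_restrict_space1 measurable_Pair)
  qed
  from measurable_compose[OF this mult_borel]
  have "(\<lambda>\<gamma>. mult G (ginv G \<gamma>) (sec n (rng G \<gamma>))) \<in> measurable (restrict_space (arrows G) ?D) (arrows G)"
    by simp
  then show ?thesis
    using D by (subst measurable_If_restrict_space_iff) (auto intro!: measurable_restrict_space1 simp: Int_def conj_commute)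
qed

text \<open>This form serves three purposes: coefficients, with \<open>a\<close> the conjugate of
  \<open>b\<close>; the convolution operator, with \<open>b\<close> the positive definite function;
  and fibrewise norms, with \<open>b = 1\<close>. The support condition falls on \<open>a\<close>
  alone, and \<open>zero\<close> settles the fibres where the sections fail.\<close>

lemma fiber_sum_measurable:
  fixes a b :: "'g \<Rightarrow> complex"
  assumes a: "a \<in> borel_measurable (arrows G)" and b: "b \<in> borel_measurable (arrows G)"
    and zero: "\<And>\<gamma>. rng G \<gamma> \<in> N0 \<Longrightarrow> a \<gamma> = 0"
    and fin: "\<And>x. x \<in> units G \<Longrightarrow> x \<notin> N0 \<Longrightarrow> finite {\<gamma> \<in> range_fiber G x. a \<gamma> \<noteq> 0}"
  shows "(\<lambda>\<gamma>. \<Sum>\<^sub>\<infinity>\<gamma>1\<in>range_fiber G (rng G \<gamma>). a \<gamma>1 * b (mult G (ginv G \<gamma>) \<gamma>1)) \<in> borel_measurable (arrows G)"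
proof -
  let ?m = "\<lambda>n \<gamma>. if rng G \<gamma> \<in> sdom n then mult G (ginv G \<gamma>) (sec n (rng G \<gamma>)) else \<gamma>"
  let ?t = "\<lambda>n \<gamma>. indicator (rng G -` sdom n \<inter> space (arrows G)) \<gamma> * (a (sec n (rng G \<gamma>)) * b (?m n \<gamma>))"
  let ?N = "rng G -` (units G - N0) \<inter> space (arrows G)"
  have D: "rng G -` sdom n \<inter> space (arrows G) \<in> sets (arrows G)" for n
    using measurable_sets[OF rng_measurable sdom_sets] .
  have N: "?N \<in> sets (arrows G)"
    using N0 sets.compl_sets[of N0 \<mu>] by (intro measurable_sets[OF rng_measurable]) (auto simp: space_unit_measure)
  have "(\<lambda>\<gamma>. a (sec n (rng G \<gamma>))) \<in> borel_measurable (arrows G)" for n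
    using measurable_compose[OF measurable_compose[OF rng_measurable sec_measurable] a] .
  moreover have "(\<lambda>\<gamma>. b (?m n \<gamma>)) \<in> borel_measurable (arrows G)" for n
    using measurable_compose[OF translate_sec_measurable b] .
  ultimately have "(\<lambda>\<gamma>. \<Sum>n. ?t n \<gamma>) \<in> borel_measurable (arrows G)"
    using D by (intro borel_measurable_suminf borel_measurable_times borel_measurable_indicator)
  then have "(\<lambda>\<gamma>. indicator ?N \<gamma> * (\<Sum>n. ?t n \<gamma>)) \<in> borel_measurable (arrows G)"
    using N by (intro borel_measurable_times borel_measurable_indicator)
  moreover have "(\<Sum>\<^sub>\<infinity>\<gamma>1\<in>range_fiber G (rng G \<gamma>). a \<gamma>1 * b (mult G (ginv G \<gamma>) \<gamma>1)) = indicator ?N \<gamma> * (\<Sum>n. ?t n \<gamma>)"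
    if \<gamma>: "\<gamma> \<in> space (arrows G)" for \<gamma>
  proof (cases "rng G \<gamma> \<in> N0")
    case True
    have "(\<Sum>\<^sub>\<infinity>\<gamma>1\<in>range_fiber G (rng G \<gamma>). a \<gamma>1 * b (mult G (ginv G \<gamma>) \<gamma>1)) = (\<Sum>\<^sub>\<infinity>\<gamma>1\<in>range_fiber G (rng G \<gamma>). 0)"
      using True zero by (intro infsum_cong) (auto simp: range_fiber_def)
    then show ?thesis using True by simp
  next
    case False
    have u: "rng G \<gamma> \<in> units G" using rng_units \<gamma> .
    have "(\<Sum>\<^sub>\<infinity>\<gamma>1\<in>range_fiber G (rng G \<gamma>). a \<gamma>1 * b (mult G (ginv G \<gamma>) \<gamma>1)) =
      (\<Sum>n. if rng G \<gamma> \<in> sdom n then a (sec n (rng G \<gamma>)) * b (mult G (ginv G \<gamma>) (sec n (rng G \<gamma>))) else 0)"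
      by (rule infsum_fiber_suminf[OF u False]) (rule finite_subset[OF _ fin[OF u False]], auto)
    also have "\<dots> = (\<Sum>n. ?t n \<gamma>)"
      using \<gamma> by (intro suminf_cong) auto
    finally show ?thesis using \<gamma> u False by simp
  qed
  ultimately show ?thesis by (subst measurable_cong) simp_all
qed

lemma ginv_vimage_sets: "B \<in> sets (arrows G) \<Longrightarrow> {\<gamma> \<in> space (arrows G). ginv G \<gamma> \<in> B} \<in> sets (arrows G)"
  using measurable_sets[OF ginv_borel, of B] by (simp add: vimage_def Int_def conj_commute)

lemma src_vimage_sets: "B \<in> sets \<mu> \<Longrightarrow> {\<gamma> \<in> space (arrows G). src G \<gamma> \<in> B} \<in> sets (arrows G)"
  using measurable_sets[OF src_measurable, of B] by (simp add: vimage_def Int_def conj_commute)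

lemma rng_vimage_sets: "B \<in> sets \<mu> \<Longrightarrow> {\<gamma> \<in> space (arrows G). rng G \<gamma> \<in> B} \<in> sets (arrows G)"
  using measurable_sets[OF rng_measurable, of B] by (simp add: vimage_def Int_def conj_commute)

text \<open>Inversion carries the sections of the range map to an enumeration of the source
  fibre.\<close>

lemma source_count:
  assumes x: "x \<in> units G" "x \<notin> N0"
  shows "(\<integral>\<^sup>+\<gamma>. indicator B \<gamma> \<partial>count_space (source_fiber G x)) =
    (\<Sum>n. indicator {x \<in> sdom n. ginv G (sec n x) \<in> B} x)"
proof -
  have bij: "bij_betw (\<lambda>n. ginv G (sec n x)) {n. x \<in> sdom n} (source_fiber G x)"
    using bij_betw_trans[OF sec_bij[OF x] bij_ginv_fibers] by (simp add: comp_def)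
  have "(\<integral>\<^sup>+\<gamma>. indicator B \<gamma> \<partial>count_space (source_fiber G x)) =
      (\<integral>\<^sup>+n. indicator B (ginv G (sec n x)) \<partial>count_space {n. x \<in> sdom n})"
    using nn_integral_bij_count_space[OF bij, of "indicator B"] by simp
  also have "\<dots> = (\<integral>\<^sup>+n. indicator B (ginv G (sec n x)) * indicator {n. x \<in> sdom n} n \<partial>count_space UNIV)"
    by (rule nn_integral_count_space_indicator) simp
  also have "\<dots> = (\<Sum>n. indicator B (ginv G (sec n x)) * indicator {n. x \<in> sdom n} n)"
    by (rule nn_integral_count_space_nat)
  also have "\<dots> = (\<Sum>n. indicator {x \<in> sdom n. ginv G (sec n x) \<in> B} x)"
    by (intro suminf_cong) (auto simp: indicator_def)
  finally show ?thesis .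
qed

lemma source_piece_sets:
  assumes "B \<in> sets (arrows G)"
  shows "{x \<in> sdom n. ginv G (sec n x) \<in> B} \<in> sets \<mu>"
proof -
  have "(\<lambda>x. ginv G (sec n x)) -` B \<inter> space \<mu> \<in> sets \<mu>"
    using measurable_sets[OF measurable_compose[OF sec_measurable ginv_borel] assms] .
  then have "sdom n \<inter> ((\<lambda>x. ginv G (sec n x)) -` B \<inter> space \<mu>) \<in> sets \<mu>" using sdom_sets by blast
  moreover have "sdom n \<subseteq> space \<mu>" using sdom_sets by (rule sets.sets_into_space)
  then have "sdom n \<inter> ((\<lambda>x. ginv G (sec n x)) -` B \<inter> space \<mu>) = {x \<in> sdom n. ginv G (sec n x) \<in> B}" by auto
  ultimately show ?thesis by simp
qed

lemma AE_N0: "AE x in \<mu>. x \<in> units G \<and> x \<notin> N0"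
  using AE_not_in[OF N0] AE_space space_unit_measure by (auto elim: eventually_elim2)

lemma source_count_AE:
  "AE x in \<mu>. (\<integral>\<^sup>+\<gamma>. indicator B \<gamma> \<partial>count_space (source_fiber G x)) =
    (\<Sum>n. indicator {x \<in> sdom n. ginv G (sec n x) \<in> B} x)"
  using AE_N0 by eventually_elim (auto intro: source_count)

lemma source_count_measurable:
  "B \<in> sets (arrows G) \<Longrightarrow>
    (\<lambda>x. \<Sum>n. indicator {x \<in> sdom n. ginv G (sec n x) \<in> B} x :: ennreal) \<in> borel_measurable \<mu>"
  using source_piece_sets by (intro borel_measurable_suminf_order borel_measurable_indicator)

section \<open>The measure on arrows and its null sets\<close>

lemma sets_gpd: "sets (gpd_measure G \<mu>) = sets (arrows G)"
  and space_gpd: "space (gpd_measure G \<mu>) = space (arrows G)"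
  unfolding gpd_measure_def using sets.space_closed by (auto simp: sets.sigma_sets_eq)

text \<open>\<open>measure_of\<close> keeps the prescribed values only for a countably additive set
  function. Exchanging sum and integral needs measurable integrands, so the fibre count is replaced
  almost everywhere by the series over sections and restored afterwards.\<close>

lemma emeasure_gpd:
  assumes "B \<in> sets (arrows G)"
  shows "emeasure (gpd_measure G \<mu>) B = (\<integral>\<^sup>+ x. (\<integral>\<^sup>+ \<gamma>. indicator B \<gamma> \<partial>count_space (source_fiber G x)) \<partial>\<mu>)"
  unfolding gpd_measure_def
proof (rule emeasure_measure_of_sigma)
  show "sigma_algebra (space (arrows G)) (sets (arrows G))" by (rule sets.sigma_algebra_axioms)
  let ?\<kappa> = "\<lambda>B. \<integral>\<^sup>+ x. (\<integral>\<^sup>+ \<gamma>. indicator B \<gamma> \<partial>count_space (source_fiber G x)) \<partial>\<mu>"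
  show "positive (sets (arrows G)) ?\<kappa>" by (simp add: positive_def)
  have \<kappa>: "?\<kappa> B = (\<integral>\<^sup>+ x. (\<Sum>n. indicator {x \<in> sdom n. ginv G (sec n x) \<in> B} x) \<partial>\<mu>)" for B
    by (rule nn_integral_cong_AE[OF source_count_AE])
  show "countably_additive (sets (arrows G)) ?\<kappa>"
    unfolding countably_additive_def
  proof (intro allI impI)
    fix A :: "nat \<Rightarrow> 'g set" assume A: "range A \<subseteq> sets (arrows G)" "disjoint_family A"
    have A': "A i \<in> sets (arrows G)" for i using A(1) by auto
    have "(\<Sum>i. ?\<kappa> (A i)) = (\<integral>\<^sup>+ x. (\<Sum>i. \<Sum>n. indicator {x \<in> sdom n. ginv G (sec n x) \<in> A i} x) \<partial>\<mu>)"
      unfolding \<kappa> using source_count_measurable[OF A'] by (intro nn_integral_suminf[symmetric])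
    also have "\<dots> = (\<integral>\<^sup>+ x. (\<Sum>i. \<integral>\<^sup>+ \<gamma>. indicator (A i) \<gamma> \<partial>count_space (source_fiber G x)) \<partial>\<mu>)"
    proof (rule nn_integral_cong_AE)
      show "AE x in \<mu>. (\<Sum>i. \<Sum>n. indicator {x \<in> sdom n. ginv G (sec n x) \<in> A i} x :: ennreal) =
          (\<Sum>i. \<integral>\<^sup>+ \<gamma>. indicator (A i) \<gamma> \<partial>count_space (source_fiber G x))"
        using AE_N0 by eventually_elim (auto intro!: suminf_cong source_count[symmetric])
    qed
    also have "\<dots> = ?\<kappa> (\<Union>i. A i)"
    proof (rule nn_integral_cong)
      fix x
      have "(\<Sum>i. \<integral>\<^sup>+ \<gamma>. indicator (A i) \<gamma> \<partial>count_space (source_fiber G x)) =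
          (\<integral>\<^sup>+ \<gamma>. (\<Sum>i. indicator (A i) \<gamma>) \<partial>count_space (source_fiber G x))"
        by (intro nn_integral_suminf[symmetric]) simp
      also have "(\<lambda>\<gamma>. \<Sum>i. indicator (A i) \<gamma> :: ennreal) = indicator (\<Union>i. A i)"
        using suminf_indicator[OF A(2)] by (intro ext)
      finally show "(\<Sum>i. \<integral>\<^sup>+ \<gamma>. indicator (A i) \<gamma> \<partial>count_space (source_fiber G x)) =
          (\<integral>\<^sup>+ \<gamma>. indicator (\<Union>i. A i) \<gamma> \<partial>count_space (source_fiber G x))" .
    qed
    finally show "(\<Sum>i. ?\<kappa> (A i)) = ?\<kappa> (\<Union>i. A i)" .
  qed
qed (rule assms)

lemma null_sets_gpd:
  "B \<in> null_sets (gpd_measure G \<mu>) \<longleftrightarrow>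
    B \<in> sets (arrows G) \<and> (AE x in \<mu>. \<forall>\<gamma>\<in>source_fiber G x. \<gamma> \<notin> B)"
proof (cases "B \<in> sets (arrows G)")
  case True
  have "emeasure (gpd_measure G \<mu>) B = (\<integral>\<^sup>+ x. (\<Sum>n. indicator {x \<in> sdom n. ginv G (sec n x) \<in> B} x) \<partial>\<mu>)"
    unfolding emeasure_gpd[OF True] by (rule nn_integral_cong_AE[OF source_count_AE])
  then have "emeasure (gpd_measure G \<mu>) B = 0 \<longleftrightarrow>
      (AE x in \<mu>. (\<Sum>n. indicator {x \<in> sdom n. ginv G (sec n x) \<in> B} x :: ennreal) = 0)"
    by (simp add: nn_integral_0_iff_AE source_count_measurable[OF True])
  also have "\<dots> \<longleftrightarrow> (AE x in \<mu>. (\<integral>\<^sup>+\<gamma>. indicator B \<gamma> \<partial>count_space (source_fiber G x)) = 0)"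
    using source_count_AE[of B] by (intro eventually_subst) (auto elim: eventually_mono)
  also have "\<dots> \<longleftrightarrow> (AE x in \<mu>. \<forall>\<gamma>\<in>source_fiber G x. \<gamma> \<notin> B)"
    by (simp add: nn_integral_0_iff_AE AE_count_space indicator_eq_0_iff)
  finally show ?thesis using True by (simp add: null_sets_def sets_gpd)
next
  case False then show ?thesis by (simp add: null_sets_def sets_gpd)
qed

text \<open>\<open>P\<close> may be nonmeasurable: the bad units are enclosed in a null set, whose
  preimage under the source map is null for the measure on arrows.\<close>

lemma AE_gpd: "(AE \<gamma> in gpd_measure G \<mu>. P \<gamma>) \<longleftrightarrow> (AE x in \<mu>. \<forall>\<gamma>\<in>source_fiber G x. P \<gamma>)"
proof
  assume "AE \<gamma> in gpd_measure G \<mu>. P \<gamma>"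
  then obtain B where B: "B \<in> null_sets (gpd_measure G \<mu>)" "{\<gamma> \<in> space (arrows G). \<not> P \<gamma>} \<subseteq> B"
    unfolding eventually_ae_filter space_gpd by blast
  then have "AE x in \<mu>. \<forall>\<gamma>\<in>source_fiber G x. \<gamma> \<notin> B" using null_sets_gpd by blast
  then show "AE x in \<mu>. \<forall>\<gamma>\<in>source_fiber G x. P \<gamma>"
    by eventually_elim (use B(2) in \<open>auto simp: source_fiber_def\<close>)
next
  assume "AE x in \<mu>. \<forall>\<gamma>\<in>source_fiber G x. P \<gamma>"
  then obtain Z where Z: "Z \<in> null_sets \<mu>" "{x \<in> space \<mu>. \<not> (\<forall>\<gamma>\<in>source_fiber G x. P \<gamma>)} \<subseteq> Z"
    unfolding eventually_ae_filter by blast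
  have "AE x in \<mu>. \<forall>\<gamma>\<in>source_fiber G x. \<gamma> \<notin> {\<gamma> \<in> space (arrows G). src G \<gamma> \<in> Z}"
    using AE_not_in[OF Z(1)] by eventually_elim (auto simp: source_fiber_def)
  then have "{\<gamma> \<in> space (arrows G). src G \<gamma> \<in> Z} \<in> null_sets (gpd_measure G \<mu>)"
    using Z(1) src_vimage_sets unfolding null_sets_gpd by blast
  then show "AE \<gamma> in gpd_measure G \<mu>. P \<gamma>"
  proof (rule AE_I')
    show "{x \<in> space (gpd_measure G \<mu>). \<not> P x} \<subseteq> {\<gamma> \<in> space (arrows G). src G \<gamma> \<in> Z}"
      using Z(2) src_units by (auto simp: space_gpd space_unit_measure source_fiber_def)
  qed
qed

text \<open>The inverse of a section meets every source fibre at most once and so has measure at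
  most 1. The arrows outside all of these have their source in \<open>N0\<close> and form a null
  set.\<close>

lemma sigma_finite_gpd: "sigma_finite_measure (gpd_measure G \<mu>)"
proof
  let ?S = "\<lambda>n. {\<gamma> \<in> space (arrows G). ginv G \<gamma> \<in> E n}"
  let ?Z = "{\<gamma> \<in> space (arrows G). src G \<gamma> \<in> N0}"
  have S: "?S n \<in> sets (arrows G)" for n using E_sets by (rule ginv_vimage_sets)
  have Z: "?Z \<in> sets (arrows G)" using N0 by (intro src_vimage_sets) auto
  have one: "(\<integral>\<^sup>+ \<gamma>. indicator (?S n) \<gamma> \<partial>count_space (source_fiber G x)) \<le> 1" for n x
  proof (cases "\<exists>a. a \<in> source_fiber G x \<and> a \<in> ?S n")
    case True
    then obtain a where a: "a \<in> source_fiber G x" "a \<in> ?S n" by blast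
    have "b = a" if "b \<in> source_fiber G x" "b \<in> ?S n" for b
    proof -
      have "rng G (ginv G b) = rng G (ginv G a)" using that a by (auto simp: source_fiber_def rng_ginv)
      then have "ginv G b = ginv G a" using that a E_inj[of n] by (auto dest: inj_onD)
      then show ?thesis using that a ginv_ginv by (metis (mono_tags, lifting) mem_Collect_eq)
    qed
    then have "(\<integral>\<^sup>+ \<gamma>. indicator (?S n) \<gamma> \<partial>count_space (source_fiber G x)) \<le>
        (\<integral>\<^sup>+ \<gamma>. indicator {a} \<gamma> \<partial>count_space (source_fiber G x))"
      by (intro nn_integral_mono) (auto simp: indicator_def)
    also have "\<dots> = emeasure (count_space (source_fiber G x)) {a}" using a by (intro nn_integral_indicator) simp
    also have "\<dots> = 1" using a by (simp add: emeasure_count_space_finite)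
    finally show ?thesis .
  next
    case False
    then have "(\<integral>\<^sup>+ \<gamma>. indicator (?S n) \<gamma> \<partial>count_space (source_fiber G x)) = (\<integral>\<^sup>+ \<gamma>. 0 \<partial>count_space (source_fiber G x))"
      by (intro nn_integral_cong) (auto simp: indicator_def)
    then show ?thesis by simp
  qed
  have "emeasure (gpd_measure G \<mu>) (?S n) \<noteq> \<infinity>" for n
  proof -
    have "emeasure (gpd_measure G \<mu>) (?S n) \<le> (\<integral>\<^sup>+ x. 1 \<partial>\<mu>)"
      unfolding emeasure_gpd[OF S] by (intro nn_integral_mono one)
    also have "\<dots> = 1" by (simp add: emeasure_space_1)
    finally have "emeasure (gpd_measure G \<mu>) (?S n) < \<infinity>" by (rule order_le_less_trans) simp
    then show ?thesis by simp
  qed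
  moreover have "?Z \<in> null_sets (gpd_measure G \<mu>)"
  proof -
    have "AE x in \<mu>. \<forall>\<gamma>\<in>source_fiber G x. \<gamma> \<notin> ?Z"
      using AE_N0 by eventually_elim (auto simp: source_fiber_def)
    then show ?thesis unfolding null_sets_gpd using Z by blast
  qed
  moreover have cover: "\<gamma> \<in> ?Z \<or> (\<exists>n. \<gamma> \<in> ?S n)" if "\<gamma> \<in> space (arrows G)" for \<gamma>
  proof (cases "src G \<gamma> \<in> N0")
    case False
    then have "ginv G \<gamma> \<in> (\<Union>n. E n)" unfolding E_UN using that ginv_closed rng_ginv by auto
    then show ?thesis using that by blast
  qed (use that in simp)
  ultimately show "\<exists>A. countable A \<and> A \<subseteq> sets (gpd_measure G \<mu>) \<and> \<Union>A = space (gpd_measure G \<mu>) \<and>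
      (\<forall>a\<in>A. emeasure (gpd_measure G \<mu>) a \<noteq> \<infinity>)"
  proof (intro exI[of _ "insert ?Z (range ?S)"] conjI)
    show "\<Union> (insert ?Z (range ?S)) = space (gpd_measure G \<mu>)"
    proof (rule antisym)
      show "\<Union> (insert ?Z (range ?S)) \<subseteq> space (gpd_measure G \<mu>)" by (auto simp: space_gpd)
      show "space (gpd_measure G \<mu>) \<subseteq> \<Union> (insert ?Z (range ?S))"
        unfolding space_gpd using cover by blast
    qed
  qed (use S Z in \<open>auto simp: sets_gpd\<close>)
qed

section \<open>Quasi-invariance and invariant null sets\<close>

text \<open>Quasi-invariance in the form in which it is used: inversion preserves null sets of
  arrows and exchanges source fibres with range fibres.\<close>

lemma AE_swap: "(AE x in \<mu>. \<forall>\<gamma>\<in>source_fiber G x. P \<gamma>) \<longleftrightarrow> (AE x in \<mu>. \<forall>\<gamma>\<in>range_fiber G x. P \<gamma>)"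
proof -
  let ?\<nu> = "gpd_measure G \<mu>"
  have inv: "ginv G \<in> measurable ?\<nu> (arrows G)"
    using ginv_borel measurable_cong_sets[OF sets_gpd refl] by blast
  have qi: "null_sets ?\<nu> = null_sets (distr ?\<nu> (arrows G) (ginv G))"
    using quasi_inv unfolding quasi_invariant_def equivalent_measures_def absolutely_continuous_def by blast
  have distr: "(AE \<gamma> in distr ?\<nu> (arrows G) (ginv G). P \<gamma>) \<longleftrightarrow> (AE \<gamma> in ?\<nu>. P \<gamma>)" for P
    unfolding eventually_ae_filter qi by (simp add: space_gpd)
  have fib: "(\<forall>\<gamma>\<in>source_fiber G x. P (ginv G \<gamma>)) \<longleftrightarrow> (\<forall>\<gamma>\<in>range_fiber G x. P \<gamma>)" for x and P :: "'g \<Rightarrow> bool"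
  proof -
    have "bij_betw (ginv G) (source_fiber G x) (range_fiber G x)"
      by (rule bij_betwI[where g = "ginv G"])
        (auto simp: range_fiber_def source_fiber_def ginv_closed src_ginv rng_ginv ginv_ginv)
    then have "range_fiber G x = ginv G ` source_fiber G x" by (simp add: bij_betw_def)
    then show ?thesis by simp
  qed
  have *: "AE \<gamma> in ?\<nu>. P (ginv G \<gamma>)" if "AE \<gamma> in ?\<nu>. P \<gamma>" for P
    using AE_distrD[OF inv] that distr by blast
  show ?thesis
  proof
    assume "AE x in \<mu>. \<forall>\<gamma>\<in>source_fiber G x. P \<gamma>"
    then have "AE \<gamma> in ?\<nu>. P (ginv G \<gamma>)" using * AE_gpd by blast
    then show "AE x in \<mu>. \<forall>\<gamma>\<in>range_fiber G x. P \<gamma>" unfolding AE_gpd fib .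
  next
    assume "AE x in \<mu>. \<forall>\<gamma>\<in>range_fiber G x. P \<gamma>"
    then have "AE \<gamma> in ?\<nu>. P (ginv G \<gamma>)" unfolding AE_gpd fib .
    then have "AE \<gamma> in ?\<nu>. P (ginv G (ginv G \<gamma>))" by (rule *)
    then have "AE x in \<mu>. \<forall>\<gamma>\<in>source_fiber G x. P (ginv G (ginv G \<gamma>))" unfolding AE_gpd .
    then show "AE x in \<mu>. \<forall>\<gamma>\<in>source_fiber G x. P \<gamma>"
      by eventually_elim (auto simp: source_fiber_def ginv_ginv)
  qed
qed

text \<open>A null set is saturated countably often: by \<open>AE_swap\<close>, the sources of all
  arrows with range in a null set lie in a null set. Applying the resulting inclusion to inverse
  arrows gives the equivalence.\<close>

lemma invariant_null_set:
  assumes "AE x in \<mu>. Q x"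
  shows "\<exists>N\<in>null_sets \<mu>. N0 \<subseteq> N \<and> (\<forall>\<gamma>\<in>space (arrows G). rng G \<gamma> \<in> N \<longleftrightarrow> src G \<gamma> \<in> N) \<and>
    (\<forall>x\<in>units G - N. Q x)"
proof -
  have step: "\<exists>Z'. Z' \<in> null_sets \<mu> \<and> Z \<subseteq> Z' \<and> (\<forall>\<gamma>\<in>space (arrows G). rng G \<gamma> \<in> Z \<longrightarrow> src G \<gamma> \<in> Z')"
    if Z: "Z \<in> null_sets \<mu>" for Z
  proof -
    have "AE x in \<mu>. \<forall>\<gamma>\<in>range_fiber G x. rng G \<gamma> \<notin> Z"
      using AE_not_in[OF Z] by eventually_elim (auto simp: range_fiber_def)
    then have "AE x in \<mu>. \<forall>\<gamma>\<in>source_fiber G x. rng G \<gamma> \<notin> Z" using AE_swap by blast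
    then obtain Y where Y: "Y \<in> null_sets \<mu>" "{x \<in> space \<mu>. \<not> (\<forall>\<gamma>\<in>source_fiber G x. rng G \<gamma> \<notin> Z)} \<subseteq> Y"
      unfolding eventually_ae_filter by blast
    have "src G \<gamma> \<in> Y" if "\<gamma> \<in> space (arrows G)" "rng G \<gamma> \<in> Z" for \<gamma>
      using that Y(2) src_units unfolding space_unit_measure source_fiber_def by blast
    then show ?thesis using Y(1) Z by (intro exI[of _ "Z \<union> Y"]) auto
  qed
  obtain Y where Y: "Y \<in> null_sets \<mu>" "{x \<in> space \<mu>. \<not> Q x} \<subseteq> Y"
    using assms unfolding eventually_ae_filter by blast
  have "\<exists>Z. \<forall>n. (Z n \<in> null_sets \<mu> \<and> N0 \<union> Y \<subseteq> Z n) \<and>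
      (\<forall>\<gamma>\<in>space (arrows G). rng G \<gamma> \<in> Z n \<longrightarrow> src G \<gamma> \<in> Z (Suc n))"
  proof (rule dependent_nat_choice)
    show "\<exists>Z. Z \<in> null_sets \<mu> \<and> N0 \<union> Y \<subseteq> Z" using N0 Y(1) by (intro exI[of _ "N0 \<union> Y"]) auto
    fix Z and n :: nat assume "Z \<in> null_sets \<mu> \<and> N0 \<union> Y \<subseteq> Z"
    then show "\<exists>Z'. (Z' \<in> null_sets \<mu> \<and> N0 \<union> Y \<subseteq> Z') \<and>
      (\<forall>\<gamma>\<in>space (arrows G). rng G \<gamma> \<in> Z \<longrightarrow> src G \<gamma> \<in> Z')"
      using step[of Z] by (meson order_trans)
  qed
  then obtain Z where Z: "\<And>n. Z n \<in> null_sets \<mu>" "\<And>n. N0 \<union> Y \<subseteq> Z n"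
    "\<And>n \<gamma>. \<gamma> \<in> space (arrows G) \<Longrightarrow> rng G \<gamma> \<in> Z n \<Longrightarrow> src G \<gamma> \<in> Z (Suc n)" by blast
  let ?N = "\<Union>n. Z n"
  have fwd: "src G \<gamma> \<in> ?N" if "\<gamma> \<in> space (arrows G)" "rng G \<gamma> \<in> ?N" for \<gamma>
    using that Z(3) by blast
  have "rng G \<gamma> \<in> ?N \<longleftrightarrow> src G \<gamma> \<in> ?N" if "\<gamma> \<in> space (arrows G)" for \<gamma>
    using fwd[OF that] fwd[OF ginv_closed[OF that]] rng_ginv[OF that] src_ginv[OF that] by auto
  moreover have "?N \<in> null_sets \<mu>" using Z(1) by (rule null_sets_UN)
  moreover have "N0 \<subseteq> ?N" using Z(2) by blast
  moreover have "Q x" if "x \<in> units G - ?N" for x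
    using that Y(2) Z(2) unfolding space_unit_measure by blast
  ultimately show ?thesis by (intro bexI[of _ ?N]) auto
qed

end

section \<open>Coefficients\<close>

text \<open>Dominated convergence for the counting measure, restated for unordered sums.\<close>

lemma infsum_dominated_tendsto:
  fixes f :: "'a \<Rightarrow> complex" and u :: "nat \<Rightarrow> 'a \<Rightarrow> complex"
  assumes f: "(\<lambda>i. norm (f i)) summable_on I" and le: "\<And>m i. i \<in> I \<Longrightarrow> norm (u m i) \<le> norm (f i)"
    and lim: "\<And>i. i \<in> I \<Longrightarrow> (\<lambda>m. u m i) \<longlonglongrightarrow> f i"
  shows "(\<lambda>m. infsum (u m) I) \<longlonglongrightarrow> infsum f I"
proof -
  have eq: "integral\<^sup>L (count_space I) g = infsum g I" "integrable (count_space I) g"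
    if "(\<lambda>i. norm (g i)) summable_on I" for g :: "'a \<Rightarrow> complex"
    using infsetsum_infsum[of g I] that abs_summable_equivalent[of g I]
    unfolding infsetsum_def abs_summable_on_def by simp_all
  have u: "(\<lambda>i. norm (u m i)) summable_on I" for m
    by (rule Infinite_Sum.abs_summable_on_comparison_test[OF f le])
  have "(\<lambda>m. integral\<^sup>L (count_space I) (u m)) \<longlonglongrightarrow> integral\<^sup>L (count_space I) f"
  proof (rule integral_dominated_convergence)
    show "integrable (count_space I) (\<lambda>i. norm (f i))" using eq(2)[OF f] by simp
  qed (use le lim in \<open>auto simp: AE_count_space\<close>)
  then show ?thesis using eq(1)[OF f] eq(1)[OF u] by simp
qed

context alg_groupoid
begin

text \<open>The inequality between geometric and arithmetic mean replaces Cauchy-Schwarz: it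
  supplies an explicit dominating family, whose sum is 1 when both vectors have norm 1.\<close>

lemma coefficient_dominant:
  assumes \<gamma>: "\<gamma> \<in> space (arrows G)"
    and r: "((\<lambda>\<zeta>. (cmod (\<xi> \<zeta>))\<^sup>2) has_sum A) (range_fiber G (rng G \<gamma>))"
    and s: "((\<lambda>\<zeta>. (cmod (\<xi> \<zeta>))\<^sup>2) has_sum B) (range_fiber G (src G \<gamma>))"
  shows "((\<lambda>\<zeta>. ((cmod (\<xi> \<zeta>))\<^sup>2 + (cmod (\<xi> (mult G (ginv G \<gamma>) \<zeta>)))\<^sup>2) / 2) has_sum (A + B) / 2) (range_fiber G (rng G \<gamma>))"
    and "cmod (cnj (\<xi> \<zeta>) * \<xi> (mult G (ginv G \<gamma>) \<zeta>)) \<le> ((cmod (\<xi> \<zeta>))\<^sup>2 + (cmod (\<xi> (mult G (ginv G \<gamma>) \<zeta>)))\<^sup>2) / 2"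
proof -
  have "((\<lambda>\<zeta>. (cmod (\<xi> (mult G (ginv G \<gamma>) \<zeta>)))\<^sup>2) has_sum B) (range_fiber G (rng G \<gamma>))"
    using has_sum_reindex_bij_betw[OF bij_translate[OF \<gamma>], of "\<lambda>\<zeta>. (cmod (\<xi> \<zeta>))\<^sup>2"] s by simp
  from has_sum_cmult_right[OF has_sum_add[OF r this], of "1/2"]
  show "((\<lambda>\<zeta>. ((cmod (\<xi> \<zeta>))\<^sup>2 + (cmod (\<xi> (mult G (ginv G \<gamma>) \<zeta>)))\<^sup>2) / 2) has_sum (A + B) / 2) (range_fiber G (rng G \<gamma>))"
    by simp
  have "0 \<le> (cmod (\<xi> \<zeta>) - cmod (\<xi> (mult G (ginv G \<gamma>) \<zeta>)))\<^sup>2" by simp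
  then show "cmod (cnj (\<xi> \<zeta>) * \<xi> (mult G (ginv G \<gamma>) \<zeta>)) \<le> ((cmod (\<xi> \<zeta>))\<^sup>2 + (cmod (\<xi> (mult G (ginv G \<gamma>) \<zeta>)))\<^sup>2) / 2"
    unfolding power2_diff norm_mult complex_mod_cnj by simp
qed

lemma coefficient_abs_summable:
  assumes "\<gamma> \<in> space (arrows G)"
    and "((\<lambda>\<zeta>. (cmod (\<xi> \<zeta>))\<^sup>2) has_sum A) (range_fiber G (rng G \<gamma>))"
    and "((\<lambda>\<zeta>. (cmod (\<xi> \<zeta>))\<^sup>2) has_sum B) (range_fiber G (src G \<gamma>))"
  shows "(\<lambda>\<zeta>. cmod (cnj (\<xi> \<zeta>) * \<xi> (mult G (ginv G \<gamma>) \<zeta>))) summable_on (range_fiber G (rng G \<gamma>))"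
proof -
  let ?w = "\<lambda>\<zeta>. ((cmod (\<xi> \<zeta>))\<^sup>2 + (cmod (\<xi> (mult G (ginv G \<gamma>) \<zeta>)))\<^sup>2) / 2"
  have "(\<lambda>\<zeta>. norm (?w \<zeta>)) summable_on range_fiber G (rng G \<gamma>)"
    using has_sum_imp_summable[OF coefficient_dominant(1)[OF assms]] by simp
  then show ?thesis
  proof (rule Infinite_Sum.abs_summable_on_comparison_test)
    fix \<zeta>
    show "norm (cnj (\<xi> \<zeta>) * \<xi> (mult G (ginv G \<gamma>) \<zeta>)) \<le> norm (?w \<zeta>)"
      using coefficient_dominant(2)[OF assms, of \<zeta>] by simp
  qed
qed

lemma coefficient_le_1:
  assumes \<gamma>: "\<gamma> \<in> space (arrows G)"
    and r: "((\<lambda>\<zeta>. (cmod (\<xi> \<zeta>))\<^sup>2) has_sum 1) (range_fiber G (rng G \<gamma>))"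
    and s: "((\<lambda>\<zeta>. (cmod (\<xi> \<zeta>))\<^sup>2) has_sum 1) (range_fiber G (src G \<gamma>))"
  shows "cmod (coefficient G \<xi> \<gamma>) \<le> 1"
proof -
  have "(\<lambda>\<zeta>. cnj (\<xi> \<zeta>) * \<xi> (mult G (ginv G \<gamma>) \<zeta>)) summable_on (range_fiber G (rng G \<gamma>))"
    using coefficient_abs_summable[OF assms] by (rule abs_summable_summable)
  then have "((\<lambda>\<zeta>. cnj (\<xi> \<zeta>) * \<xi> (mult G (ginv G \<gamma>) \<zeta>)) has_sum coefficient G \<xi> \<gamma>) (range_fiber G (rng G \<gamma>))"
    unfolding coefficient_def by (rule has_sum_infsum)
  from norm_infsum_le[OF this coefficient_dominant(1)[OF assms] coefficient_dominant(2)[OF assms]]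
  show ?thesis by simp
qed

lemma coefficient_unit:
  assumes "x \<in> units G" "((\<lambda>\<zeta>. (cmod (\<xi> \<zeta>))\<^sup>2) has_sum A) (range_fiber G x)"
  shows "coefficient G \<xi> x = of_real A"
proof -
  have "coefficient G \<xi> x = (\<Sum>\<^sub>\<infinity>\<zeta>\<in>range_fiber G x. complex_of_real ((cmod (\<xi> \<zeta>))\<^sup>2))"
    unfolding coefficient_def rng_unit[OF assms(1)]
    by (intro infsum_cong) (simp only: ginv_unit_mult[OF assms(1)] mult.commute complex_norm_square)
  also have "\<dots> = of_real A" using assms(2) by (intro infsumI has_sum_of_real)
  finally show ?thesis .
qed

text \<open>Exhibits the matrix of a coefficient as the Gram matrix of translates of
  \<open>\<xi>\<close> on a single fibre.\<close>

lemma coefficient_translate: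
  assumes a: "a \<in> range_fiber G x" and b: "b \<in> range_fiber G x"
  shows "coefficient G \<xi> (mult G (ginv G a) b) =
    (\<Sum>\<^sub>\<infinity>\<zeta>\<in>range_fiber G x. cnj (\<xi> (mult G (ginv G a) \<zeta>)) * \<xi> (mult G (ginv G b) \<zeta>))"
proof -
  note a' = range_fiberD[OF a] and b' = range_fiberD[OF b]
  have r: "rng G (mult G (ginv G a) b) = src G a" using ginv_mult_closed a' b' by simp
  have "coefficient G \<xi> (mult G (ginv G a) b) = (\<Sum>\<^sub>\<infinity>\<zeta>\<in>range_fiber G (rng G a). cnj (\<xi> (mult G (ginv G a) \<zeta>)) *
      \<xi> (mult G (ginv G (mult G (ginv G a) b)) (mult G (ginv G a) \<zeta>)))"
    unfolding coefficient_def r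
    using infsum_reindex_bij_betw[OF bij_translate[OF a'(1)],
        of "\<lambda>\<eta>. cnj (\<xi> \<eta>) * \<xi> (mult G (ginv G (mult G (ginv G a) b)) \<eta>)"] by simp
  also have "\<dots> = (\<Sum>\<^sub>\<infinity>\<zeta>\<in>range_fiber G x. cnj (\<xi> (mult G (ginv G a) \<zeta>)) * \<xi> (mult G (ginv G b) \<zeta>))"
    unfolding a'(2)
    by (intro infsum_cong) (use ginv_mult_translate a' b' in \<open>auto simp: range_fiber_def\<close>)
  finally show ?thesis .
qed

text \<open>A Gram matrix is positive; finite supports reduce its entries to sums over one finite
  set \<open>S\<close>, so the quadratic form becomes a finite sum of squared moduli.\<close>

lemma coefficient_psd:
  assumes \<gamma>: "\<And>i. i < k \<Longrightarrow> \<gamma> i \<in> range_fiber G x"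
    and fin: "\<And>i. i < k \<Longrightarrow> finite {\<eta> \<in> range_fiber G (src G (\<gamma> i)). \<xi> \<eta> \<noteq> 0}"
  shows "psd_matrix k (\<lambda>i j. coefficient G \<xi> (mult G (ginv G (\<gamma> i)) (\<gamma> j)))"
proof -
  let ?v = "\<lambda>i \<zeta>. \<xi> (mult G (ginv G (\<gamma> i)) \<zeta>)"
  define S where "S = (\<Union>i<k. {\<zeta> \<in> range_fiber G x. ?v i \<zeta> \<noteq> 0})"
  have "finite {\<zeta> \<in> range_fiber G x. ?v i \<zeta> \<noteq> 0}" if i: "i < k" for i
  proof -
    have bij: "bij_betw (\<lambda>\<zeta>. mult G (ginv G (\<gamma> i)) \<zeta>) (range_fiber G x) (range_fiber G (src G (\<gamma> i)))"
      using bij_translate range_fiberD[OF \<gamma>[OF i]] by metis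
    have "(\<lambda>\<zeta>. mult G (ginv G (\<gamma> i)) \<zeta>) ` {\<zeta> \<in> range_fiber G x. ?v i \<zeta> \<noteq> 0} \<subseteq> {\<eta> \<in> range_fiber G (src G (\<gamma> i)). \<xi> \<eta> \<noteq> 0}"
      using bij by (auto simp: bij_betw_def)
    moreover have "inj_on (\<lambda>\<zeta>. mult G (ginv G (\<gamma> i)) \<zeta>) {\<zeta> \<in> range_fiber G x. ?v i \<zeta> \<noteq> 0}"
      using bij_betw_imp_inj_on[OF bij] by (rule inj_on_subset) auto
    ultimately show ?thesis using fin[OF i] finite_imageD finite_subset by blast
  qed
  then have S: "finite S" "S \<subseteq> range_fiber G x" unfolding S_def by auto
  have F: "coefficient G \<xi> (mult G (ginv G (\<gamma> i)) (\<gamma> j)) = (\<Sum>\<zeta>\<in>S. cnj (?v i \<zeta>) * ?v j \<zeta>)" if ij: "i < k" "j < k" for i j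
  proof -
    have "coefficient G \<xi> (mult G (ginv G (\<gamma> i)) (\<gamma> j)) = (\<Sum>\<^sub>\<infinity>\<zeta>\<in>range_fiber G x. cnj (?v i \<zeta>) * ?v j \<zeta>)"
      using \<gamma> ij by (intro coefficient_translate)
    also have "\<dots> = (\<Sum>\<^sub>\<infinity>\<zeta>\<in>S. cnj (?v i \<zeta>) * ?v j \<zeta>)"
      using ij S(2) by (intro infsum_cong_neutral) (auto simp: S_def)
    finally show ?thesis using S(1) by simp
  qed
  have "(\<Sum>i<k. \<Sum>j<k. cnj (c i) * coefficient G \<xi> (mult G (ginv G (\<gamma> i)) (\<gamma> j)) * c j) =
      of_real (\<Sum>\<zeta>\<in>S. (cmod (\<Sum>j<k. c j * ?v j \<zeta>))\<^sup>2)" for c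
  proof -
    have "(\<Sum>i<k. \<Sum>j<k. cnj (c i) * coefficient G \<xi> (mult G (ginv G (\<gamma> i)) (\<gamma> j)) * c j) =
        (\<Sum>i<k. \<Sum>j<k. \<Sum>\<zeta>\<in>S. cnj (c i * ?v i \<zeta>) * (c j * ?v j \<zeta>))"
      by (intro sum.cong refl) (simp add: F sum_distrib_left sum_distrib_right mult_ac)
    also have "\<dots> = (\<Sum>i<k. \<Sum>\<zeta>\<in>S. \<Sum>j<k. cnj (c i * ?v i \<zeta>) * (c j * ?v j \<zeta>))"
      by (intro sum.cong refl sum.swap)
    also have "\<dots> = (\<Sum>\<zeta>\<in>S. \<Sum>i<k. \<Sum>j<k. cnj (c i * ?v i \<zeta>) * (c j * ?v j \<zeta>))"
      by (rule sum.swap)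
    also have "\<dots> = (\<Sum>\<zeta>\<in>S. cnj (\<Sum>i<k. c i * ?v i \<zeta>) * (\<Sum>j<k. c j * ?v j \<zeta>))"
      by (simp add: sum_product cnj_sum del: complex_cnj_mult)
    also have "\<dots> = of_real (\<Sum>\<zeta>\<in>S. (cmod (\<Sum>j<k. c j * ?v j \<zeta>))\<^sup>2)"
      by (simp only: of_real_sum complex_norm_square mult.commute)
    finally show ?thesis .
  qed
  then show ?thesis unfolding psd_matrix_def by (simp add: sum_nonneg)
qed

text \<open>If the coefficient at \<open>\<gamma>\<close> is nonzero, some \<open>\<zeta>\<close>
  and its translate both lie in the support of \<open>\<xi>\<close>. They have the same source and
  determine \<open>\<gamma>\<close> as the product of \<open>\<zeta>\<close> with the inverse of the
  translate. One of the two lies over \<open>x\<close>, which leaves \<open>c\<close> choices for it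
  and then \<open>c\<close> for the other; passing to the source fibre exchanges their
  roles.\<close>

lemma coefficient_support:
  assumes fin: "finite {\<eta> \<in> range_fiber G x. \<xi> \<eta> \<noteq> 0}" "card {\<eta> \<in> range_fiber G x. \<xi> \<eta> \<noteq> 0} \<le> c"
    and fin': "\<And>\<eta>. \<eta> \<in> range_fiber G x \<Longrightarrow> finite {\<zeta> \<in> source_fiber G (src G \<eta>). \<xi> \<zeta> \<noteq> 0}"
      "\<And>\<eta>. \<eta> \<in> range_fiber G x \<Longrightarrow> card {\<zeta> \<in> source_fiber G (src G \<eta>). \<xi> \<zeta> \<noteq> 0} \<le> c"
    and Q: "Q = {\<gamma> \<in> space (arrows G). coefficient G \<xi> \<gamma> \<noteq> 0}"
  shows "finite (Q \<inter> range_fiber G x)" "card (Q \<inter> range_fiber G x) \<le> c * c"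
    "finite (Q \<inter> source_fiber G x)" "card (Q \<inter> source_fiber G x) \<le> c * c"
proof -
  define P where "P = (SIGMA \<eta>:{\<eta> \<in> range_fiber G x. \<xi> \<eta> \<noteq> 0}. {\<zeta> \<in> source_fiber G (src G \<eta>). \<xi> \<zeta> \<noteq> 0})"
  have P: "finite P" unfolding P_def using fin(1) fin'(1) by (intro finite_SigmaI) auto
  have cP: "card P \<le> c * c"
  proof -
    have "card P = (\<Sum>\<eta>\<in>{\<eta> \<in> range_fiber G x. \<xi> \<eta> \<noteq> 0}. card {\<zeta> \<in> source_fiber G (src G \<eta>). \<xi> \<zeta> \<noteq> 0})"
      unfolding P_def using fin(1) fin'(1) by (intro card_SigmaI) auto
    also have "\<dots> \<le> (\<Sum>\<eta>\<in>{\<eta> \<in> range_fiber G x. \<xi> \<eta> \<noteq> 0}. c)" using fin'(2) by (intro sum_mono) auto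
    also have "\<dots> \<le> c * c" using fin(2) by simp
    finally show ?thesis .
  qed
  have key: "\<exists>\<zeta>\<in>range_fiber G (rng G \<gamma>). \<xi> \<zeta> \<noteq> 0 \<and> \<xi> (mult G (ginv G \<gamma>) \<zeta>) \<noteq> 0 \<and>
      mult G (ginv G \<gamma>) \<zeta> \<in> range_fiber G (src G \<gamma>) \<and> src G (mult G (ginv G \<gamma>) \<zeta>) = src G \<zeta> \<and>
      \<gamma> = mult G \<zeta> (ginv G (mult G (ginv G \<gamma>) \<zeta>))" if \<gamma>: "\<gamma> \<in> Q" for \<gamma>
  proof -
    have g: "\<gamma> \<in> space (arrows G)" "coefficient G \<xi> \<gamma> \<noteq> 0" using \<gamma> Q by auto
    have "\<exists>\<zeta>\<in>range_fiber G (rng G \<gamma>). cnj (\<xi> \<zeta>) * \<xi> (mult G (ginv G \<gamma>) \<zeta>) \<noteq> 0"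
    proof (rule ccontr)
      assume "\<not> ?thesis"
      then have "coefficient G \<xi> \<gamma> = (\<Sum>\<^sub>\<infinity>\<zeta>\<in>range_fiber G (rng G \<gamma>). 0)"
        unfolding coefficient_def by (intro infsum_cong) blast
      then show False using g(2) by simp
    qed
    then obtain \<zeta> where \<zeta>: "\<zeta> \<in> range_fiber G (rng G \<gamma>)" "\<xi> \<zeta> \<noteq> 0" "\<xi> (mult G (ginv G \<gamma>) \<zeta>) \<noteq> 0" by auto
    note z = range_fiberD[OF \<zeta>(1)]
    have "mult G \<zeta> (ginv G (mult G (ginv G \<gamma>) \<zeta>)) = mult G \<zeta> (mult G (ginv G \<zeta>) \<gamma>)"
      using ginv_ginv_mult[OF g(1) z(1)] z(2) by simp
    also have "\<dots> = \<gamma>" using ginv_mult_cancel[OF z(1) g(1)] z(2) by simp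
    finally show ?thesis
      using \<zeta> ginv_mult_closed[OF g(1) z(1)] z(2) by (intro bexI[OF _ \<zeta>(1)]) (auto simp: range_fiber_def)
  qed
  have R: "Q \<inter> range_fiber G x \<subseteq> (\<lambda>(\<zeta>, \<eta>). mult G \<zeta> (ginv G \<eta>)) ` P"
  proof
    fix \<gamma> assume \<gamma>: "\<gamma> \<in> Q \<inter> range_fiber G x"
    then obtain \<zeta> where \<zeta>: "\<zeta> \<in> range_fiber G (rng G \<gamma>)" "\<xi> \<zeta> \<noteq> 0" "\<xi> (mult G (ginv G \<gamma>) \<zeta>) \<noteq> 0"
      "mult G (ginv G \<gamma>) \<zeta> \<in> range_fiber G (src G \<gamma>)" "src G (mult G (ginv G \<gamma>) \<zeta>) = src G \<zeta>"
      "\<gamma> = mult G \<zeta> (ginv G (mult G (ginv G \<gamma>) \<zeta>))" using key by blast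
    then have "(\<zeta>, mult G (ginv G \<gamma>) \<zeta>) \<in> P"
      using \<gamma> unfolding P_def by (auto simp: range_fiber_def source_fiber_def)
    then show "\<gamma> \<in> (\<lambda>(\<zeta>, \<eta>). mult G \<zeta> (ginv G \<eta>)) ` P"
      using \<zeta>(6) by (intro image_eqI[where x = "(\<zeta>, mult G (ginv G \<gamma>) \<zeta>)"]) simp_all
  qed
  have S: "Q \<inter> source_fiber G x \<subseteq> (\<lambda>(\<eta>, \<zeta>). mult G \<zeta> (ginv G \<eta>)) ` P"
  proof
    fix \<gamma> assume \<gamma>: "\<gamma> \<in> Q \<inter> source_fiber G x"
    then obtain \<zeta> where \<zeta>: "\<zeta> \<in> range_fiber G (rng G \<gamma>)" "\<xi> \<zeta> \<noteq> 0" "\<xi> (mult G (ginv G \<gamma>) \<zeta>) \<noteq> 0"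
      "mult G (ginv G \<gamma>) \<zeta> \<in> range_fiber G (src G \<gamma>)" "src G (mult G (ginv G \<gamma>) \<zeta>) = src G \<zeta>"
      "\<gamma> = mult G \<zeta> (ginv G (mult G (ginv G \<gamma>) \<zeta>))" using key by blast
    then have "(mult G (ginv G \<gamma>) \<zeta>, \<zeta>) \<in> P"
      using \<gamma> unfolding P_def by (auto simp: range_fiber_def source_fiber_def)
    then show "\<gamma> \<in> (\<lambda>(\<eta>, \<zeta>). mult G \<zeta> (ginv G \<eta>)) ` P"
      using \<zeta>(6) by (intro image_eqI[where x = "(mult G (ginv G \<gamma>) \<zeta>, \<zeta>)"]) simp_all
  qed
  show "finite (Q \<inter> range_fiber G x)" "finite (Q \<inter> source_fiber G x)"
    using R S P by (auto intro: finite_surj)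
  show "card (Q \<inter> range_fiber G x) \<le> c * c" using surj_card_le[OF P R] cP by simp
  show "card (Q \<inter> source_fiber G x) \<le> c * c" using surj_card_le[OF P S] cP by simp
qed

end

section \<open>Coefficients over an invariant null set\<close>

locale reduced_groupoid = sectioned_groupoid G \<mu> E N0
  for G :: "'g groupoid_data" and \<mu> :: "'g measure" and E :: "nat \<Rightarrow> 'g set" and N0 :: "'g set" +
  fixes N :: "'g set"
  assumes N_null: "N \<in> null_sets \<mu>" and N0_sub: "N0 \<subseteq> N"
    and N_invariant: "\<gamma> \<in> space (arrows G) \<Longrightarrow> rng G \<gamma> \<in> N \<longleftrightarrow> src G \<gamma> \<in> N"
begin

lemma AE_good: "(\<And>x. x \<in> units G \<Longrightarrow> x \<notin> N \<Longrightarrow> P x) \<Longrightarrow> AE x in \<mu>. P x"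
  using AE_not_in[OF N_null] AE_space space_unit_measure by (auto elim: eventually_elim2)

lemma AE_gpd_good: "(\<And>\<gamma>. \<gamma> \<in> space (arrows G) \<Longrightarrow> rng G \<gamma> \<notin> N \<Longrightarrow> P \<gamma>) \<Longrightarrow> AE \<gamma> in gpd_measure G \<mu>. P \<gamma>"
  unfolding AE_gpd using N_invariant by (intro AE_good) (auto simp: source_fiber_def)

lemma coefficient_measurable:
  assumes \<xi>: "\<xi> \<in> borel_measurable (arrows G)" and zero: "\<And>\<gamma>. rng G \<gamma> \<in> N \<Longrightarrow> \<xi> \<gamma> = 0"
    and fin: "\<And>x. x \<in> units G \<Longrightarrow> x \<notin> N \<Longrightarrow> finite {\<gamma> \<in> range_fiber G x. \<xi> \<gamma> \<noteq> 0}"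
  shows "coefficient G \<xi> \<in> borel_measurable (arrows G)"
proof -
  have "finite {\<gamma> \<in> range_fiber G x. cnj (\<xi> \<gamma>) \<noteq> 0}" if "x \<in> units G" for x
  proof (cases "x \<in> N")
    case True
    then have e: "{\<gamma> \<in> range_fiber G x. cnj (\<xi> \<gamma>) \<noteq> 0} = {}" using zero by (auto simp: range_fiber_def)
    show ?thesis unfolding e by simp
  next
    case False then show ?thesis using fin that by simp
  qed
  moreover have "(\<lambda>\<gamma>. cnj (\<xi> \<gamma>)) \<in> borel_measurable (arrows G)"
    by (rule measurable_compose[OF \<xi>]) (intro borel_measurable_continuous_onI continuous_intros)
  ultimately show ?thesis
    unfolding coefficient_def[abs_def] using \<xi> zero N0_sub
    by (intro fiber_sum_measurable) auto
qed

lemma coefficient_properties: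
  assumes \<xi>: "\<xi> \<in> borel_measurable (arrows G)" and zero: "\<And>\<gamma>. rng G \<gamma> \<in> N \<Longrightarrow> \<xi> \<gamma> = 0"
    and r: "\<And>x. x \<in> units G \<Longrightarrow> x \<notin> N \<Longrightarrow>
        finite {\<gamma> \<in> range_fiber G x. \<xi> \<gamma> \<noteq> 0} \<and> card {\<gamma> \<in> range_fiber G x. \<xi> \<gamma> \<noteq> 0} \<le> c"
    and s: "\<And>x. x \<in> units G \<Longrightarrow> x \<notin> N \<Longrightarrow>
        finite {\<gamma> \<in> source_fiber G x. \<xi> \<gamma> \<noteq> 0} \<and> card {\<gamma> \<in> source_fiber G x. \<xi> \<gamma> \<noteq> 0} \<le> c"
  shows "positive_definite G \<mu> (coefficient G \<xi>)" "has_bounded_support G \<mu> (coefficient G \<xi>)"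
proof -
  have m: "coefficient G \<xi> \<in> borel_measurable (arrows G)"
    using \<xi> zero r by (intro coefficient_measurable) auto
  have "psd_matrix k (\<lambda>i j. coefficient G \<xi> (mult G (ginv G (\<gamma> i)) (\<gamma> j)))"
    if x: "x \<in> units G - N" and \<gamma>: "\<forall>i<k. \<gamma> i \<in> range_fiber G x" for x k \<gamma>
  proof (rule coefficient_psd)
    show "\<gamma> i \<in> range_fiber G x" if "i < k" for i using \<gamma> that by blast
    show "finite {\<eta> \<in> range_fiber G (src G (\<gamma> i)). \<xi> \<eta> \<noteq> 0}" if i: "i < k" for i
    proof -
      have "\<gamma> i \<in> space (arrows G)" "rng G (\<gamma> i) = x" using \<gamma> i by (auto simp: range_fiber_def)
      then have "src G (\<gamma> i) \<in> units G" "src G (\<gamma> i) \<notin> N" using src_units N_invariant x by auto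
      then show ?thesis using r by blast
    qed
  qed
  then show "positive_definite G \<mu> (coefficient G \<xi>)"
    unfolding positive_definite_def using m N_null by blast
  define Q where "Q = {\<gamma> \<in> space (arrows G). coefficient G \<xi> \<gamma> \<noteq> 0}"
  have "Q \<in> sets (arrows G)" unfolding Q_def using m by measurable
  \<comment> \<open>The summand 1 keeps the constant positive when \<open>c = 0\<close>.\<close>
  moreover have "AE x in \<mu>. finite (Q \<inter> range_fiber G x) \<and> real (card (Q \<inter> range_fiber G x)) \<le> real (c * c) + 1 \<and>
        finite (Q \<inter> source_fiber G x) \<and> real (card (Q \<inter> source_fiber G x)) \<le> real (c * c) + 1"
  proof (rule AE_good)
    fix x assume x: "x \<in> units G" "x \<notin> N"
    have s': "finite {\<zeta> \<in> source_fiber G (src G \<eta>). \<xi> \<zeta> \<noteq> 0} \<and> card {\<zeta> \<in> source_fiber G (src G \<eta>). \<xi> \<zeta> \<noteq> 0} \<le> c"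
      if "\<eta> \<in> range_fiber G x" for \<eta>
      using s[of "src G \<eta>"] that x src_units N_invariant by (auto simp: range_fiber_def)
    note cs = coefficient_support[OF conjunct1[OF r[OF x]] conjunct2[OF r[OF x]] conjunct1[OF s'] conjunct2[OF s'] Q_def]
    have "real n \<le> real (c * c) + 1" if "n \<le> c * c" for n
      using of_nat_mono[OF that, where 'a = real] by linarith
    then show "finite (Q \<inter> range_fiber G x) \<and> real (card (Q \<inter> range_fiber G x)) \<le> real (c * c) + 1 \<and>
        finite (Q \<inter> source_fiber G x) \<and> real (card (Q \<inter> source_fiber G x)) \<le> real (c * c) + 1"
      using cs by blast
  qed
  then have "\<exists>c>0. AE x in \<mu>. finite (Q \<inter> range_fiber G x) \<and> real (card (Q \<inter> range_fiber G x)) \<le> c \<and>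
        finite (Q \<inter> source_fiber G x) \<and> real (card (Q \<inter> source_fiber G x)) \<le> c"
    by (intro exI[of _ "real (c * c) + 1"] conjI) (intro add_nonneg_pos of_nat_0_le_iff zero_less_one)
  ultimately have "bounded_subset G \<mu> Q" unfolding bounded_subset_def by blast
  then show "has_bounded_support G \<mu> (coefficient G \<xi>)"
    unfolding has_bounded_support_def by (rule exI[of _ Q, OF conjI]) (auto simp: Q_def)
qed

end

section \<open>From amenability to positive definite functions\<close>

context reduced_groupoid
begin

text \<open>Membership in a section bounds the range fibres, and membership of the inverse in a
  section bounds the source fibres; bounded support requires both.\<close>

definition blk :: "nat \<Rightarrow> 'g set" where
  "blk m = {\<gamma> \<in> space (arrows G). rng G \<gamma> \<notin> N \<and> (\<exists>i\<le>m. \<gamma> \<in> E i) \<and> (\<exists>j\<le>m. ginv G \<gamma> \<in> E j)}"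

lemma blk_sets: "blk m \<in> sets (arrows G)"
proof -
  have "blk m = (space (arrows G) - {\<gamma> \<in> space (arrows G). rng G \<gamma> \<in> N}) \<inter> (\<Union>i\<in>{..m}. E i) \<inter>
      (\<Union>j\<in>{..m}. {\<gamma> \<in> space (arrows G). ginv G \<gamma> \<in> E j})"
    unfolding blk_def by auto
  then show ?thesis
    using rng_vimage_sets[of N] N_null E_sets ginv_vimage_sets[OF E_sets] by auto
qed

lemma blk_range: "finite (blk m \<inter> range_fiber G x) \<and> card (blk m \<inter> range_fiber G x) \<le> Suc m"
proof -
  have "blk m \<inter> range_fiber G x \<subseteq> (\<lambda>i. sec i x) ` {..m}"
  proof
    fix \<gamma> assume \<gamma>: "\<gamma> \<in> blk m \<inter> range_fiber G x"
    then obtain i where i: "i \<le> m" "\<gamma> \<in> E i" "rng G \<gamma> = x" by (auto simp: blk_def range_fiber_def)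
    then have d: "x \<in> sdom i" by (auto simp: sdom_def)
    then have "sec i x = \<gamma>" using sec_in[OF d] rng_sec[OF d] i E_inj[of i] by (auto dest: inj_onD)
    then show "\<gamma> \<in> (\<lambda>i. sec i x) ` {..m}" using i by blast
  qed
  from finite_subset[OF this] surj_card_le[OF _ this] show ?thesis by simp
qed

lemma blk_source: "finite (blk m \<inter> source_fiber G x) \<and> card (blk m \<inter> source_fiber G x) \<le> Suc m"
proof -
  have "blk m \<inter> source_fiber G x \<subseteq> (\<lambda>i. ginv G (sec i x)) ` {..m}"
  proof
    fix \<gamma> assume \<gamma>: "\<gamma> \<in> blk m \<inter> source_fiber G x"
    then obtain i where i: "i \<le> m" "ginv G \<gamma> \<in> E i" "src G \<gamma> = x" "\<gamma> \<in> space (arrows G)"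
      by (auto simp: blk_def source_fiber_def)
    then have r: "rng G (ginv G \<gamma>) = x" using rng_ginv by simp
    then have d: "x \<in> sdom i" using i by (auto simp: sdom_def)
    have "sec i x = ginv G \<gamma>"
      by (rule inj_onD[OF E_inj[of i]]) (use sec_in[OF d] rng_sec[OF d] i(2) r in simp_all)
    then have "\<gamma> = ginv G (sec i x)" using ginv_ginv i by simp
    then show "\<gamma> \<in> (\<lambda>i. ginv G (sec i x)) ` {..m}" using i by blast
  qed
  from finite_subset[OF this] surj_card_le[OF _ this] show ?thesis by simp
qed

lemma blk_exhaust:
  assumes "\<gamma> \<in> space (arrows G)" "rng G \<gamma> \<notin> N"
  shows "eventually (\<lambda>m. \<gamma> \<in> blk m) sequentially"
proof -
  have "\<gamma> \<in> (\<Union>n. E n)" unfolding E_UN using assms N0_sub by auto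
  then obtain i where i: "\<gamma> \<in> E i" by blast
  have "ginv G \<gamma> \<in> (\<Union>n. E n)"
    unfolding E_UN using assms N0_sub ginv_closed rng_ginv N_invariant by auto
  then obtain j where j: "ginv G \<gamma> \<in> E j" by blast
  have "\<gamma> \<in> blk m" if "max i j \<le> m" for m
    unfolding blk_def using assms i j that by auto
  then show ?thesis unfolding eventually_sequentially by blast
qed

text \<open>The squared norm of the restriction of \<open>\<xi>\<close> to \<open>blk m\<close> on
  the fibre through \<open>\<gamma>\<close>. The complex values and the factor 1 give it the shape
  of \<open>fiber_sum_measurable\<close>.\<close>

definition mass :: "('g \<Rightarrow> complex) \<Rightarrow> nat \<Rightarrow> 'g \<Rightarrow> real" where
  "mass \<xi> m \<gamma> = Re (\<Sum>\<^sub>\<infinity>\<zeta>\<in>range_fiber G (rng G \<gamma>).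
     (indicator (blk m) \<zeta> * complex_of_real ((cmod (\<xi> \<zeta>))\<^sup>2)) * 1)"

text \<open>Where nothing of \<open>\<xi>\<close> survives in the block, the unit vector at the base
  point takes over, so that the norm is 1 on every good fibre and for every
  \<open>m\<close>.\<close>

definition trunc :: "('g \<Rightarrow> complex) \<Rightarrow> nat \<Rightarrow> 'g \<Rightarrow> complex" where
  "trunc \<xi> m \<gamma> = (if rng G \<gamma> \<in> N then 0
     else if 0 < mass \<xi> m \<gamma> then indicator (blk m) \<gamma> * \<xi> \<gamma> / complex_of_real (sqrt (mass \<xi> m \<gamma>))
     else indicator (units G) \<gamma>)"

lemma mass_measurable:
  assumes "\<xi> \<in> borel_measurable (arrows G)"
  shows "mass \<xi> m \<in> borel_measurable (arrows G)"
proof -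
  have "(\<lambda>\<gamma>. \<Sum>\<^sub>\<infinity>\<zeta>\<in>range_fiber G (rng G \<gamma>).
     (indicator (blk m) \<zeta> * complex_of_real ((cmod (\<xi> \<zeta>))\<^sup>2)) * 1) \<in> borel_measurable (arrows G)"
  proof (rule fiber_sum_measurable)
    show "(\<lambda>\<zeta>. indicator (blk m) \<zeta> * complex_of_real ((cmod (\<xi> \<zeta>))\<^sup>2)) \<in> borel_measurable (arrows G)"
      using assms blk_sets[of m] by measurable
    show "indicator (blk m) \<gamma> * complex_of_real ((cmod (\<xi> \<gamma>))\<^sup>2) = 0" if "rng G \<gamma> \<in> N0" for \<gamma>
      using that N0_sub by (auto simp: blk_def indicator_def)
    show "finite {\<gamma> \<in> range_fiber G x. indicator (blk m) \<gamma> * complex_of_real ((cmod (\<xi> \<gamma>))\<^sup>2) \<noteq> 0}" for x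
      by (rule finite_subset[OF _ conjunct1[OF blk_range[of m x]]]) (auto simp: indicator_def split: if_splits)
  qed simp
  then show ?thesis unfolding mass_def[abs_def] by measurable
qed

lemma mass_eq: "mass \<xi> m \<gamma> = (\<Sum>\<zeta>\<in>blk m \<inter> range_fiber G (rng G \<gamma>). (cmod (\<xi> \<zeta>))\<^sup>2)"
proof -
  have "(\<Sum>\<^sub>\<infinity>\<zeta>\<in>range_fiber G (rng G \<gamma>). (indicator (blk m) \<zeta> * complex_of_real ((cmod (\<xi> \<zeta>))\<^sup>2)) * 1) =
      (\<Sum>\<^sub>\<infinity>\<zeta>\<in>blk m \<inter> range_fiber G (rng G \<gamma>). complex_of_real ((cmod (\<xi> \<zeta>))\<^sup>2))"
    by (rule infsum_cong_neutral) auto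
  also have "\<dots> = complex_of_real (\<Sum>\<zeta>\<in>blk m \<inter> range_fiber G (rng G \<gamma>). (cmod (\<xi> \<zeta>))\<^sup>2)"
    using blk_range by (subst infsum_finite) auto
  finally show ?thesis unfolding mass_def by simp
qed

lemma trunc_measurable:
  assumes "\<xi> \<in> borel_measurable (arrows G)"
  shows "trunc \<xi> m \<in> borel_measurable (arrows G)"
proof -
  have [measurable]: "Measurable.pred (arrows G) (\<lambda>\<gamma>. rng G \<gamma> \<in> N)"
    unfolding pred_def using rng_vimage_sets[of N] N_null by auto
  note [measurable] = assms mass_measurable[OF assms] blk_sets units_sets
  show ?thesis unfolding trunc_def[abs_def] by measurable
qed

lemma trunc_support:
  "{\<gamma> \<in> range_fiber G x. trunc \<xi> m \<gamma> \<noteq> 0} \<subseteq> insert x (blk m \<inter> range_fiber G x)"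
  "{\<gamma> \<in> source_fiber G x. trunc \<xi> m \<gamma> \<noteq> 0} \<subseteq> insert x (blk m \<inter> source_fiber G x)"
  using rng_unit src_unit
  by (auto simp: trunc_def range_fiber_def source_fiber_def indicator_def split: if_splits)

text \<open>The bound \<open>m + 2\<close> counts \<open>Suc m\<close> arrows of the block and one
  unit from the default value.\<close>

lemma trunc_finite:
  "finite {\<gamma> \<in> range_fiber G x. trunc \<xi> m \<gamma> \<noteq> 0} \<and> card {\<gamma> \<in> range_fiber G x. trunc \<xi> m \<gamma> \<noteq> 0} \<le> m + 2"
  "finite {\<gamma> \<in> source_fiber G x. trunc \<xi> m \<gamma> \<noteq> 0} \<and> card {\<gamma> \<in> source_fiber G x. trunc \<xi> m \<gamma> \<noteq> 0} \<le> m + 2"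
proof -
  have *: "finite A \<and> card A \<le> m + 2" if "A \<subseteq> insert x B" "finite B \<and> card B \<le> Suc m" for A B :: "'g set"
  proof -
    have "finite A" using that finite_subset by auto
    moreover have "card A \<le> card (insert x B)" using that by (intro card_mono) auto
    moreover have "card (insert x B) \<le> Suc (card B)" by (simp add: card_insert_le_m1 card_insert_if)
    ultimately show ?thesis using that by simp
  qed
  show "finite {\<gamma> \<in> range_fiber G x. trunc \<xi> m \<gamma> \<noteq> 0} \<and> card {\<gamma> \<in> range_fiber G x. trunc \<xi> m \<gamma> \<noteq> 0} \<le> m + 2"
    using *[OF trunc_support(1) blk_range] .
  show "finite {\<gamma> \<in> source_fiber G x. trunc \<xi> m \<gamma> \<noteq> 0} \<and> card {\<gamma> \<in> source_fiber G x. trunc \<xi> m \<gamma> \<noteq> 0} \<le> m + 2"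
    using *[OF trunc_support(2) blk_source] .
qed

lemma trunc_has_sum:
  assumes x: "x \<in> units G" "x \<notin> N"
  shows "((\<lambda>\<gamma>. (cmod (trunc \<xi> m \<gamma>))\<^sup>2) has_sum 1) (range_fiber G x)"
proof (cases "0 < mass \<xi> m x")
  case True
  have mass: "mass \<xi> m \<gamma> = mass \<xi> m x" if "\<gamma> \<in> range_fiber G x" for \<gamma>
    using that rng_unit[OF x(1)] by (simp add: mass_def range_fiber_def)
  have t: "trunc \<xi> m \<gamma> = indicator (blk m) \<gamma> * \<xi> \<gamma> / complex_of_real (sqrt (mass \<xi> m x))" if "\<gamma> \<in> range_fiber G x" for \<gamma>
    using that x True mass by (auto simp: trunc_def range_fiber_def)
  show ?thesis
  proof (rule has_sum_finite_neutralI)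
    show "finite (blk m \<inter> range_fiber G x)" using blk_range by blast
    have "(\<Sum>\<gamma>\<in>blk m \<inter> range_fiber G x. (cmod (trunc \<xi> m \<gamma>))\<^sup>2) =
        (\<Sum>\<gamma>\<in>blk m \<inter> range_fiber G x. (cmod (\<xi> \<gamma>))\<^sup>2 / mass \<xi> m x)"
      using True by (intro sum.cong) (auto simp: t norm_divide power_divide)
    also have "\<dots> = (\<Sum>\<gamma>\<in>blk m \<inter> range_fiber G x. (cmod (\<xi> \<gamma>))\<^sup>2) / mass \<xi> m x"
      by (rule sum_divide_distrib[symmetric])
    also have "(\<Sum>\<gamma>\<in>blk m \<inter> range_fiber G x. (cmod (\<xi> \<gamma>))\<^sup>2) = mass \<xi> m x"
      using mass_eq[of \<xi> m x] rng_unit[OF x(1)] by simp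
    finally show "1 = (\<Sum>\<gamma>\<in>blk m \<inter> range_fiber G x. (cmod (trunc \<xi> m \<gamma>))\<^sup>2)" using True by simp
  qed (auto simp: t)
next
  case False
  have t: "trunc \<xi> m \<gamma> = indicator {x} \<gamma>" if "\<gamma> \<in> range_fiber G x" for \<gamma>
  proof -
    have "mass \<xi> m \<gamma> = mass \<xi> m x" using that rng_unit[OF x(1)] by (simp add: mass_def range_fiber_def)
    moreover have "\<gamma> \<in> units G \<longleftrightarrow> \<gamma> = x" using that x rng_unit by (auto simp: range_fiber_def)
    ultimately show ?thesis using that False x by (auto simp: trunc_def range_fiber_def indicator_def)
  qed
  show ?thesis
    by (rule has_sum_finite_neutralI[of "{x}"]) (use t unit_in_fiber[OF x(1)] in auto)
qed

lemma trunc_coefficient: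
  assumes "\<xi> \<in> borel_measurable (arrows G)"
  shows "positive_definite G \<mu> (coefficient G (trunc \<xi> m))"
    and "has_bounded_support G \<mu> (coefficient G (trunc \<xi> m))"
    and "coefficient G (trunc \<xi> m) \<in> borel_measurable (arrows G)"
    and "x \<in> units G \<Longrightarrow> x \<notin> N \<Longrightarrow> coefficient G (trunc \<xi> m) x = 1"
    and "\<gamma> \<in> space (arrows G) \<Longrightarrow> rng G \<gamma> \<notin> N \<Longrightarrow> cmod (coefficient G (trunc \<xi> m) \<gamma>) \<le> 1"
proof -
  note m = trunc_measurable[OF assms]
  have z: "trunc \<xi> m \<gamma> = 0" if "rng G \<gamma> \<in> N" for \<gamma> using that by (simp add: trunc_def)
  show "positive_definite G \<mu> (coefficient G (trunc \<xi> m))" "has_bounded_support G \<mu> (coefficient G (trunc \<xi> m))"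
    by (rule coefficient_properties[OF m z trunc_finite(1) trunc_finite(2)]; assumption)+
  show "coefficient G (trunc \<xi> m) \<in> borel_measurable (arrows G)"
    using trunc_finite by (intro coefficient_measurable m z) auto
  show "coefficient G (trunc \<xi> m) x = 1" if "x \<in> units G" "x \<notin> N" for x
    using coefficient_unit[OF that(1) trunc_has_sum[OF that]] by simp
  show "cmod (coefficient G (trunc \<xi> m) \<gamma>) \<le> 1" if "\<gamma> \<in> space (arrows G)" "rng G \<gamma> \<notin> N" for \<gamma>
    using that rng_units src_units N_invariant by (intro coefficient_le_1 trunc_has_sum) auto
qed

lemma mass_tendsto:
  assumes x: "x \<in> units G" "x \<notin> N" and s: "((\<lambda>\<zeta>. (cmod (\<xi> \<zeta>))\<^sup>2) has_sum 1) (range_fiber G x)"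
  shows "(\<lambda>m. mass \<xi> m x) \<longlonglongrightarrow> 1"
proof -
  have "(\<lambda>m. \<Sum>\<^sub>\<infinity>\<zeta>\<in>range_fiber G x. (indicator (blk m) \<zeta> * complex_of_real ((cmod (\<xi> \<zeta>))\<^sup>2)) * 1)
      \<longlonglongrightarrow> (\<Sum>\<^sub>\<infinity>\<zeta>\<in>range_fiber G x. complex_of_real ((cmod (\<xi> \<zeta>))\<^sup>2))"
  proof (rule infsum_dominated_tendsto)
    show "(\<lambda>i. cmod (complex_of_real ((cmod (\<xi> i))\<^sup>2))) summable_on range_fiber G x"
      using has_sum_imp_summable[OF s] by (simp add: norm_power)
    show "(\<lambda>m. (indicator (blk m) \<zeta> * complex_of_real ((cmod (\<xi> \<zeta>))\<^sup>2)) * 1) \<longlonglongrightarrow> complex_of_real ((cmod (\<xi> \<zeta>))\<^sup>2)"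
      if \<zeta>: "\<zeta> \<in> range_fiber G x" for \<zeta>
    proof (rule tendsto_eventually)
      show "\<forall>\<^sub>F m in sequentially. (indicator (blk m) \<zeta> * complex_of_real ((cmod (\<xi> \<zeta>))\<^sup>2)) * 1 = complex_of_real ((cmod (\<xi> \<zeta>))\<^sup>2)"
      proof -
        have "\<forall>\<^sub>F m in sequentially. \<zeta> \<in> blk m"
          using \<zeta> x by (intro blk_exhaust) (auto simp: range_fiber_def)
        then show ?thesis by eventually_elim simp
      qed
    qed
  qed (auto simp: indicator_def)
  moreover have "(\<Sum>\<^sub>\<infinity>\<zeta>\<in>range_fiber G x. complex_of_real ((cmod (\<xi> \<zeta>))\<^sup>2)) = 1"
    using s by (intro infsumI) (auto dest: has_sum_of_real[where 'a = complex])
  ultimately show ?thesis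
    using tendsto_Re unfolding mass_def rng_unit[OF x(1)] by fastforce
qed

text \<open>Once the masses at both ends are positive, the coefficient is a cut-off sum divided by
  the norms at range and source. The sum converges by domination and the norms tend to 1.\<close>

lemma trunc_tendsto:
  assumes s: "\<And>x. x \<in> units G \<Longrightarrow> x \<notin> N \<Longrightarrow> ((\<lambda>\<zeta>. (cmod (\<xi> \<zeta>))\<^sup>2) has_sum 1) (range_fiber G x)"
    and \<gamma>: "\<gamma> \<in> space (arrows G)" "rng G \<gamma> \<notin> N"
  shows "(\<lambda>m. coefficient G (trunc \<xi> m) \<gamma>) \<longlonglongrightarrow> coefficient G \<xi> \<gamma>"
proof -
  let ?x = "rng G \<gamma>" and ?y = "src G \<gamma>" and ?t = "\<lambda>\<zeta>. mult G (ginv G \<gamma>) \<zeta>"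
  have x: "?x \<in> units G" and y: "?y \<in> units G" "?y \<notin> N"
    using \<gamma> rng_units src_units N_invariant by auto
  define num where "num m = (\<Sum>\<^sub>\<infinity>\<zeta>\<in>range_fiber G ?x. indicator (blk m) \<zeta> * indicator (blk m) (?t \<zeta>) *
      (cnj (\<xi> \<zeta>) * \<xi> (?t \<zeta>)))" for m
  have t: "?t \<zeta> \<in> space (arrows G)" "rng G (?t \<zeta>) = ?y" if "\<zeta> \<in> range_fiber G ?x" for \<zeta>
    using ginv_mult_closed[OF \<gamma>(1)] that by (auto simp: range_fiber_def)
  have "num \<longlonglongrightarrow> coefficient G \<xi> \<gamma>"
    unfolding num_def coefficient_def
  proof (rule infsum_dominated_tendsto)
    show "(\<lambda>\<zeta>. cmod (cnj (\<xi> \<zeta>) * \<xi> (?t \<zeta>))) summable_on range_fiber G ?x"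
      by (rule coefficient_abs_summable[OF \<gamma>(1) s[OF x \<gamma>(2)] s[OF y]])
    show "(\<lambda>m. indicator (blk m) \<zeta> * indicator (blk m) (?t \<zeta>) * (cnj (\<xi> \<zeta>) * \<xi> (?t \<zeta>))) \<longlonglongrightarrow> cnj (\<xi> \<zeta>) * \<xi> (?t \<zeta>)"
      if \<zeta>: "\<zeta> \<in> range_fiber G ?x" for \<zeta>
    proof (rule tendsto_eventually)
      have "\<forall>\<^sub>F m in sequentially. \<zeta> \<in> blk m" "\<forall>\<^sub>F m in sequentially. ?t \<zeta> \<in> blk m"
        using blk_exhaust[of \<zeta>] blk_exhaust[of "?t \<zeta>"] t[OF \<zeta>] \<zeta> y \<gamma> by (auto simp: range_fiber_def)
      then show "\<forall>\<^sub>F m in sequentially. indicator (blk m) \<zeta> * indicator (blk m) (?t \<zeta>) * (cnj (\<xi> \<zeta>) * \<xi> (?t \<zeta>)) =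
          cnj (\<xi> \<zeta>) * \<xi> (?t \<zeta>)"
        by eventually_elim simp
    qed
  qed (auto simp: indicator_def)
  moreover note mass_tendsto[OF x \<gamma>(2) s[OF x \<gamma>(2)]] mass_tendsto[OF y s[OF y]]
  ultimately have "(\<lambda>m. num m / (of_real (sqrt (mass \<xi> m ?x)) * of_real (sqrt (mass \<xi> m ?y)))) \<longlonglongrightarrow>
      coefficient G \<xi> \<gamma> / (of_real (sqrt 1) * of_real (sqrt 1))"
    by (intro tendsto_intros) auto
  moreover have "\<forall>\<^sub>F m in sequentially. num m / (of_real (sqrt (mass \<xi> m ?x)) * of_real (sqrt (mass \<xi> m ?y))) =
      coefficient G (trunc \<xi> m) \<gamma>"
  proof -
    have "\<forall>\<^sub>F m in sequentially. 0 < mass \<xi> m ?x" "\<forall>\<^sub>F m in sequentially. 0 < mass \<xi> m ?y"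
      using order_tendstoD(1)[OF mass_tendsto[OF x \<gamma>(2) s[OF x \<gamma>(2)]], of 0]
        order_tendstoD(1)[OF mass_tendsto[OF y s[OF y]], of 0] by auto
    then show ?thesis
    proof eventually_elim
      case (elim m)
      have "cnj (trunc \<xi> m \<zeta>) * trunc \<xi> m (?t \<zeta>) =
          (indicator (blk m) \<zeta> * indicator (blk m) (?t \<zeta>) * (cnj (\<xi> \<zeta>) * \<xi> (?t \<zeta>))) *
          (1 / (of_real (sqrt (mass \<xi> m ?x)) * of_real (sqrt (mass \<xi> m ?y))))" if \<zeta>: "\<zeta> \<in> range_fiber G ?x" for \<zeta>
      proof -
        have m: "mass \<xi> m \<zeta> = mass \<xi> m ?x" "mass \<xi> m (?t \<zeta>) = mass \<xi> m ?y"
          using \<zeta> t[OF \<zeta>] rng_unit[OF x] rng_unit[OF y(1)] by (simp_all add: mass_def range_fiber_def)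
        have "trunc \<xi> m \<zeta> = indicator (blk m) \<zeta> * \<xi> \<zeta> / of_real (sqrt (mass \<xi> m ?x))"
          using \<zeta> \<gamma> elim m by (auto simp: trunc_def range_fiber_def)
        moreover have "trunc \<xi> m (?t \<zeta>) = indicator (blk m) (?t \<zeta>) * \<xi> (?t \<zeta>) / of_real (sqrt (mass \<xi> m ?y))"
          using t[OF \<zeta>] y elim m by (auto simp: trunc_def)
        moreover have "cnj (indicator (blk m) \<zeta>) = indicator (blk m) \<zeta>" by (simp add: indicator_def)
        ultimately show ?thesis by simp
      qed
      then have "coefficient G (trunc \<xi> m) \<gamma> = num m * (1 / (of_real (sqrt (mass \<xi> m ?x)) * of_real (sqrt (mass \<xi> m ?y))))"
        unfolding coefficient_def num_def infsum_cmult_left'[symmetric] by (intro infsum_cong)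
      then show ?case by simp
    qed
  qed
  ultimately show ?thesis by (auto dest: Lim_transform_eventually)
qed

end

text \<open>Here \<open>b\<close> is the given coefficient and \<open>a\<close> its truncation. The
  bound is linear in \<open>cmod (a - b)\<close> and \<open>1 - Re b\<close>, the quantities
  controlled by dominated convergence and by weak* convergence. The factor 4 in front of
  \<open>cmod (a - b)\<close> uses that this distance is at most 2.\<close>

lemma cmod_diff_1_square:
  assumes "cmod a \<le> 1" "cmod b \<le> 1"
  shows "(cmod (a - 1))\<^sup>2 \<le> 4 * cmod (a - b) + 4 * (1 - Re b)"
proof -
  have "cmod (a - 1) \<le> cmod (a - b) + cmod (b - 1)" using norm_triangle_ineq[of "a - b" "b - 1"] by simp
  then have "(cmod (a - 1))\<^sup>2 \<le> (cmod (a - b) + cmod (b - 1))\<^sup>2" by (intro power_mono) auto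
  also have "\<dots> \<le> 2 * (cmod (a - b))\<^sup>2 + 2 * (cmod (b - 1))\<^sup>2"
    using sum_squares_bound[of "cmod (a - b)" "cmod (b - 1)"] by (simp add: power2_sum)
  also have "(cmod (a - b))\<^sup>2 \<le> 2 * cmod (a - b)"
    using norm_triangle_ineq4[of a b] assms by (simp add: power2_eq_square mult_right_mono)
  also have "(cmod (b - 1))\<^sup>2 = (cmod b)\<^sup>2 + 1 - 2 * Re b"
    unfolding cmod_power2 by (simp add: power2_eq_square algebra_simps)
  also have "(cmod b)\<^sup>2 \<le> 1" using assms(2) by (simp add: power_le_one)
  finally show ?thesis by simp
qed

context sectioned_groupoid
begin

lemma amenable_imp_positive_definite:
  assumes "amenable G \<mu>"
  shows "\<exists>F :: nat \<Rightarrow> 'g \<Rightarrow> complex. (\<forall>n. positive_definite G \<mu> (F n)) \<and> (\<forall>n. AE x in \<mu>. F n x = 1) \<and>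
       (\<forall>n. has_bounded_support G \<mu> (F n)) \<and> (AE \<gamma> in gpd_measure G \<mu>. (\<lambda>n. F n \<gamma>) \<longlonglongrightarrow> 1)"
proof -
  let ?\<nu> = "gpd_measure G \<mu>"
  obtain \<xi> :: "nat \<Rightarrow> 'g \<Rightarrow> complex" where \<xi>: "\<And>n. \<xi> n \<in> borel_measurable (arrows G)"
    "\<And>n. AE x in \<mu>. ((\<lambda>\<gamma>. (cmod (\<xi> n \<gamma>))\<^sup>2) has_sum 1) (range_fiber G x)"
    "weak_star_tendsto ?\<nu> (\<lambda>n. coefficient G (\<xi> n)) (\<lambda>_. 1)"
    using assms unfolding amenable_def by blast
  have "AE x in \<mu>. \<forall>n. ((\<lambda>\<gamma>. (cmod (\<xi> n \<gamma>))\<^sup>2) has_sum 1) (range_fiber G x)"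
    using \<xi>(2) by (simp add: AE_all_countable)
  from invariant_null_set[OF this]
  obtain N where N: "N \<in> null_sets \<mu>" "N0 \<subseteq> N" "\<forall>\<gamma>\<in>space (arrows G). rng G \<gamma> \<in> N \<longleftrightarrow> src G \<gamma> \<in> N"
    "\<forall>x\<in>units G - N. \<forall>n. ((\<lambda>\<gamma>. (cmod (\<xi> n \<gamma>))\<^sup>2) has_sum 1) (range_fiber G x)" by blast
  interpret reduced_groupoid G \<mu> E N0 N
    by unfold_locales (use N in auto)
  have s: "((\<lambda>\<gamma>. (cmod (\<xi> n \<gamma>))\<^sup>2) has_sum 1) (range_fiber G x)" if "x \<in> units G" "x \<notin> N" for x n
    using N(4) that by blast
  define \<phi> where "\<phi> n = coefficient G (\<xi> n)" for n
  define F where "F n m = coefficient G (trunc (\<xi> n) m)" for n m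
  have borel_eq: "borel_measurable ?\<nu> = borel_measurable (arrows G)" by (rule measurable_cong_sets[OF sets_gpd refl])
  have [measurable]: "\<phi> n \<in> borel_measurable ?\<nu>" for n
    using \<xi>(3) unfolding weak_star_tendsto_def L_infinity_def \<phi>_def by blast
  have [measurable]: "F n m \<in> borel_measurable ?\<nu>" for n m
    unfolding borel_eq F_def by (rule trunc_coefficient(3)[OF \<xi>(1)])
  have \<phi>1: "AE \<gamma> in ?\<nu>. cmod (\<phi> n \<gamma>) \<le> 1" for n
    unfolding \<phi>_def using rng_units src_units N_invariant s
    by (intro AE_gpd_good coefficient_le_1) auto
  have F1: "AE \<gamma> in ?\<nu>. cmod (F n m \<gamma>) \<le> 1" for n m
    unfolding F_def using trunc_coefficient(5)[OF \<xi>(1)] by (intro AE_gpd_good) auto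
  have lim: "AE \<gamma> in ?\<nu>. (\<lambda>m. F n m \<gamma>) \<longlonglongrightarrow> \<phi> n \<gamma>" for n
    unfolding F_def \<phi>_def by (intro AE_gpd_good trunc_tendsto s) auto
  \<comment> \<open>The measure on arrows is only sigma-finite. A strictly positive integrable
    weight is an admissible test function, and convergence against it can still be divided out
    pointwise.\<close>
  obtain h0 :: "'g \<Rightarrow> ennreal" where h0: "h0 \<in> borel_measurable ?\<nu>" "integral\<^sup>N ?\<nu> h0 \<noteq> \<infinity>"
    "\<And>x. x \<in> space ?\<nu> \<Longrightarrow> 0 < h0 x \<and> h0 x < \<infinity>"
    using sigma_finite_measure.Ex_finite_integrable_function[OF sigma_finite_gpd] by blast
  define h where "h x = enn2real (h0 x)" for x
  have [measurable]: "h \<in> borel_measurable ?\<nu>" unfolding h_def[abs_def] using h0(1) by measurable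
  have hpos: "0 < h x" if "x \<in> space ?\<nu>" for x
    using h0(3)[OF that] unfolding h_def by (simp add: enn2real_positive_iff)
  have h_nonneg: "0 \<le> h x" for x unfolding h_def by simp
  have "(\<integral>\<^sup>+ x. ennreal (h x) \<partial>?\<nu>) = integral\<^sup>N ?\<nu> h0"
    using h0(3) unfolding h_def by (intro nn_integral_cong) (simp add: less_top)
  then have hint: "integrable ?\<nu> h"
    using h0(2) h_nonneg by (intro integrableI_nonneg) (auto simp: less_top)
  have bound_int: "integrable ?\<nu> (\<lambda>x. g x * h x)"
    if "g \<in> borel_measurable ?\<nu>" "AE x in ?\<nu>. \<bar>g x\<bar> \<le> C" for g :: "'g \<Rightarrow> real" and C
  proof (rule Bochner_Integration.integrable_bound)
    show "integrable ?\<nu> (\<lambda>x. C * h x)" using hint by simp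
    show "(\<lambda>x. g x * h x) \<in> borel_measurable ?\<nu>" using that(1) by measurable
    show "AE x in ?\<nu>. norm (g x * h x) \<le> norm (C * h x)"
      using that(2) by eventually_elim (use h_nonneg in \<open>auto simp: abs_mult intro!: mult_right_mono\<close>)
  qed
  define v where "v n = (\<integral>x. (1 - Re (\<phi> n x)) * h x \<partial>?\<nu>)" for n
  have re1: "AE x in ?\<nu>. \<bar>1 - Re (\<phi> n x)\<bar> \<le> 2" for n
    using \<phi>1[of n]
  proof eventually_elim
    case (elim x)
    then show ?case using abs_Re_le_cmod[of "\<phi> n x"] by linarith
  qed
  have v: "v \<longlonglongrightarrow> 0"
  proof -
    have hc: "integrable ?\<nu> (\<lambda>x. complex_of_real (h x))" using hint by (rule integrable_of_real)
    then have "(\<lambda>n. \<integral>x. \<phi> n x * complex_of_real (h x) \<partial>?\<nu>) \<longlonglongrightarrow> (\<integral>x. 1 * complex_of_real (h x) \<partial>?\<nu>)"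
      using \<xi>(3) unfolding weak_star_tendsto_def \<phi>_def by blast
    then have "(\<lambda>n. Re (\<integral>x. \<phi> n x * complex_of_real (h x) \<partial>?\<nu>)) \<longlonglongrightarrow> Re (\<integral>x. 1 * complex_of_real (h x) \<partial>?\<nu>)"
      by (rule tendsto_Re)
    moreover have "Re (\<integral>x. 1 * complex_of_real (h x) \<partial>?\<nu>) = (\<integral>x. h x \<partial>?\<nu>)" by simp
    moreover have "Re (\<integral>x. \<phi> n x * complex_of_real (h x) \<partial>?\<nu>) = (\<integral>x. h x \<partial>?\<nu>) - v n" for n
    proof -
      have i: "integrable ?\<nu> (\<lambda>x. \<phi> n x * complex_of_real (h x))"
      proof (rule Bochner_Integration.integrable_bound[OF hint])
        show "(\<lambda>x. \<phi> n x * complex_of_real (h x)) \<in> borel_measurable ?\<nu>" by measurable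
        show "AE x in ?\<nu>. norm (\<phi> n x * complex_of_real (h x)) \<le> norm (h x)"
          using \<phi>1[of n] by eventually_elim (use h_nonneg in \<open>auto simp: norm_mult intro!: mult_left_le_one_le\<close>)
      qed
      have "Re (\<integral>x. \<phi> n x * complex_of_real (h x) \<partial>?\<nu>) = (\<integral>x. Re (\<phi> n x * complex_of_real (h x)) \<partial>?\<nu>)"
        by (rule integral_Re[OF i, symmetric])
      also have "\<dots> = (\<integral>x. h x - (1 - Re (\<phi> n x)) * h x \<partial>?\<nu>)"
        by (intro Bochner_Integration.integral_cong) (auto simp: algebra_simps)
      also have "\<dots> = (\<integral>x. h x \<partial>?\<nu>) - v n"
        unfolding v_def using hint bound_int[OF _ re1] by (intro Bochner_Integration.integral_diff) auto
      finally show ?thesis .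
    qed
    ultimately have "(\<lambda>n. (\<integral>x. h x \<partial>?\<nu>) - v n) \<longlonglongrightarrow> (\<integral>x. h x \<partial>?\<nu>)" by simp
    from tendsto_diff[OF tendsto_const this, of "\<integral>x. h x \<partial>?\<nu>"] show ?thesis by simp
  qed
  have d2: "AE x in ?\<nu>. \<bar>cmod (F n m x - \<phi> n x)\<bar> \<le> 2" for n m
    using \<phi>1[of n] F1[of n m]
  proof eventually_elim
    case (elim x)
    then show ?case using norm_triangle_ineq4[of "F n m x" "\<phi> n x"] by simp
  qed
  \<comment> \<open>A diagonal choice: the truncation level depends on \<open>n\<close> and makes
    the weighted truncation error smaller than \<open>1 / Suc n\<close>.\<close>
  have "\<exists>m. (\<integral>x. cmod (F n m x - \<phi> n x) * h x \<partial>?\<nu>) < 1 / Suc n" for n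
  proof -
    have "(\<lambda>m. \<integral>x. cmod (F n m x - \<phi> n x) * h x \<partial>?\<nu>) \<longlonglongrightarrow> (\<integral>x. 0 \<partial>?\<nu>)"
    proof (rule integral_dominated_convergence)
      show "integrable ?\<nu> (\<lambda>x. 2 * h x)" using hint by simp
      show "AE x in ?\<nu>. (\<lambda>m. cmod (F n m x - \<phi> n x) * h x) \<longlonglongrightarrow> 0"
        using lim[of n]
      proof eventually_elim
        case (elim x)
        have "(\<lambda>m. cmod (F n m x - \<phi> n x) * h x) \<longlonglongrightarrow> cmod (\<phi> n x - \<phi> n x) * h x"
          using elim by (intro tendsto_intros)
        then show ?case by simp
      qed
      show "AE x in ?\<nu>. norm (cmod (F n m x - \<phi> n x) * h x) \<le> 2 * h x" for m
        using d2[of n m] by eventually_elim (use h_nonneg in \<open>auto simp: abs_mult intro!: mult_right_mono\<close>)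
    qed measurable
    then have "\<forall>\<^sub>F m in sequentially. (\<integral>x. cmod (F n m x - \<phi> n x) * h x \<partial>?\<nu>) < 1 / Suc n"
      by (intro order_tendstoD(2)[where y = 0]) auto
    then show ?thesis by (auto simp: eventually_sequentially)
  qed
  then obtain k where k: "\<And>n. (\<integral>x. cmod (F n (k n) x - \<phi> n x) * h x \<partial>?\<nu>) < 1 / Suc n" by metis
  define u where "u n x = (cmod (F n (k n) x - 1))\<^sup>2 * h x" for n x
  have u_bound: "AE x in ?\<nu>. \<bar>(cmod (F n (k n) x - 1))\<^sup>2\<bar> \<le> 4" for n
    using F1[of n "k n"]
  proof eventually_elim
    case (elim x)
    then have "cmod (F n (k n) x - 1) \<le> 2" using norm_triangle_ineq4[of "F n (k n) x" 1] by simp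
    then have "(cmod (F n (k n) x - 1))\<^sup>2 \<le> 2\<^sup>2" by (intro power_mono) auto
    then show ?case by simp
  qed
  have u_int: "integrable ?\<nu> (u n)" for n
    unfolding u_def using u_bound by (intro bound_int) measurable
  have u_nonneg: "0 \<le> u n x" for n x unfolding u_def using h_nonneg by simp
  have "(\<integral>x. u n x \<partial>?\<nu>) \<le> 4 * (1 / Suc n) + 4 * v n" for n
  proof -
    have i1: "integrable ?\<nu> (\<lambda>x. cmod (F n (k n) x - \<phi> n x) * h x)" using d2 by (intro bound_int) measurable
    have i2: "integrable ?\<nu> (\<lambda>x. (1 - Re (\<phi> n x)) * h x)" using re1 by (intro bound_int) measurable
    have "(\<integral>x. u n x \<partial>?\<nu>) \<le> (\<integral>x. 4 * (cmod (F n (k n) x - \<phi> n x) * h x) + 4 * ((1 - Re (\<phi> n x)) * h x) \<partial>?\<nu>)"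
    proof (rule integral_mono_AE)
      show "AE x in ?\<nu>. u n x \<le> 4 * (cmod (F n (k n) x - \<phi> n x) * h x) + 4 * ((1 - Re (\<phi> n x)) * h x)"
        using F1[of n "k n"] \<phi>1[of n]
      proof eventually_elim
        case (elim x)
        have "u n x \<le> (4 * cmod (F n (k n) x - \<phi> n x) + 4 * (1 - Re (\<phi> n x))) * h x"
          unfolding u_def using cmod_diff_1_square[OF elim] h_nonneg by (intro mult_right_mono)
        then show ?case by (simp add: algebra_simps)
      qed
    qed (use u_int i1 i2 in auto)
    also have "\<dots> = 4 * (\<integral>x. cmod (F n (k n) x - \<phi> n x) * h x \<partial>?\<nu>) + 4 * v n"
      unfolding v_def using i1 i2 by simp
    finally show ?thesis using k[of n] by simp
  qed
  moreover have inv0: "(\<lambda>n. 1 / real (Suc n)) \<longlonglongrightarrow> 0"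
    using LIMSEQ_inverse_real_of_nat by (simp only: inverse_eq_divide)
  moreover have "(\<lambda>n. 4 * (1 / real (Suc n)) + 4 * v n) \<longlonglongrightarrow> 4 * 0 + 4 * 0"
    using tendsto_add[OF tendsto_mult_left[OF inv0, of 4] tendsto_mult_left[OF v, of 4]] .
  ultimately have up: "(\<integral>x. u n x \<partial>?\<nu>) \<le> 4 * (1 / real (Suc n)) + 4 * v n"
    and lim0: "(\<lambda>n. 4 * (1 / real (Suc n)) + 4 * v n) \<longlonglongrightarrow> 0" for n
    by simp_all
  have low: "0 \<le> (\<integral>x. u n x \<partial>?\<nu>)" for n using u_nonneg by (intro Bochner_Integration.integral_nonneg)
  have "(\<lambda>n. \<integral>x. u n x \<partial>?\<nu>) \<longlonglongrightarrow> 0"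
    by (rule real_tendsto_sandwich[OF _ _ tendsto_const lim0]) (use up low in \<open>auto intro: always_eventually\<close>)
  then have "(\<lambda>n. \<integral>x. norm (u n x) \<partial>?\<nu>) \<longlonglongrightarrow> 0" using u_nonneg by simp
  \<comment> \<open>Convergence in the mean gives convergence almost everywhere along a subsequence;
    the other properties hold for each index separately and survive.\<close>
  from tendsto_L1_AE_subseq[OF u_int this]
  obtain r where r: "AE x in ?\<nu>. (\<lambda>n. u (r n) x) \<longlonglongrightarrow> 0" by blast
  define F' where "F' n = F (r n) (k (r n))" for n
  have "AE x in ?\<nu>. (\<lambda>n. F' n x) \<longlonglongrightarrow> 1"
    using r AE_space
  proof eventually_elim
    case (elim x)
    have "(\<lambda>n. u (r n) x / h x) \<longlonglongrightarrow> 0 / h x" using elim hpos[of x] by (intro tendsto_intros) auto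
    then have "(\<lambda>n. (cmod (F' n x - 1))\<^sup>2) \<longlonglongrightarrow> 0" using hpos[of x] elim by (simp add: u_def F'_def)
    then have "(\<lambda>n. sqrt ((cmod (F' n x - 1))\<^sup>2)) \<longlonglongrightarrow> sqrt 0" by (rule tendsto_real_sqrt)
    then have "(\<lambda>n. cmod (F' n x - 1)) \<longlonglongrightarrow> 0" by simp
    then show ?case by (simp add: tendsto_norm_zero_iff LIM_zero_iff)
  qed
  moreover have "positive_definite G \<mu> (F' n)" "has_bounded_support G \<mu> (F' n)" for n
    unfolding F'_def F_def using trunc_coefficient(1,2)[OF \<xi>(1)] by auto
  moreover have "AE x in \<mu>. F' n x = 1" for n
    unfolding F'_def F_def using trunc_coefficient(4)[OF \<xi>(1)] by (intro AE_good) auto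
  ultimately show ?thesis by blast
qed

end

section \<open>Contractions from positive definite kernels\<close>

text \<open>
  With \<open>L = 1 - T / c\<close> and \<open>0 \<le> T \<le> c\<close>, the identity \<open>L - L\<^sup>2 = L (1 - L) L + (1 - L) L (1 - L)\<close>
  gives \<open>L\<^sup>2 \<le> L \<le> 1\<close> without any spectral theory.
\<close>

lemma psd_kernel_contraction:
  fixes K :: "'i \<Rightarrow> 'i \<Rightarrow> complex" and c :: nat
  assumes J: "finite J" and c: "c > 0"
    and psd: "\<And>f. 0 \<le> Re (\<Sum>b\<in>J. \<Sum>a\<in>J. cnj (f b) * K b a * f a)"
    and herm: "\<And>a b. a \<in> J \<Longrightarrow> b \<in> J \<Longrightarrow> K a b = cnj (K b a)"
    and bound: "\<And>a b. a \<in> J \<Longrightarrow> b \<in> J \<Longrightarrow> cmod (K a b) \<le> 1"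
    and row: "\<And>b. b \<in> J \<Longrightarrow> card {a \<in> J. K b a \<noteq> 0} \<le> c"
  shows "(\<Sum>b\<in>J. (cmod (f b - (\<Sum>a\<in>J. K b a * f a) / of_nat c))\<^sup>2) \<le> (\<Sum>b\<in>J. (cmod (f b))\<^sup>2)"
proof -
  define ip where "ip f g = (\<Sum>a\<in>J. cnj (f a) * g a)" for f g :: "'i \<Rightarrow> complex"
  define T where "T f b = (\<Sum>a\<in>J. K b a * f a) / of_nat c" for f b
  define nsq where "nsq f = (\<Sum>b\<in>J. (cmod (f b))\<^sup>2)" for f :: "'i \<Rightarrow> complex"
  have ip_diff_right: "ip f (\<lambda>a. g a - h a) = ip f g - ip f h" for f g h
    by (simp add: ip_def algebra_simps sum_subtractf)
  have ip_diff_left: "ip (\<lambda>a. f a - g a) h = ip f h - ip g h" for f g h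
    by (simp add: ip_def algebra_simps sum_subtractf)
  have ip_swap: "Re (ip f g) = Re (ip g f)" for f g
    by (simp add: ip_def algebra_simps)
  have ip_self: "Re (ip f f) = nsq f" for f
    by (simp add: ip_def nsq_def cmod_power2) (simp add: power2_eq_square)
  have T_diff: "T (\<lambda>a. f a - g a) b = T f b - T g b" for f g b
    by (simp add: T_def algebra_simps sum_subtractf diff_divide_distrib)
  have ipT: "ip f (T g) = (\<Sum>b\<in>J. \<Sum>a\<in>J. cnj (f b) * K b a * g a) / of_nat c" for f g
    by (simp add: ip_def T_def sum_divide_distrib sum_distrib_left mult_ac)
  have adj: "ip (T f) g = ip f (T g)" for f g
  proof -
    have "ip (T f) g = (\<Sum>b\<in>J. \<Sum>a\<in>J. cnj (K b a) * cnj (f a) * g b) / of_nat c"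
      by (simp add: ip_def T_def sum_divide_distrib sum_distrib_left sum_distrib_right mult_ac)
    also have "(\<Sum>b\<in>J. \<Sum>a\<in>J. cnj (K b a) * cnj (f a) * g b) = (\<Sum>a\<in>J. \<Sum>b\<in>J. cnj (K b a) * cnj (f a) * g b)"
      by (rule sum.swap)
    also have "\<dots> = (\<Sum>b\<in>J. \<Sum>a\<in>J. cnj (f b) * K b a * g a)"
      by (intro sum.cong refl) (metis herm mult.commute mult.assoc)
    finally show ?thesis unfolding ipT .
  qed
  have T_nonneg: "0 \<le> Re (ip f (T f))" for f
    unfolding ipT using psd[of f] by (simp add: Re_divide_of_nat)
  \<comment> \<open>A Schur test: \<open>S\<close> is the 0-1 pattern of the kernel, symmetric since
    the kernel is Hermitian, with row sums at most \<open>c\<close>. Entries are at most 1 in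
    modulus, so each of the two halves of the arithmetic mean contributes at most half of
    \<open>c\<close> times \<open>nsq f\<close>.\<close>
  have T_le: "Re (ip f (T f)) \<le> nsq f" for f
  proof -
    define S where "S b a = (if K b a = 0 then 0 else 1 :: real)" for b a
    have row': "(\<Sum>a\<in>J. S b a) \<le> c" if "b \<in> J" for b
    proof -
      have "(\<Sum>a\<in>J. S b a) = (\<Sum>a\<in>{a \<in> J. K b a \<noteq> 0}. 1)"
        using J by (intro sum.mono_neutral_cong_right) (auto simp: S_def)
      then show ?thesis using row[OF that] by simp
    qed
    have sym: "S b a = S a b" if "a \<in> J" "b \<in> J" for a b using herm[OF that] by (simp add: S_def)
    have "Re (\<Sum>b\<in>J. \<Sum>a\<in>J. cnj (f b) * K b a * f a) \<le> (\<Sum>b\<in>J. \<Sum>a\<in>J. S b a * (((cmod (f b))\<^sup>2 + (cmod (f a))\<^sup>2) / 2))"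
      unfolding Re_sum
    proof (intro sum_mono)
      fix b a assume ab: "b \<in> J" "a \<in> J"
      have "Re (cnj (f b) * K b a * f a) \<le> cmod (cnj (f b) * K b a * f a)" by (rule complex_Re_le_cmod)
      also have "\<dots> = cmod (K b a) * (cmod (f b) * cmod (f a))" by (simp add: norm_mult)
      also have "\<dots> \<le> S b a * (cmod (f b) * cmod (f a))" using bound[OF ab] by (intro mult_right_mono) (auto simp: S_def)
      also have "cmod (f b) * cmod (f a) \<le> ((cmod (f b))\<^sup>2 + (cmod (f a))\<^sup>2) / 2"
        using sum_squares_bound[of "cmod (f b)" "cmod (f a)"] by simp
      finally show "Re (cnj (f b) * K b a * f a) \<le> S b a * (((cmod (f b))\<^sup>2 + (cmod (f a))\<^sup>2) / 2)"
        by (simp add: mult_left_mono S_def)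
    qed
    also have "\<dots> = (\<Sum>b\<in>J. \<Sum>a\<in>J. S b a * (cmod (f b))\<^sup>2 / 2) + (\<Sum>b\<in>J. \<Sum>a\<in>J. S b a * (cmod (f a))\<^sup>2 / 2)"
      by (simp only: sum.distrib[symmetric] distrib_left add_divide_distrib times_divide_eq_right)
    also have "(\<Sum>b\<in>J. \<Sum>a\<in>J. S b a * (cmod (f a))\<^sup>2 / 2) = (\<Sum>a\<in>J. \<Sum>b\<in>J. S b a * (cmod (f a))\<^sup>2 / 2)"
      by (rule sum.swap)
    also have "\<dots> = (\<Sum>b\<in>J. \<Sum>a\<in>J. S b a * (cmod (f b))\<^sup>2 / 2)"
      by (intro sum.cong refl) (simp only: sym)
    also have "(\<Sum>b\<in>J. \<Sum>a\<in>J. S b a * (cmod (f b))\<^sup>2 / 2) = (\<Sum>b\<in>J. (\<Sum>a\<in>J. S b a) * ((cmod (f b))\<^sup>2 / 2))"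
      by (simp only: sum_distrib_right times_divide_eq_right sum_divide_distrib)
    also have "\<dots> + \<dots> = (\<Sum>b\<in>J. (\<Sum>a\<in>J. S b a) * (cmod (f b))\<^sup>2)"
      by (simp only: sum.distrib[symmetric] distrib_left[symmetric] field_sum_of_halves)
    also have "\<dots> \<le> (\<Sum>b\<in>J. real c * (cmod (f b))\<^sup>2)"
      using row' by (intro sum_mono mult_right_mono) auto
    also have "\<dots> = real c * nsq f" by (simp add: nsq_def sum_distrib_left)
    finally show ?thesis unfolding ipT using c by (simp add: Re_divide_of_nat field_simps)
  qed
  \<comment> \<open>With \<open>L = 1 - T\<close>, where \<open>T\<close> is already divided by
    \<open>c\<close>, \<open>g\<close> is \<open>L f\<close> and \<open>k\<close> is
    \<open>(1 - L) f\<close>. So \<open>ip g k\<close> is the quadratic form of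
    \<open>L - L^2\<close>, and \<open>id\<close> below is the operator identity evaluated at
    \<open>f\<close>.\<close>
  define k where "k = T f"
  define g where "g = (\<lambda>a. f a - k a)"
  have Tg: "T g = (\<lambda>b. k b - T k b)" unfolding g_def by (auto simp: T_diff k_def)
  have "ip g (T g) + (ip k k - ip k (T k)) = ip f (T g)"
    unfolding Tg by (simp add: ip_diff_right g_def ip_diff_left algebra_simps)
  also have "\<dots> = ip f k - ip k k"
    unfolding Tg ip_diff_right using adj[of f k] by (simp add: k_def)
  also have "\<dots> = ip g k" by (simp add: g_def ip_diff_left)
  finally have id: "ip g (T g) + (ip k k - ip k (T k)) = ip g k" .
  have "0 \<le> Re (ip g (T g))" by (rule T_nonneg)
  moreover have "0 \<le> Re (ip k k - ip k (T k))" using T_le[of k] ip_self[of k] by simp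
  ultimately have "0 \<le> Re (ip g k)" using arg_cong[OF id, of Re] by simp
  then have "0 \<le> Re (ip k g)" by (simp only: ip_swap[of k g])
  moreover have "ip k g = ip f g - ip g g" by (simp add: g_def ip_diff_left ip_diff_right)
  moreover have "Re (ip f g) = nsq f - Re (ip f (T f))" by (simp add: g_def ip_diff_right ip_self k_def)
  ultimately have "nsq g \<le> nsq f" using T_nonneg[of f] ip_self[of g] by simp
  then show ?thesis by (simp add: nsq_def g_def k_def T_def)
qed

text \<open>The test vectors \<open>(1, 1)\<close> and \<open>(1, \<i>)\<close> give Hermitian
  symmetry. For the bound, \<open>v\<close> is the phase that turns the off-diagonal entry
  \<open>z\<close> into \<open>- cmod z\<close>, so the quadratic form at \<open>(1, v)\<close>
  equals \<open>2 - 2 * cmod z\<close>.\<close>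

lemma psd_matrix_two:
  assumes "psd_matrix 2 A" "A 0 0 = 1" "A 1 1 = 1"
  shows "A 1 0 = cnj (A 0 1)" "cmod (A 0 1) \<le> 1"
proof -
  have q: "cnj u * u + cnj u * A 0 1 * v + (cnj v * A 1 0 * u + cnj v * v) \<in> \<real> \<and>
      0 \<le> Re (cnj u * u + cnj u * A 0 1 * v + (cnj v * A 1 0 * u + cnj v * v))" for u v
    using assms(1)[unfolded psd_matrix_def, rule_format, of "\<lambda>i. if i = 0 then u else v"] assms(2,3)
    by (simp add: numeral_2_eq_2)
  have "Im (A 0 1) + Im (A 1 0) = 0" using q[of 1 1] by (simp add: complex_is_Real_iff)
  moreover have "Re (A 0 1) - Re (A 1 0) = 0" using q[of 1 \<i>] by (simp add: complex_is_Real_iff)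
  ultimately show h: "A 1 0 = cnj (A 0 1)" by (simp add: complex_eq_iff)
  show "cmod (A 0 1) \<le> 1"
  proof (cases "A 0 1 = 0")
    case False
    define z where "z = A 0 1"
    define v where "v = - cnj z / of_real (cmod z)"
    have z: "cmod z \<noteq> 0" using False by (simp add: z_def)
    have "z * cnj z = of_real ((cmod z)\<^sup>2)" by (simp only: complex_norm_square)
    then have zv: "z * v = - of_real (cmod z)"
      using z by (simp add: v_def field_simps power2_eq_square)
    have "cnj (z * v) = - of_real (cmod z)" unfolding zv by simp
    then have vz: "cnj v * cnj z = - of_real (cmod z)" by (simp add: mult.commute)
    have "cnj v * v = of_real ((cmod v)\<^sup>2)" by (simp only: complex_norm_square mult.commute)
    moreover have "cmod v = 1" using z by (simp add: v_def norm_divide)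
    ultimately have "cnj v * v = 1" by simp
    then have "0 \<le> Re (1 + z * v + (cnj v * cnj z + 1))"
      using q[of 1 v] h by (simp add: z_def)
    then show ?thesis unfolding zv vz by (simp add: z_def)
  qed simp
qed

section \<open>Polynomials approximating the square root\<close>

definition nonneg_coeffs :: "real poly \<Rightarrow> bool" where
  "nonneg_coeffs p \<longleftrightarrow> (\<forall>i. 0 \<le> coeff p i)"

lemma nonneg_coeffs_add: "nonneg_coeffs p \<Longrightarrow> nonneg_coeffs q \<Longrightarrow> nonneg_coeffs (p + q)"
  and nonneg_coeffs_mult: "nonneg_coeffs p \<Longrightarrow> nonneg_coeffs q \<Longrightarrow> nonneg_coeffs (p * q)"
  and nonneg_coeffs_smult: "0 \<le> a \<Longrightarrow> nonneg_coeffs p \<Longrightarrow> nonneg_coeffs (smult a p)"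
  by (auto simp: nonneg_coeffs_def coeff_mult intro!: sum_nonneg)

text \<open>
  The iterates increase coefficientwise to the power series of \<open>1 - sqrt (1 - X)\<close>.
\<close>

fun sqrt_iter :: "nat \<Rightarrow> real poly" where
  "sqrt_iter 0 = 0"
| "sqrt_iter (Suc k) = smult (1/2) ([:0, 1:] + sqrt_iter k * sqrt_iter k)"

text \<open>A rearrangement of the recursion: the error of \<open>1 - sqrt_iter k\<close> as a
  square root of \<open>1 - X\<close> is exactly twice the next increment.\<close>

lemma sqrt_iter_square:
  "(1 - sqrt_iter k) * (1 - sqrt_iter k) = (1 - [:0, 1:]) + smult 2 (sqrt_iter (Suc k) - sqrt_iter k)"
proof -
  have "smult 2 (sqrt_iter (Suc k)) = [:0, 1:] + sqrt_iter k * sqrt_iter k" by simp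
  moreover have "smult 2 (sqrt_iter k) = sqrt_iter k + sqrt_iter k"
    by (metis one_add_one smult_1_left smult_add_left)
  ultimately show ?thesis
    unfolding smult_diff_right by (simp add: algebra_simps del: sqrt_iter.simps)
qed

lemma nonneg_sqrt_iter: "nonneg_coeffs (sqrt_iter k)"
proof (induction k)
  case (Suc k)
  have "nonneg_coeffs [:0, 1:]" by (auto simp: nonneg_coeffs_def coeff_pCons split: nat.splits)
  then show ?case using Suc by (auto intro!: nonneg_coeffs_smult nonneg_coeffs_add nonneg_coeffs_mult simp del: smult_add_right)
qed (simp add: nonneg_coeffs_def)

text \<open>The difference of two squares factors, so each increment is half the previous increment
  times a sum of iterates. This positivity is what allows the error to be estimated by its value at
  1.\<close>

lemma nonneg_sqrt_iter_diff: "nonneg_coeffs (sqrt_iter (Suc k) - sqrt_iter k)"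
proof (induction k)
  case 0
  show ?case by (auto simp: nonneg_coeffs_def coeff_pCons split: nat.splits)
next
  case (Suc k)
  define p where "p = sqrt_iter k"
  define q where "q = sqrt_iter (Suc k)"
  have q: "q = smult (1/2) ([:0, 1:] + p * p)" unfolding q_def p_def by (rule sqrt_iter.simps(2))
  have q': "sqrt_iter (Suc (Suc k)) = smult (1/2) ([:0, 1:] + q * q)"
    unfolding q_def by (rule sqrt_iter.simps(2))
  have "smult (1/2) ([:0, 1:] + q * q) - q = smult (1/2) ([:0, 1:] + q * q) - smult (1/2) ([:0, 1:] + p * p)"
    by (rule arg_cong[OF q])
  also have "\<dots> = smult (1/2) (([:0, 1:] + q * q) - ([:0, 1:] + p * p))" by (simp only: smult_diff_right)
  also have "([:0, 1:] + q * q) - ([:0, 1:] + p * p) = (q - p) * (q + p)" by (simp add: algebra_simps)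
  finally have "sqrt_iter (Suc (Suc k)) - sqrt_iter (Suc k) =
      smult (1/2) ((sqrt_iter (Suc k) - sqrt_iter k) * (sqrt_iter (Suc k) + sqrt_iter k))"
    unfolding q' q_def p_def .
  then show ?case
    using Suc nonneg_sqrt_iter
    by (simp add: nonneg_coeffs_smult nonneg_coeffs_mult nonneg_coeffs_add del: sqrt_iter.simps)
qed

text \<open>The values at 1 increase and stay below 1; convergence alone makes the increments
  vanish.\<close>

lemma sqrt_iter_at_1: "(\<lambda>k. poly (sqrt_iter (Suc k) - sqrt_iter k) 1) \<longlonglongrightarrow> 0"
proof -
  define y where "y k = poly (sqrt_iter k) 1" for k
  have y: "y (Suc k) = (1 + y k * y k) / 2" for k by (simp add: y_def)
  have b: "0 \<le> y k \<and> y k \<le> 1" for k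
  proof (induction k)
    case (Suc k)
    then have "y k * y k \<le> 1" by (simp add: mult_le_one)
    then show ?case using Suc by (simp add: y)
  qed (simp add: y_def)
  have "y k \<le> y (Suc k)" for k
    using zero_le_square[of "1 - y k"] by (simp add: y algebra_simps)
  then have "incseq y" by (rule incseq_SucI)
  then obtain l where l: "y \<longlonglongrightarrow> l" using incseq_convergent[of y 1] b by blast
  have "(\<lambda>k. y (Suc k) - y k) \<longlonglongrightarrow> l - l" using LIMSEQ_Suc[OF l] l by (rule tendsto_diff)
  then show ?thesis by (simp add: y_def del: sqrt_iter.simps)
qed

section \<open>Square roots of positive definite functions\<close>

locale bounded_positive_definite = reduced_groupoid G \<mu> E N0 N
  for G :: "'g groupoid_data" and \<mu> :: "'g measure" and E :: "nat \<Rightarrow> 'g set" and N0 N :: "'g set" +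
  fixes F :: "'g \<Rightarrow> complex" and c :: nat
  assumes F_borel: "F \<in> borel_measurable (arrows G)"
    and F_psd: "x \<in> units G \<Longrightarrow> x \<notin> N \<Longrightarrow> \<forall>i<k. \<gamma> i \<in> range_fiber G x \<Longrightarrow>
      psd_matrix k (\<lambda>i j. F (mult G (ginv G (\<gamma> i)) (\<gamma> j)))"
    and F_unit: "x \<in> units G \<Longrightarrow> x \<notin> N \<Longrightarrow> F x = 1"
    and F_support: "x \<in> units G \<Longrightarrow> x \<notin> N \<Longrightarrow>
      finite {\<gamma> \<in> range_fiber G x. F \<gamma> \<noteq> 0} \<and> card {\<gamma> \<in> range_fiber G x. F \<gamma> \<noteq> 0} \<le> c"
    and c_pos: "c > 0"
begin

definition K :: "'g \<Rightarrow> 'g \<Rightarrow> complex" where "K b a = F (mult G (ginv G b) a)"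

lemma
  assumes x: "x \<in> units G" "x \<notin> N" and ab: "a \<in> range_fiber G x" "b \<in> range_fiber G x"
  shows K_herm: "K a b = cnj (K b a)" and K_le_1: "cmod (K a b) \<le> 1"
proof -
  have self: "K d d = 1" if d: "d \<in> range_fiber G x" for d
  proof -
    have d': "d \<in> space (arrows G)" "rng G d = x" using d by (auto simp: range_fiber_def)
    then have "src G d \<in> units G" "src G d \<notin> N" using src_units N_invariant x by auto
    then show ?thesis using F_unit ginv_left[OF d'(1)] by (simp add: K_def)
  qed
  have "psd_matrix 2 (\<lambda>i j. F (mult G (ginv G (if i = 0 then a else b)) (if j = 0 then a else b)))"
    using F_psd[OF x, of 2 "\<lambda>i. if i = 0 then a else b"] ab by simp
  note two = psd_matrix_two[OF this]
  show "K a b = cnj (K b a)" "cmod (K a b) \<le> 1"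
    using two self[OF ab(1)] self[OF ab(2)] by (simp_all add: K_def)
qed

text \<open>Translation by \<open>b\<close> carries the row at \<open>b\<close> to the support of
  \<open>F\<close> over the source of \<open>b\<close>, a unit that is good because \<open>N\<close>
  is invariant.\<close>

lemma K_row:
  assumes x: "x \<in> units G" "x \<notin> N" and b: "b \<in> range_fiber G x"
  shows "finite {a \<in> range_fiber G x. K b a \<noteq> 0}" "card {a \<in> range_fiber G x. K b a \<noteq> 0} \<le> c"
proof -
  have b': "b \<in> space (arrows G)" "rng G b = x" using b by (auto simp: range_fiber_def)
  then have y: "src G b \<in> units G" "src G b \<notin> N" using src_units N_invariant x by auto
  have bij: "bij_betw (\<lambda>\<zeta>. mult G (ginv G b) \<zeta>) (range_fiber G x) (range_fiber G (src G b))"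
    using bij_translate[OF b'(1)] b'(2) by simp
  have inj: "inj_on (\<lambda>\<zeta>. mult G (ginv G b) \<zeta>) {a \<in> range_fiber G x. K b a \<noteq> 0}"
    using bij_betw_imp_inj_on[OF bij] by (rule inj_on_subset) auto
  have sub: "(\<lambda>\<zeta>. mult G (ginv G b) \<zeta>) ` {a \<in> range_fiber G x. K b a \<noteq> 0} \<subseteq> {\<gamma> \<in> range_fiber G (src G b). F \<gamma> \<noteq> 0}"
    using bij by (auto simp: bij_betw_def K_def)
  show "finite {a \<in> range_fiber G x. K b a \<noteq> 0}"
    using F_support[OF y] sub inj finite_imageD finite_subset by blast
  show "card {a \<in> range_fiber G x. K b a \<noteq> 0} \<le> c"
    using card_inj_on_le[OF inj sub] F_support[OF y] by simp
qed

section \<open>Finitely supported vectors and convolution operators on the fibres\<close>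

text \<open>One function stands for a family of finitely supported vectors, one on each fibre.
  Requiring zero over \<open>N\<close> lets the lemmas on \<open>T\<close> and \<open>L\<close> be
  stated without distinguishing good from bad units.\<close>

definition fsupp :: "('g \<Rightarrow> complex) \<Rightarrow> bool" where
  "fsupp f \<longleftrightarrow> (\<forall>x. finite {\<gamma> \<in> range_fiber G x. f \<gamma> \<noteq> 0}) \<and> (\<forall>\<gamma>. rng G \<gamma> \<in> N \<longrightarrow> f \<gamma> = 0)"

text \<open>The order of the factors is that of \<open>fiber_sum_measurable\<close>; on the fibre
  over \<open>x\<close> this is the operator with matrix \<open>K\<close>.\<close>

definition T :: "('g \<Rightarrow> complex) \<Rightarrow> 'g \<Rightarrow> complex" where
  "T f \<gamma> = (\<Sum>\<^sub>\<infinity>\<zeta>\<in>range_fiber G (rng G \<gamma>). f \<zeta> * F (mult G (ginv G \<gamma>) \<zeta>))"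

definition L :: "('g \<Rightarrow> complex) \<Rightarrow> 'g \<Rightarrow> complex" where
  "L f \<gamma> = f \<gamma> - T f \<gamma> / of_nat c"

definition nsq :: "'g \<Rightarrow> ('g \<Rightarrow> complex) \<Rightarrow> real" where
  "nsq x f = (\<Sum>\<^sub>\<infinity>\<gamma>\<in>range_fiber G x. (cmod (f \<gamma>))\<^sup>2)"

definition ip :: "'g \<Rightarrow> ('g \<Rightarrow> complex) \<Rightarrow> ('g \<Rightarrow> complex) \<Rightarrow> complex" where
  "ip x f g = (\<Sum>\<^sub>\<infinity>\<gamma>\<in>range_fiber G x. cnj (f \<gamma>) * g \<gamma>)"

lemma T_sum:
  assumes "finite S" "S \<subseteq> range_fiber G (rng G \<gamma>)" "\<And>\<zeta>. \<zeta> \<in> range_fiber G (rng G \<gamma>) - S \<Longrightarrow> f \<zeta> = 0"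
  shows "T f \<gamma> = (\<Sum>\<zeta>\<in>S. f \<zeta> * K \<gamma> \<zeta>)"
proof -
  have "T f \<gamma> = (\<Sum>\<^sub>\<infinity>\<zeta>\<in>S. f \<zeta> * K \<gamma> \<zeta>)"
    unfolding T_def K_def using assms(2,3) by (intro infsum_cong_neutral) auto
  then show ?thesis using assms(1) by simp
qed

lemma nsq_sum:
  assumes "finite S" "S \<subseteq> range_fiber G x" "\<And>\<zeta>. \<zeta> \<in> range_fiber G x - S \<Longrightarrow> f \<zeta> = 0"
  shows "nsq x f = (\<Sum>\<zeta>\<in>S. (cmod (f \<zeta>))\<^sup>2)"
proof -
  have "nsq x f = (\<Sum>\<^sub>\<infinity>\<zeta>\<in>S. (cmod (f \<zeta>))\<^sup>2)"
    unfolding nsq_def using assms(2,3) by (intro infsum_cong_neutral) auto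
  then show ?thesis using assms(1) by simp
qed

lemma ip_sum:
  assumes "finite S" "S \<subseteq> range_fiber G x" "\<And>\<zeta>. \<zeta> \<in> range_fiber G x - S \<Longrightarrow> f \<zeta> = 0 \<or> g \<zeta> = 0"
  shows "ip x f g = (\<Sum>\<zeta>\<in>S. cnj (f \<zeta>) * g \<zeta>)"
proof -
  have "ip x f g = (\<Sum>\<^sub>\<infinity>\<zeta>\<in>S. cnj (f \<zeta>) * g \<zeta>)"
    unfolding ip_def using assms(2,3) by (intro infsum_cong_neutral) auto
  then show ?thesis using assms(1) by simp
qed

lemma fsupp_finite: "fsupp f \<Longrightarrow> finite {\<gamma> \<in> range_fiber G x. f \<gamma> \<noteq> 0}"
  by (simp add: fsupp_def)

lemma fsupp_zero [simp]: "fsupp (\<lambda>_. 0)"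
  by (simp add: fsupp_def)

lemma fsupp_add: "fsupp f \<Longrightarrow> fsupp g \<Longrightarrow> fsupp (\<lambda>\<gamma>. f \<gamma> + g \<gamma>)"
  unfolding fsupp_def
proof (intro conjI allI impI)
  fix x assume *: "(\<forall>x. finite {\<gamma> \<in> range_fiber G x. f \<gamma> \<noteq> 0}) \<and> (\<forall>\<gamma>. rng G \<gamma> \<in> N \<longrightarrow> f \<gamma> = 0)"
    "(\<forall>x. finite {\<gamma> \<in> range_fiber G x. g \<gamma> \<noteq> 0}) \<and> (\<forall>\<gamma>. rng G \<gamma> \<in> N \<longrightarrow> g \<gamma> = 0)"
  show "finite {\<gamma> \<in> range_fiber G x. f \<gamma> + g \<gamma> \<noteq> 0}"
    by (rule finite_subset[of _ "{\<gamma> \<in> range_fiber G x. f \<gamma> \<noteq> 0} \<union> {\<gamma> \<in> range_fiber G x. g \<gamma> \<noteq> 0}"])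
      (use * in auto)
qed auto

lemma fsupp_scale: "fsupp f \<Longrightarrow> fsupp (\<lambda>\<gamma>. a * f \<gamma>)"
  unfolding fsupp_def
proof (intro conjI allI impI)
  fix x assume *: "(\<forall>x. finite {\<gamma> \<in> range_fiber G x. f \<gamma> \<noteq> 0}) \<and> (\<forall>\<gamma>. rng G \<gamma> \<in> N \<longrightarrow> f \<gamma> = 0)"
  show "finite {\<gamma> \<in> range_fiber G x. a * f \<gamma> \<noteq> 0}"
    by (rule finite_subset[of _ "{\<gamma> \<in> range_fiber G x. f \<gamma> \<noteq> 0}"]) (use * in auto)
qed auto

lemma fiber_cases:
  assumes "fsupp f"
  obtains "x \<in> units G" "x \<notin> N" | "\<And>\<gamma>. \<gamma> \<in> range_fiber G x \<Longrightarrow> f \<gamma> = 0"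
proof (cases "x \<in> units G \<and> x \<notin> N")
  case False
  have "f \<gamma> = 0" if "\<gamma> \<in> range_fiber G x" for \<gamma>
    using that assms rng_units False by (auto simp: fsupp_def range_fiber_def)
  then show ?thesis using that(2) by blast
qed (use that in blast)

lemma T_zero:
  assumes "\<And>\<zeta>. \<zeta> \<in> range_fiber G (rng G \<gamma>) \<Longrightarrow> f \<zeta> = 0"
  shows "T f \<gamma> = 0"
  using T_sum[of "{}" \<gamma> f] assms by simp

text \<open>A value of \<open>T f\<close> can be nonzero only at points where a column of
  \<open>K\<close> indexed by the support of \<open>f\<close> is nonzero. Hermitian symmetry turns
  columns into rows, which are finite.\<close>

lemma fsupp_T:
  assumes f: "fsupp f"
  shows "fsupp (T f)"
  unfolding fsupp_def
proof (intro conjI allI impI)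
  show "T f \<gamma> = 0" if "rng G \<gamma> \<in> N" for \<gamma>
    using f that by (intro T_zero) (auto simp: fsupp_def range_fiber_def)
  fix x
  show "finite {\<gamma> \<in> range_fiber G x. T f \<gamma> \<noteq> 0}"
  proof (cases rule: fiber_cases[OF f, of x, case_names good zero])
    case good
    let ?S = "{\<gamma> \<in> range_fiber G x. f \<gamma> \<noteq> 0}"
    have "{\<gamma> \<in> range_fiber G x. T f \<gamma> \<noteq> 0} \<subseteq> (\<Union>\<zeta>\<in>?S. {\<gamma> \<in> range_fiber G x. K \<zeta> \<gamma> \<noteq> 0})"
    proof
      fix \<gamma> assume \<gamma>: "\<gamma> \<in> {\<gamma> \<in> range_fiber G x. T f \<gamma> \<noteq> 0}"
      have "T f \<gamma> = (\<Sum>\<zeta>\<in>?S. f \<zeta> * K \<gamma> \<zeta>)"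
        using \<gamma> fsupp_finite[OF f, of x] by (intro T_sum) (auto simp: range_fiber_def)
      then obtain \<zeta> where "\<zeta> \<in> ?S" "K \<gamma> \<zeta> \<noteq> 0"
        using \<gamma> sum.neutral[of ?S "\<lambda>\<zeta>. f \<zeta> * K \<gamma> \<zeta>"] by fastforce
      moreover from this have "K \<zeta> \<gamma> \<noteq> 0" using K_herm[OF good, of \<zeta> \<gamma>] \<gamma> by auto
      ultimately show "\<gamma> \<in> (\<Union>\<zeta>\<in>?S. {\<gamma> \<in> range_fiber G x. K \<zeta> \<gamma> \<noteq> 0})" using \<gamma> by blast
    qed
    moreover have "finite (\<Union>\<zeta>\<in>?S. {\<gamma> \<in> range_fiber G x. K \<zeta> \<gamma> \<noteq> 0})"
      using fsupp_finite[OF f, of x] K_row(1)[OF good] by (intro finite_UN_I) auto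
    ultimately show ?thesis by (rule finite_subset)
  next
    case zero
    have "T f \<gamma> = 0" if "\<gamma> \<in> range_fiber G x" for \<gamma>
      using that zero by (intro T_zero) (auto simp: range_fiber_def)
    then have e: "{\<gamma> \<in> range_fiber G x. T f \<gamma> \<noteq> 0} = {}" by auto
    show ?thesis unfolding e by simp
  qed
qed

lemma fsupp_L: "fsupp f \<Longrightarrow> fsupp (L f)"
  using fsupp_add[OF _ fsupp_scale[OF fsupp_T], of f f "- 1 / of_nat c"]
  by (simp add: L_def[abs_def] divide_inverse mult.commute)

lemma T_add:
  assumes f: "fsupp f" and g: "fsupp g"
  shows "T (\<lambda>\<gamma>. f \<gamma> + g \<gamma>) \<gamma> = T f \<gamma> + T g \<gamma>"
proof -
  let ?S = "{\<zeta> \<in> range_fiber G (rng G \<gamma>). f \<zeta> \<noteq> 0} \<union> {\<zeta> \<in> range_fiber G (rng G \<gamma>). g \<zeta> \<noteq> 0}"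
  have fin: "finite ?S" using fsupp_finite[OF f] fsupp_finite[OF g] by simp
  have "T (\<lambda>\<gamma>. f \<gamma> + g \<gamma>) \<gamma> = (\<Sum>\<zeta>\<in>?S. (f \<zeta> + g \<zeta>) * K \<gamma> \<zeta>)" by (rule T_sum) (use fin in auto)
  also have "\<dots> = (\<Sum>\<zeta>\<in>?S. f \<zeta> * K \<gamma> \<zeta>) + (\<Sum>\<zeta>\<in>?S. g \<zeta> * K \<gamma> \<zeta>)" by (simp only: distrib_right sum.distrib)
  also have "(\<Sum>\<zeta>\<in>?S. f \<zeta> * K \<gamma> \<zeta>) = T f \<gamma>" by (rule T_sum[symmetric]) (use fin in auto)
  also have "(\<Sum>\<zeta>\<in>?S. g \<zeta> * K \<gamma> \<zeta>) = T g \<gamma>" by (rule T_sum[symmetric]) (use fin in auto)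
  finally show ?thesis .
qed

lemma T_scale: "T (\<lambda>\<gamma>. a * f \<gamma>) \<gamma> = a * T f \<gamma>"
  unfolding T_def by (simp add: mult.assoc infsum_cmult_right')

lemma L_add: "fsupp f \<Longrightarrow> fsupp g \<Longrightarrow> L (\<lambda>\<gamma>. f \<gamma> + g \<gamma>) = (\<lambda>\<gamma>. L f \<gamma> + L g \<gamma>)"
  by (auto simp: L_def T_add add_divide_distrib)

lemma L_scale: "L (\<lambda>\<gamma>. a * f \<gamma>) = (\<lambda>\<gamma>. a * L f \<gamma>)"
  by (auto simp: L_def T_scale algebra_simps)

lemma L_zero [simp]: "L (\<lambda>_. 0) = (\<lambda>_. 0)"
  using L_scale[of 0 "\<lambda>_. 0"] by simp

lemma nsq_L:
  assumes f: "fsupp f"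
  shows "nsq x (L f) \<le> nsq x f"
proof (cases rule: fiber_cases[OF f, of x, case_names good zero])
  case good
  \<comment> \<open>Including the support of \<open>L f\<close> makes the finite matrix over
    \<open>J\<close> compute the full norms of both \<open>f\<close> and \<open>L f\<close>, so
    compressing to \<open>J\<close> loses nothing.\<close>
  define J where "J = {\<gamma> \<in> range_fiber G x. f \<gamma> \<noteq> 0} \<union> {\<gamma> \<in> range_fiber G x. L f \<gamma> \<noteq> 0}"
  have J: "finite J" "J \<subseteq> range_fiber G x"
    unfolding J_def using fsupp_finite[OF f] fsupp_finite[OF fsupp_L[OF f]] by auto
  have "(\<Sum>b\<in>J. (cmod (f b - (\<Sum>a\<in>J. K b a * f a) / of_nat c))\<^sup>2) \<le> (\<Sum>b\<in>J. (cmod (f b))\<^sup>2)"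
  proof (rule psd_kernel_contraction[OF J(1) c_pos])
    fix h
    obtain e where e: "bij_betw e {..<card J} J" using ex_bij_betw_nat_finite[OF J(1)] by (auto simp: atLeast0LessThan)
    have "\<forall>i<card J. e i \<in> range_fiber G x" using e J(2) by (auto simp: bij_betw_def)
    from F_psd[OF good this, unfolded psd_matrix_def, THEN spec, of "\<lambda>i. h (e i)"]
    have "0 \<le> Re (\<Sum>i<card J. \<Sum>j<card J. cnj (h (e i)) * K (e i) (e j) * h (e j))"
      unfolding K_def by simp
    also have "(\<Sum>i<card J. \<Sum>j<card J. cnj (h (e i)) * K (e i) (e j) * h (e j)) =
        (\<Sum>i<card J. \<Sum>a\<in>J. cnj (h (e i)) * K (e i) a * h a)"
      by (intro sum.cong refl) (rule sum.reindex_bij_betw[OF e])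
    also have "\<dots> = (\<Sum>b\<in>J. \<Sum>a\<in>J. cnj (h b) * K b a * h a)"
      by (rule sum.reindex_bij_betw[OF e, of "\<lambda>b. \<Sum>a\<in>J. cnj (h b) * K b a * h a"])
    finally show "0 \<le> Re (\<Sum>b\<in>J. \<Sum>a\<in>J. cnj (h b) * K b a * h a)" .
  next
    fix a b assume "a \<in> J" "b \<in> J"
    then have "a \<in> range_fiber G x" "b \<in> range_fiber G x" using J(2) by auto
    then show "K a b = cnj (K b a)" "cmod (K a b) \<le> 1" using K_herm[OF good] K_le_1[OF good] by blast+
  next
    fix b assume "b \<in> J"
    then have b: "b \<in> range_fiber G x" using J(2) by auto
    have "card {a \<in> J. K b a \<noteq> 0} \<le> card {a \<in> range_fiber G x. K b a \<noteq> 0}"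
      using J(2) K_row(1)[OF good b] by (intro card_mono) auto
    then show "card {a \<in> J. K b a \<noteq> 0} \<le> c" using K_row(2)[OF good b] by simp
  qed
  also have "(\<Sum>b\<in>J. (cmod (f b))\<^sup>2) = nsq x f" by (rule nsq_sum[symmetric]) (use J in \<open>auto simp: J_def\<close>)
  also have "(\<Sum>b\<in>J. (cmod (f b - (\<Sum>a\<in>J. K b a * f a) / of_nat c))\<^sup>2) = (\<Sum>b\<in>J. (cmod (L f b))\<^sup>2)"
  proof (intro sum.cong refl)
    fix b assume "b \<in> J"
    then have "rng G b = x" using J(2) by (auto simp: range_fiber_def)
    then have "T f b = (\<Sum>a\<in>J. f a * K b a)" using J by (intro T_sum) (auto simp: J_def)
    then show "(cmod (f b - (\<Sum>a\<in>J. K b a * f a) / of_nat c))\<^sup>2 = (cmod (L f b))\<^sup>2"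
      by (simp add: L_def mult.commute)
  qed
  also have "\<dots> = nsq x (L f)" by (rule nsq_sum[symmetric]) (use J in \<open>auto simp: J_def\<close>)
  finally show ?thesis .
next
  case zero
  have "L f \<gamma> = 0" if "\<gamma> \<in> range_fiber G x" for \<gamma>
    using that zero T_zero[of \<gamma> f] by (auto simp: range_fiber_def L_def)
  then have "nsq x (L f) = 0" using nsq_sum[of "{}" x "L f"] by simp
  moreover have "nsq x f = 0" using nsq_sum[of "{}" x f] zero by simp
  ultimately show ?thesis by simp
qed

lemma entry_le_nsq:
  assumes f: "fsupp f" and "\<gamma> \<in> range_fiber G x"
  shows "(cmod (f \<gamma>))\<^sup>2 \<le> nsq x f"
proof -
  let ?S = "insert \<gamma> {\<gamma> \<in> range_fiber G x. f \<gamma> \<noteq> 0}"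
  have S: "finite ?S" using fsupp_finite[OF f] by simp
  have "nsq x f = (\<Sum>\<zeta>\<in>?S. (cmod (f \<zeta>))\<^sup>2)" by (rule nsq_sum) (use S assms(2) in auto)
  moreover have "(cmod (f \<gamma>))\<^sup>2 \<le> (\<Sum>\<zeta>\<in>?S. (cmod (f \<zeta>))\<^sup>2)"
    by (rule member_le_sum[where f = "\<lambda>\<zeta>. (cmod (f \<zeta>))\<^sup>2"]) (use S in auto)
  ultimately show ?thesis by simp
qed

lemma ip_T:
  assumes f: "fsupp f" and g: "fsupp g" and x: "x \<in> units G" "x \<notin> N"
  shows "ip x (T f) g = ip x f (T g)"
proof -
  let ?A = "{\<gamma> \<in> range_fiber G x. f \<gamma> \<noteq> 0}" and ?B = "{\<gamma> \<in> range_fiber G x. g \<gamma> \<noteq> 0}"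
  have A: "finite ?A" and B: "finite ?B" using fsupp_finite f g by auto
  have Tf: "T f b = (\<Sum>a\<in>?A. f a * K b a)" if "b \<in> range_fiber G x" for b
    using that A by (intro T_sum) (auto simp: range_fiber_def)
  have Tg: "T g a = (\<Sum>b\<in>?B. g b * K a b)" if "a \<in> range_fiber G x" for a
    using that B by (intro T_sum) (auto simp: range_fiber_def)
  have "ip x (T f) g = (\<Sum>b\<in>?B. cnj (T f b) * g b)" by (rule ip_sum) (use B in auto)
  also have "\<dots> = (\<Sum>b\<in>?B. \<Sum>a\<in>?A. cnj (f a) * (g b * K a b))"
  proof (intro sum.cong refl)
    fix b assume b: "b \<in> ?B"
    have "cnj (K b a) = K a b" if "a \<in> ?A" for a using K_herm[OF x, of a b] b that by simp
    then show "cnj (T f b) * g b = (\<Sum>a\<in>?A. cnj (f a) * (g b * K a b))"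
      using b by (simp add: Tf sum_distrib_right sum_distrib_left cnj_sum mult_ac)
  qed
  also have "\<dots> = (\<Sum>a\<in>?A. \<Sum>b\<in>?B. cnj (f a) * (g b * K a b))" by (rule sum.swap)
  also have "\<dots> = (\<Sum>a\<in>?A. cnj (f a) * T g a)" by (intro sum.cong refl) (simp add: Tg sum_distrib_left)
  also have "\<dots> = ip x f (T g)" by (rule ip_sum[symmetric]) (use A in auto)
  finally show ?thesis .
qed

lemma ip_add_left:
  assumes "fsupp f" "fsupp g" "fsupp h"
  shows "ip x (\<lambda>\<gamma>. f \<gamma> + g \<gamma>) h = ip x f h + ip x g h"
proof -
  let ?S = "{\<gamma> \<in> range_fiber G x. h \<gamma> \<noteq> 0}"
  have S: "finite ?S" using fsupp_finite assms by auto
  have "ip x k h = (\<Sum>\<gamma>\<in>?S. cnj (k \<gamma>) * h \<gamma>)" for k by (rule ip_sum) (use S in auto)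
  then show ?thesis by (simp add: algebra_simps sum.distrib)
qed

lemma ip_add_right:
  assumes "fsupp f" "fsupp g" "fsupp h"
  shows "ip x h (\<lambda>\<gamma>. f \<gamma> + g \<gamma>) = ip x h f + ip x h g"
proof -
  let ?S = "{\<gamma> \<in> range_fiber G x. h \<gamma> \<noteq> 0}"
  have S: "finite ?S" using fsupp_finite assms by auto
  have "ip x h k = (\<Sum>\<gamma>\<in>?S. cnj (h \<gamma>) * k \<gamma>)" for k by (rule ip_sum) (use S in auto)
  then show ?thesis by (simp add: algebra_simps sum.distrib)
qed

lemma ip_scale_left: "ip x (\<lambda>\<gamma>. of_real a * f \<gamma>) g = of_real a * ip x f g"
  and ip_scale_right: "ip x f (\<lambda>\<gamma>. of_real a * g \<gamma>) = of_real a * ip x f g"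
  unfolding ip_def by (simp_all add: mult.left_commute mult.assoc infsum_cmult_right')

lemma L_as_sum: "L f = (\<lambda>\<gamma>. f \<gamma> + of_real (- 1 / real c) * T f \<gamma>)"
  by (auto simp: L_def)

lemma ip_L:
  assumes "fsupp f" "fsupp g" "x \<in> units G" "x \<notin> N"
  shows "ip x (L f) g = ip x f (L g)"
  unfolding L_as_sum using assms
  by (simp only: ip_add_left ip_add_right fsupp_scale fsupp_T ip_scale_left ip_scale_right ip_T[OF assms])

text \<open>\<open>pop p f\<close> is \<open>p(L) f\<close>.\<close>

definition pop :: "real poly \<Rightarrow> ('g \<Rightarrow> complex) \<Rightarrow> 'g \<Rightarrow> complex" where
  "pop p f = fold_coeffs (\<lambda>a h \<gamma>. of_real a * f \<gamma> + L h \<gamma>) p (\<lambda>_. 0)"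

lemma pop_0 [simp]: "pop 0 f = (\<lambda>_. 0)"
  by (simp add: pop_def)

lemma pop_pCons [simp]: "pop (pCons a p) f = (\<lambda>\<gamma>. of_real a * f \<gamma> + L (pop p f) \<gamma>)"
  by (cases "p = 0 \<and> a = 0") (auto simp: pop_def)

lemma fsupp_pop: "fsupp f \<Longrightarrow> fsupp (pop p f)"
  by (induction p) (auto intro!: fsupp_add fsupp_scale fsupp_L)

lemma pop_add: "fsupp f \<Longrightarrow> pop (p + q) f = (\<lambda>\<gamma>. pop p f \<gamma> + pop q f \<gamma>)"
  by (induction p q rule: poly_induct2) (auto simp: L_add fsupp_pop algebra_simps)

lemma pop_smult: "pop (smult a p) f = (\<lambda>\<gamma>. of_real a * pop p f \<gamma>)"
  by (induction p) (auto simp: L_scale algebra_simps)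

lemma pop_mult: "fsupp f \<Longrightarrow> pop (p * q) f = pop p (pop q f)"
proof (induction p)
  case (pCons a p)
  then show ?case by (simp add: mult_pCons_left pop_add pop_smult)
qed simp

lemma L_pop: "fsupp f \<Longrightarrow> L (pop p f) = pop p (L f)"
proof (induction p)
  case (pCons a p)
  then show ?case by (simp add: L_add L_scale fsupp_pop fsupp_scale fsupp_L)
qed simp

lemma ip_pop:
  assumes "fsupp f" "fsupp g" "x \<in> units G" "x \<notin> N"
  shows "ip x (pop p f) g = ip x f (pop p g)"
  using assms(1,2)
proof (induction p arbitrary: g)
  case 0
  show ?case by (simp add: ip_def)
next
  case (pCons a p)
  have "ip x (pop (pCons a p) f) g = of_real a * ip x f g + ip x (L (pop p f)) g"
    using pCons.prems by (simp add: ip_add_left fsupp_scale fsupp_L fsupp_pop ip_scale_left)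
  also have "ip x (L (pop p f)) g = ip x (pop p f) (L g)"
    using pCons.prems assms by (intro ip_L fsupp_pop)
  also have "\<dots> = ip x f (pop p (L g))" using pCons fsupp_L by blast
  also have "pop p (L g) = L (pop p g)" using pCons.prems by (simp add: L_pop)
  finally show ?case
    using pCons.prems by (simp add: ip_add_right fsupp_scale fsupp_L fsupp_pop ip_scale_right)
qed

text \<open>The powers of the contraction \<open>L\<close> keep the norm of \<open>f\<close> at most
  1, so each of their entries has modulus at most 1, and nonnegative coefficients add up to
  \<open>poly p 1\<close>. The bound depends neither on the fibre nor on the arrow.\<close>

lemma pop_bound:
  assumes "nonneg_coeffs p" "fsupp f" "nsq x f \<le> 1" "\<gamma> \<in> range_fiber G x"
  shows "cmod (pop p f \<gamma>) \<le> poly p 1"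
  using assms(1-3)
proof (induction p arbitrary: f)
  case (pCons a p)
  have p: "nonneg_coeffs p" "0 \<le> a"
    using pCons.prems(1) unfolding nonneg_coeffs_def
    by (metis coeff_pCons_Suc, metis coeff_pCons_0)
  have "(cmod (f \<gamma>))\<^sup>2 \<le> 1" using entry_le_nsq[OF pCons.prems(2) assms(4)] pCons.prems(3) by simp
  then have f1: "cmod (f \<gamma>) \<le> 1" by (simp add: power_le_one_iff abs_square_le_1)
  have "cmod (pop p (L f) \<gamma>) \<le> poly p 1"
    using pCons.prems nsq_L[OF pCons.prems(2), of x] by (intro pCons.IH p fsupp_L) auto
  moreover have "cmod (of_real a * f \<gamma>) \<le> a" using p(2) f1 by (simp add: norm_mult mult_left_le)
  ultimately show ?case
    using norm_triangle_ineq[of "of_real a * f \<gamma>" "pop p (L f) \<gamma>"] pCons.prems(2) by (simp add: L_pop)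
qed simp

text \<open>Right convolution commutes with left translation. The hypothesis compares
  \<open>f\<close> and \<open>g\<close> on only one fibre, so that \<open>g\<close> need not be
  defined by translation elsewhere.\<close>

lemma T_translate:
  assumes \<gamma>: "\<gamma> \<in> space (arrows G)" and fg: "\<And>\<zeta>. \<zeta> \<in> range_fiber G (rng G \<gamma>) \<Longrightarrow> g \<zeta> = f (mult G (ginv G \<gamma>) \<zeta>)"
    and \<zeta>: "\<zeta> \<in> range_fiber G (rng G \<gamma>)"
  shows "T g \<zeta> = T f (mult G (ginv G \<gamma>) \<zeta>)"
proof -
  let ?t = "\<lambda>\<zeta>. mult G (ginv G \<gamma>) \<zeta>"
  have z: "\<zeta> \<in> space (arrows G)" "rng G \<zeta> = rng G \<gamma>" using \<zeta> by (auto simp: range_fiber_def)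
  have r: "rng G (?t \<zeta>) = src G \<gamma>" using ginv_mult_closed \<gamma> z by simp
  have "T f (?t \<zeta>) = (\<Sum>\<^sub>\<infinity>\<eta>\<in>range_fiber G (rng G \<gamma>). f (?t \<eta>) * F (mult G (ginv G (?t \<zeta>)) (?t \<eta>)))"
    unfolding T_def r
    using infsum_reindex_bij_betw[OF bij_translate[OF \<gamma>], of "\<lambda>\<eta>. f \<eta> * F (mult G (ginv G (?t \<zeta>)) \<eta>)"] by simp
  also have "\<dots> = (\<Sum>\<^sub>\<infinity>\<eta>\<in>range_fiber G (rng G \<gamma>). g \<eta> * F (mult G (ginv G \<zeta>) \<eta>))"
    using ginv_mult_translate[OF \<gamma> z(1)] z fg by (intro infsum_cong) (auto simp: range_fiber_def)
  finally show ?thesis unfolding T_def z(2) by simp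
qed

lemma pop_translate:
  assumes \<gamma>: "\<gamma> \<in> space (arrows G)" and fg: "\<And>\<zeta>. \<zeta> \<in> range_fiber G (rng G \<gamma>) \<Longrightarrow> g \<zeta> = f (mult G (ginv G \<gamma>) \<zeta>)"
    and \<zeta>: "\<zeta> \<in> range_fiber G (rng G \<gamma>)"
  shows "pop p g \<zeta> = pop p f (mult G (ginv G \<gamma>) \<zeta>)"
  using \<zeta>
proof (induction p arbitrary: \<zeta>)
  case (pCons a p)
  have "L (pop p g) \<zeta> = L (pop p f) (mult G (ginv G \<gamma>) \<zeta>)"
    using T_translate[OF \<gamma>, of "pop p g" "pop p f" \<zeta>] pCons by (simp add: L_def)
  then show ?case using fg pCons.prems by simp
qed simp

text \<open>A single Borel function that restricts to the point mass at \<open>x\<close> on the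
  fibre over every good unit \<open>x\<close>.\<close>

definition unit_vec :: "'g \<Rightarrow> complex" where
  "unit_vec \<gamma> = (if \<gamma> \<in> units G - N then 1 else 0)"

lemma fsupp_unit_vec: "fsupp unit_vec"
  unfolding fsupp_def
proof (intro conjI allI impI)
  show "unit_vec \<gamma> = 0" if "rng G \<gamma> \<in> N" for \<gamma>
    using that rng_unit by (auto simp: unit_vec_def)
  show "finite {\<gamma> \<in> range_fiber G x. unit_vec \<gamma> \<noteq> 0}" for x
    by (rule finite_subset[of _ "{x}"]) (use rng_unit in \<open>auto simp: unit_vec_def range_fiber_def split: if_splits\<close>)
qed

lemma nsq_unit_vec: "nsq x unit_vec \<le> 1"
proof -
  have "nsq x unit_vec = (\<Sum>\<zeta>\<in>{x} \<inter> range_fiber G x. (cmod (unit_vec \<zeta>))\<^sup>2)"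
    by (rule nsq_sum) (use rng_unit in \<open>auto simp: unit_vec_def range_fiber_def\<close>)
  also have "\<dots> \<le> (\<Sum>\<zeta>\<in>{x} \<inter> range_fiber G x. 1)" by (intro sum_mono) (auto simp: unit_vec_def)
  also have "\<dots> \<le> 1" by (cases "x \<in> range_fiber G x") auto
  finally show ?thesis .
qed

lemma pop_measurable:
  assumes f: "f \<in> borel_measurable (arrows G)" "fsupp f"
  shows "pop p f \<in> borel_measurable (arrows G)"
proof (induction p)
  case (pCons a p)
  have "T (pop p f) \<in> borel_measurable (arrows G)"
    unfolding T_def[abs_def]
    using pCons.IH F_borel fsupp_pop[OF f(2)] N0_sub
    by (intro fiber_sum_measurable) (auto simp: fsupp_def)
  then show ?case using f(1) pCons.IH by (simp add: L_def[abs_def])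
qed simp

text \<open>
  \<open>\<langle>p(L) e, \<gamma> p(L) e\<rangle> = \<langle>p(L)\<^sup>2 e, \<gamma> e\<rangle>\<close>, since \<open>L\<close> is self-adjoint and commutes with left translations.
\<close>

lemma coefficient_pop:
  assumes \<gamma>: "\<gamma> \<in> space (arrows G)" "rng G \<gamma> \<notin> N"
  shows "coefficient G (pop p unit_vec) \<gamma> = cnj (pop (p * p) unit_vec \<gamma>)"
proof -
  let ?x = "rng G \<gamma>"
  have x: "?x \<in> units G" "?x \<notin> N" using \<gamma> rng_units by auto
  have gx: "\<gamma> \<in> range_fiber G ?x" using \<gamma> by (simp add: range_fiber_def)
  \<comment> \<open>On the fibre over \<open>rng G \<gamma>\<close>, the point mass at
    \<open>\<gamma>\<close> is the translate of \<open>unit_vec\<close> by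
    \<open>\<gamma>\<close>.\<close>
  define \<delta> where "\<delta> \<zeta> = (if \<zeta> = \<gamma> then 1 else 0 :: complex)" for \<zeta>
  have d: "fsupp \<delta>"
    unfolding fsupp_def
  proof (intro conjI allI impI)
    show "finite {\<zeta> \<in> range_fiber G y. \<delta> \<zeta> \<noteq> 0}" for y
      by (rule finite_subset[of _ "{\<gamma>}"]) (auto simp: \<delta>_def)
  qed (use \<gamma> in \<open>auto simp: \<delta>_def\<close>)
  have tr: "\<delta> \<zeta> = unit_vec (mult G (ginv G \<gamma>) \<zeta>)" if "\<zeta> \<in> range_fiber G ?x" for \<zeta>
  proof -
    have z: "\<zeta> \<in> space (arrows G)" "rng G \<zeta> = ?x" using that by (auto simp: range_fiber_def)
    have "mult G (ginv G \<gamma>) \<zeta> \<in> units G \<longleftrightarrow> \<zeta> = \<gamma>" using mult_ginv_unit_iff[OF \<gamma>(1) z(1)] z(2) by simp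
    moreover have "mult G (ginv G \<gamma>) \<gamma> \<notin> N" using ginv_left[OF \<gamma>(1)] N_invariant[OF \<gamma>(1)] \<gamma>(2) by simp
    ultimately show ?thesis by (auto simp: \<delta>_def unit_vec_def)
  qed
  have "coefficient G (pop p unit_vec) \<gamma> = ip ?x (pop p unit_vec) (pop p \<delta>)"
    unfolding coefficient_def ip_def
    using pop_translate[where f = unit_vec and g = \<delta>, OF \<gamma>(1) tr] by (intro infsum_cong) simp
  also have "\<dots> = ip ?x (pop (p * p) unit_vec) \<delta>"
    using ip_pop[OF fsupp_pop[OF fsupp_unit_vec] d x] pop_mult[OF fsupp_unit_vec] by simp
  also have "\<dots> = (\<Sum>\<zeta>\<in>{\<gamma>}. cnj (pop (p * p) unit_vec \<zeta>) * \<delta> \<zeta>)"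
    using gx by (intro ip_sum) (auto simp: \<delta>_def)
  finally show ?thesis by (simp add: \<delta>_def)
qed

text \<open>The column of the kernel at the unit is the conjugate of \<open>F\<close>; this
  conjugation cancels the one in \<open>coefficient_pop\<close>.\<close>

lemma T_unit_vec:
  assumes \<gamma>: "\<gamma> \<in> space (arrows G)" "rng G \<gamma> \<notin> N"
  shows "T unit_vec \<gamma> = cnj (F \<gamma>)"
proof -
  let ?x = "rng G \<gamma>"
  have x: "?x \<in> units G" "?x \<notin> N" using \<gamma> rng_units by auto
  have gx: "\<gamma> \<in> range_fiber G ?x" using \<gamma> by (simp add: range_fiber_def)
  have "T unit_vec \<gamma> = (\<Sum>\<zeta>\<in>{?x}. unit_vec \<zeta> * K \<gamma> \<zeta>)"
    using unit_in_fiber[OF x(1)] rng_unit by (intro T_sum) (auto simp: unit_vec_def range_fiber_def)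
  also have "\<dots> = K \<gamma> ?x" using x by (simp add: unit_vec_def)
  also have "\<dots> = cnj (K ?x \<gamma>)" using K_herm[OF x gx unit_in_fiber[OF x(1)]] .
  also have "K ?x \<gamma> = F \<gamma>" unfolding K_def using ginv_unit_mult[OF x(1) gx] by simp
  finally show ?thesis .
qed

lemma F_le_1:
  assumes \<gamma>: "\<gamma> \<in> space (arrows G)" "rng G \<gamma> \<notin> N"
  shows "cmod (F \<gamma>) \<le> 1"
proof -
  have x: "rng G \<gamma> \<in> units G" using \<gamma> rng_units by auto
  have gx: "\<gamma> \<in> range_fiber G (rng G \<gamma>)" using \<gamma> by (simp add: range_fiber_def)
  show ?thesis
    using K_le_1[OF x \<gamma>(2) unit_in_fiber[OF x] gx] ginv_unit_mult[OF x gx] by (simp add: K_def)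
qed

section \<open>Approximate and normalised square roots\<close>

text \<open>For \<open>p = 1 - sqrt_iter k\<close>, the operator \<open>p(L)^2\<close> is
  \<open>T / c + 2 D(L)\<close> with \<open>D\<close> the next increment. The coefficient of
  \<open>\<xi>\<close> therefore differs from \<open>F\<close> by \<open>2 c\<close> times the
  conjugate of an entry of \<open>D(L)\<close> applied to the unit vector, of modulus at most
  \<open>D(1)\<close>.\<close>

lemma approximate_square_root:
  assumes \<epsilon>: "\<epsilon> > 0"
  shows "\<exists>\<xi>. \<xi> \<in> borel_measurable (arrows G) \<and> fsupp \<xi> \<and>
    (\<forall>\<gamma>\<in>space (arrows G). rng G \<gamma> \<notin> N \<longrightarrow> cmod (coefficient G \<xi> \<gamma> - F \<gamma>) \<le> \<epsilon>)"
proof -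
  have "eventually (\<lambda>k. poly (sqrt_iter (Suc k) - sqrt_iter k) 1 < \<epsilon> / (2 * real c)) sequentially"
    using \<epsilon> c_pos by (intro order_tendstoD(2)[OF sqrt_iter_at_1]) simp
  then obtain k where k: "poly (sqrt_iter (Suc k) - sqrt_iter k) 1 < \<epsilon> / (2 * real c)"
    by (auto simp: eventually_sequentially simp del: sqrt_iter.simps)
  define D where "D = sqrt_iter (Suc k) - sqrt_iter k"
  define p where "p = 1 - sqrt_iter k"
  have pp: "p * p = (1 - [:0, 1:]) + smult 2 D" unfolding p_def D_def by (rule sqrt_iter_square)
  \<comment> \<open>The factor \<open>sqrt c\<close> undoes the scaling of \<open>T\<close> by
    \<open>1 / c\<close>, since coefficients are quadratic in the vector.\<close>
  define \<xi> where "\<xi> \<gamma> = of_real (sqrt (real c)) * pop p unit_vec \<gamma>" for \<gamma>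
  have fs: "fsupp \<xi>" unfolding \<xi>_def[abs_def] by (intro fsupp_scale fsupp_pop fsupp_unit_vec)
  have "unit_vec \<in> borel_measurable (arrows G)"
  proof -
    have "units G - N \<in> sets (arrows G)" using units_sets N_null sets_mu_iff by blast
    then have "indicator (units G - N) \<in> borel_measurable (arrows G)" by (rule borel_measurable_indicator)
    moreover have "unit_vec = indicator (units G - N)" by (auto simp: unit_vec_def indicator_def)
    ultimately show ?thesis by simp
  qed
  then have m: "\<xi> \<in> borel_measurable (arrows G)"
    unfolding \<xi>_def[abs_def] using pop_measurable fsupp_unit_vec by (intro borel_measurable_times) auto
  have "cmod (coefficient G \<xi> \<gamma> - F \<gamma>) \<le> \<epsilon>" if \<gamma>: "\<gamma> \<in> space (arrows G)" "rng G \<gamma> \<notin> N" for \<gamma>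
  proof -
    have "coefficient G \<xi> \<gamma> = of_nat c * coefficient G (pop p unit_vec) \<gamma>"
    proof -
      have "complex_of_real (sqrt (real c)) * complex_of_real (sqrt (real c)) = of_nat c"
        by (simp flip: of_real_mult)
      then have "cnj (\<xi> a) * \<xi> b = of_nat c * (cnj (pop p unit_vec a) * pop p unit_vec b)" for a b
        unfolding \<xi>_def by (simp add: mult_ac)
      then show ?thesis unfolding coefficient_def by (simp add: infsum_cmult_right')
    qed
    also have "coefficient G (pop p unit_vec) \<gamma> = cnj (pop (p * p) unit_vec \<gamma>)"
      using \<gamma> by (rule coefficient_pop)
    also have "pop (p * p) unit_vec \<gamma> = cnj (F \<gamma>) / of_nat c + 2 * pop D unit_vec \<gamma>"
    proof -
      have "1 - [:0, 1:] = [:1, - 1 :: real:]" by (simp add: one_pCons)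
      moreover have "pop [:1, - 1:] unit_vec \<gamma> = T unit_vec \<gamma> / of_nat c"
        using L_scale[of "-1" unit_vec] by (simp add: L_def)
      ultimately show ?thesis
        unfolding pp by (simp add: pop_add[OF fsupp_unit_vec] pop_smult T_unit_vec[OF \<gamma>])
    qed
    also have "of_nat c * cnj (cnj (F \<gamma>) / of_nat c + 2 * pop D unit_vec \<gamma>) =
        F \<gamma> + 2 * of_nat c * cnj (pop D unit_vec \<gamma>)"
      using c_pos by (simp add: distrib_left)
    finally have "coefficient G \<xi> \<gamma> - F \<gamma> = 2 * of_nat c * cnj (pop D unit_vec \<gamma>)" by simp
    then have "cmod (coefficient G \<xi> \<gamma> - F \<gamma>) = 2 * real c * cmod (pop D unit_vec \<gamma>)"
      by (simp add: norm_mult)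
    also have "cmod (pop D unit_vec \<gamma>) \<le> poly D 1"
      using nonneg_sqrt_iter_diff fsupp_unit_vec nsq_unit_vec[of "rng G \<gamma>"] \<gamma>
      unfolding D_def by (intro pop_bound) (auto simp: range_fiber_def)
    also have "2 * real c * poly D 1 \<le> \<epsilon>" using k c_pos unfolding D_def[symmetric] by (simp add: field_simps)
    finally show ?thesis by (simp add: mult_left_mono)
  qed
  then show ?thesis using m fs by blast
qed

lemma approximate_normalised_square_root:
  assumes \<epsilon>: "\<epsilon> > 0"
  shows "\<exists>\<xi>. \<xi> \<in> borel_measurable (arrows G) \<and> coefficient G \<xi> \<in> borel_measurable (arrows G) \<and>
    (\<forall>x\<in>units G - N. ((\<lambda>\<gamma>. (cmod (\<xi> \<gamma>))\<^sup>2) has_sum 1) (range_fiber G x)) \<and>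
    (\<forall>\<gamma>\<in>space (arrows G). rng G \<gamma> \<notin> N \<longrightarrow> cmod (coefficient G \<xi> \<gamma> - F \<gamma>) \<le> \<epsilon>)"
proof -
  \<comment> \<open>The bound \<open>1/2\<close> keeps the normalising factor \<open>s\<close> at
    least \<open>1/2\<close>. Approximation and normalisation each contribute an error of
    \<open>d\<close>, and dividing by \<open>s\<close> at most doubles the total, giving
    \<open>4 * d\<close>.\<close>
  define d where "d = min (1/2) (\<epsilon> / 4)"
  have d: "0 < d" "d \<le> 1/2" "4 * d \<le> \<epsilon>" using \<epsilon> by (auto simp: d_def)
  obtain \<xi> where \<xi>: "\<xi> \<in> borel_measurable (arrows G)" "fsupp \<xi>"
    "\<And>\<gamma>. \<gamma> \<in> space (arrows G) \<Longrightarrow> rng G \<gamma> \<notin> N \<Longrightarrow> cmod (coefficient G \<xi> \<gamma> - F \<gamma>) \<le> d"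
    using approximate_square_root[OF d(1)] by blast
  have hs: "((\<lambda>\<gamma>. (cmod (\<xi> \<gamma>))\<^sup>2) has_sum nsq x \<xi>) (range_fiber G x)" for x
  proof (rule has_sum_finite_neutralI)
    show "finite {\<gamma> \<in> range_fiber G x. \<xi> \<gamma> \<noteq> 0}" using \<xi>(2) by (rule fsupp_finite)
    then show "nsq x \<xi> = (\<Sum>\<gamma>\<in>{\<gamma> \<in> range_fiber G x. \<xi> \<gamma> \<noteq> 0}. (cmod (\<xi> \<gamma>))\<^sup>2)"
      by (intro nsq_sum) auto
  qed auto
  have cx: "coefficient G \<xi> x = of_real (nsq x \<xi>)" if "x \<in> units G" for x
    using that hs by (rule coefficient_unit)
  have near: "\<bar>nsq x \<xi> - 1\<bar> \<le> d" if x: "x \<in> units G" "x \<notin> N" for x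
  proof -
    have "x \<in> space (arrows G)" "rng G x = x" using x units_subset rng_unit by auto
    then have "cmod (of_real (nsq x \<xi>) - 1) \<le> d" using \<xi>(3)[of x] cx[OF x(1)] F_unit[OF x] x by simp
    then show ?thesis by (metis norm_of_real of_real_1 of_real_diff)
  qed
  \<comment> \<open>The norm on the fibre is expressed through the coefficient at the unit
    \<open>rng G \<gamma>\<close>, which makes it Borel in \<open>\<gamma>\<close>.\<close>
  define \<rho> where "\<rho> \<gamma> = sqrt (Re (coefficient G \<xi> (rng G \<gamma>)))" for \<gamma>
  have \<rho>: "\<rho> \<gamma> = sqrt (nsq (rng G \<gamma>) \<xi>)" if "\<gamma> \<in> space (arrows G)" for \<gamma>
    using cx[OF rng_units[OF that]] by (simp add: \<rho>_def)
  define \<eta> where "\<eta> \<gamma> = \<xi> \<gamma> / of_real (\<rho> \<gamma>)" for \<gamma>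
  have cm: "coefficient G \<xi> \<in> borel_measurable (arrows G)"
    using \<xi> by (intro coefficient_measurable) (auto simp: fsupp_def)
  have \<eta>m: "\<eta> \<in> borel_measurable (arrows G)"
  proof -
    have [measurable]: "(\<lambda>\<gamma>. coefficient G \<xi> (rng G \<gamma>)) \<in> borel_measurable (arrows G)"
      using measurable_compose[OF rng_borel cm] .
    show ?thesis unfolding \<eta>_def[abs_def] \<rho>_def using \<xi>(1) by measurable
  qed
  have c\<eta>m: "coefficient G \<eta> \<in> borel_measurable (arrows G)"
  proof (rule coefficient_measurable[OF \<eta>m])
    show "\<eta> \<gamma> = 0" if "rng G \<gamma> \<in> N" for \<gamma> using that \<xi>(2) by (simp add: \<eta>_def fsupp_def)
    show "finite {\<gamma> \<in> range_fiber G x. \<eta> \<gamma> \<noteq> 0}" for x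
      by (rule finite_subset[OF _ fsupp_finite[OF \<xi>(2), of x]]) (auto simp: \<eta>_def)
  qed
  have one: "((\<lambda>\<gamma>. (cmod (\<eta> \<gamma>))\<^sup>2) has_sum 1) (range_fiber G x)" if x: "x \<in> units G - N" for x
  proof -
    have pos: "nsq x \<xi> > 0" using near[of x] x d by auto
    have "((\<lambda>\<gamma>. (cmod (\<xi> \<gamma>))\<^sup>2 * (1 / nsq x \<xi>)) has_sum (nsq x \<xi> * (1 / nsq x \<xi>))) (range_fiber G x)"
      by (rule has_sum_cmult_left[OF hs])
    then have "((\<lambda>\<gamma>. (cmod (\<xi> \<gamma>))\<^sup>2 * (1 / nsq x \<xi>)) has_sum 1) (range_fiber G x)" using pos by simp
    moreover have "(cmod (\<eta> \<gamma>))\<^sup>2 = (cmod (\<xi> \<gamma>))\<^sup>2 * (1 / nsq x \<xi>)" if "\<gamma> \<in> range_fiber G x" for \<gamma>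
    proof -
      have "\<gamma> \<in> space (arrows G)" "rng G \<gamma> = x" using that by (auto simp: range_fiber_def)
      then have "\<rho> \<gamma> = sqrt (nsq x \<xi>)" using \<rho> by simp
      then show ?thesis using pos by (simp add: \<eta>_def norm_divide power_divide)
    qed
    ultimately show ?thesis by (subst has_sum_cong) auto
  qed
  have "cmod (coefficient G \<eta> \<gamma> - F \<gamma>) \<le> \<epsilon>" if \<gamma>: "\<gamma> \<in> space (arrows G)" "rng G \<gamma> \<notin> N" for \<gamma>
  proof -
    have x: "rng G \<gamma> \<in> units G" "src G \<gamma> \<in> units G" "src G \<gamma> \<notin> N"
      using \<gamma> rng_units src_units N_invariant by auto
    define a where "a = nsq (rng G \<gamma>) \<xi>"
    define b where "b = nsq (src G \<gamma>) \<xi>"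
    have ab: "\<bar>a - 1\<bar> \<le> d" "\<bar>b - 1\<bar> \<le> d" using near x \<gamma> by (auto simp: a_def b_def)
    \<comment> \<open>The product of the two norms by which the coefficient is divided, one at each
      end of the arrow. Both squared norms lie in \<open>[1 - d, 1 + d]\<close>, so the product does
      as well.\<close>
    define s where "s = sqrt a * sqrt b"
    have s_lo: "1 - d \<le> s"
    proof -
      have "sqrt (1 - d) * sqrt (1 - d) \<le> s"
        unfolding s_def using ab d by (intro mult_mono real_sqrt_le_mono) auto
      then show ?thesis using d by simp
    qed
    have s_hi: "s \<le> 1 + d"
    proof -
      have "s \<le> sqrt (1 + d) * sqrt (1 + d)"
        unfolding s_def using ab d by (intro mult_mono real_sqrt_le_mono) auto
      then show ?thesis using d by simp
    qed
    have s: "1/2 \<le> s" "\<bar>1 - s\<bar> \<le> d" using s_lo s_hi d by auto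
    have "cnj (\<eta> \<zeta>) * \<eta> (mult G (ginv G \<gamma>) \<zeta>) = (cnj (\<xi> \<zeta>) * \<xi> (mult G (ginv G \<gamma>) \<zeta>)) * (1 / of_real s)"
      if \<zeta>: "\<zeta> \<in> range_fiber G (rng G \<gamma>)" for \<zeta>
    proof -
      have z: "\<zeta> \<in> space (arrows G)" "rng G \<zeta> = rng G \<gamma>" using \<zeta> by (auto simp: range_fiber_def)
      have "\<rho> \<zeta> = sqrt a" "\<rho> (mult G (ginv G \<gamma>) \<zeta>) = sqrt b"
        using \<rho>[OF z(1)] \<rho>[OF ginv_mult_closed(1)[OF \<gamma>(1) z(1)]] ginv_mult_closed(2)[OF \<gamma>(1) z(1)] z(2)
        by (simp_all add: a_def b_def)
      then show ?thesis by (simp add: \<eta>_def s_def)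
    qed
    then have "coefficient G \<eta> \<gamma> = coefficient G \<xi> \<gamma> * (1 / of_real s)"
      unfolding coefficient_def infsum_cmult_left'[symmetric] by (intro infsum_cong)
    then have "coefficient G \<eta> \<gamma> - F \<gamma> = ((coefficient G \<xi> \<gamma> - F \<gamma>) + F \<gamma> * of_real (1 - s)) / of_real s"
      using s by (simp add: field_simps)
    then have "cmod (coefficient G \<eta> \<gamma> - F \<gamma>) = cmod ((coefficient G \<xi> \<gamma> - F \<gamma>) + F \<gamma> * of_real (1 - s)) / s"
      using s by (simp only: norm_divide norm_of_real)
    also have "\<dots> \<le> (2 * d) / (1/2)"
    proof (rule frac_le)
      have "cmod (F \<gamma> * of_real (1 - s)) \<le> 1 * d"
        using F_le_1[OF \<gamma>] s unfolding norm_mult norm_of_real by (intro mult_mono) auto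
      then show "cmod ((coefficient G \<xi> \<gamma> - F \<gamma>) + F \<gamma> * of_real (1 - s)) \<le> 2 * d"
        using norm_triangle_ineq[of "coefficient G \<xi> \<gamma> - F \<gamma>" "F \<gamma> * of_real (1 - s)"] \<xi>(3)[OF \<gamma>] by linarith
    qed (use d s in auto)
    finally show ?thesis using d by simp
  qed
  then show ?thesis using \<eta>m c\<eta>m one by blast
qed

end

section \<open>From positive definite functions to amenability\<close>

context sectioned_groupoid
begin

lemma positive_definite_imp_coefficient:
  assumes F: "positive_definite G \<mu> F" "AE x in \<mu>. F x = 1" "has_bounded_support G \<mu> F" and \<epsilon>: "\<epsilon> > 0"
  shows "\<exists>\<xi>. \<xi> \<in> borel_measurable (arrows G) \<and> coefficient G \<xi> \<in> borel_measurable (arrows G) \<and>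
    (AE x in \<mu>. ((\<lambda>\<gamma>. (cmod (\<xi> \<gamma>))\<^sup>2) has_sum 1) (range_fiber G x)) \<and>
    (AE \<gamma> in gpd_measure G \<mu>. cmod (coefficient G \<xi> \<gamma>) \<le> 1) \<and>
    (AE \<gamma> in gpd_measure G \<mu>. cmod (coefficient G \<xi> \<gamma> - F \<gamma>) \<le> \<epsilon>)"
proof -
  obtain Z where Z: "Z \<in> null_sets \<mu>" "\<And>x k \<gamma>. x \<in> units G - Z \<Longrightarrow> \<forall>i<k. \<gamma> i \<in> range_fiber G x \<Longrightarrow>
      psd_matrix k (\<lambda>i j. F (mult G (ginv G (\<gamma> i)) (\<gamma> j)))"
    using F(1) unfolding positive_definite_def by blast
  obtain Q C where Q: "Q \<in> sets (arrows G)" "0 < C" "AE x in \<mu>. finite (Q \<inter> range_fiber G x) \<and>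
      real (card (Q \<inter> range_fiber G x)) \<le> C \<and> finite (Q \<inter> source_fiber G x) \<and> real (card (Q \<inter> source_fiber G x)) \<le> C"
    "\<And>\<gamma>. \<gamma> \<in> space (arrows G) - Q \<Longrightarrow> F \<gamma> = 0"
    using F(3) unfolding has_bounded_support_def bounded_subset_def by blast
  define c where "c = nat \<lceil>C\<rceil>"
  have c: "c > 0" "C \<le> real c" using Q(2) by (auto simp: c_def)
  have sub: "{\<gamma> \<in> range_fiber G x. F \<gamma> \<noteq> 0} \<subseteq> Q \<inter> range_fiber G x" for x
    using Q(4) by (auto simp: range_fiber_def)
  have "AE x in \<mu>. x \<notin> Z \<and> F x = 1 \<and> finite {\<gamma> \<in> range_fiber G x. F \<gamma> \<noteq> 0} \<and> card {\<gamma> \<in> range_fiber G x. F \<gamma> \<noteq> 0} \<le> c"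
    using AE_not_in[OF Z(1)] F(2) Q(3)
  proof eventually_elim
    case (elim x)
    then have "finite {\<gamma> \<in> range_fiber G x. F \<gamma> \<noteq> 0}" using sub finite_subset by blast
    moreover have "card {\<gamma> \<in> range_fiber G x. F \<gamma> \<noteq> 0} \<le> card (Q \<inter> range_fiber G x)"
      using elim sub by (intro card_mono) auto
    ultimately show ?case using elim c(2) by auto
  qed
  \<comment> \<open>All hypotheses holding almost everywhere are collected before saturating, so
    that off \<open>N\<close> they are available at both ends of every arrow, as the kernel
    estimates demand.\<close>
  from invariant_null_set[OF this] obtain N where N: "N \<in> null_sets \<mu>" "N0 \<subseteq> N"
    "\<forall>\<gamma>\<in>space (arrows G). rng G \<gamma> \<in> N \<longleftrightarrow> src G \<gamma> \<in> N"
    "\<forall>x\<in>units G - N. x \<notin> Z \<and> F x = 1 \<and> finite {\<gamma> \<in> range_fiber G x. F \<gamma> \<noteq> 0} \<and> card {\<gamma> \<in> range_fiber G x. F \<gamma> \<noteq> 0} \<le> c"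
    by blast
  have "reduced_groupoid_axioms G \<mu> N0 N" by unfold_locales (use N in auto)
  then interpret reduced_groupoid G \<mu> E N0 N by (intro reduced_groupoid.intro sectioned_groupoid_axioms)
  interpret bounded_positive_definite G \<mu> E N0 N F c
  proof
    show "F \<in> borel_measurable (arrows G)" using F(1) unfolding positive_definite_def by blast
    show "psd_matrix k (\<lambda>i j. F (mult G (ginv G (\<gamma> i)) (\<gamma> j)))"
      if "x \<in> units G" "x \<notin> N" "\<forall>i<k. \<gamma> i \<in> range_fiber G x" for x k \<gamma>
      using that N(4) by (intro Z(2)) auto
  qed (use N(4) c(1) in auto)
  obtain \<xi> where \<xi>: "\<xi> \<in> borel_measurable (arrows G)" "coefficient G \<xi> \<in> borel_measurable (arrows G)"
    "\<And>x. x \<in> units G - N \<Longrightarrow> ((\<lambda>\<gamma>. (cmod (\<xi> \<gamma>))\<^sup>2) has_sum 1) (range_fiber G x)"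
    "\<And>\<gamma>. \<gamma> \<in> space (arrows G) \<Longrightarrow> rng G \<gamma> \<notin> N \<Longrightarrow> cmod (coefficient G \<xi> \<gamma> - F \<gamma>) \<le> \<epsilon>"
    using approximate_normalised_square_root[OF \<epsilon>] by blast
  have "AE x in \<mu>. ((\<lambda>\<gamma>. (cmod (\<xi> \<gamma>))\<^sup>2) has_sum 1) (range_fiber G x)"
    using \<xi>(3) by (intro AE_good) auto
  moreover have "AE \<gamma> in gpd_measure G \<mu>. cmod (coefficient G \<xi> \<gamma>) \<le> 1"
    using \<xi>(3) rng_units src_units N_invariant by (intro AE_gpd_good coefficient_le_1) auto
  moreover have "AE \<gamma> in gpd_measure G \<mu>. cmod (coefficient G \<xi> \<gamma> - F \<gamma>) \<le> \<epsilon>"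
    using \<xi>(4) by (intro AE_gpd_good)
  ultimately show ?thesis using \<xi>(1,2) by blast
qed

text \<open>Errors of at most \<open>1 / Suc n\<close> transfer the limit of \<open>F n\<close> to
  the coefficients. These are bounded by 1, so for a test function \<open>h\<close> dominated
  convergence applies with bound \<open>cmod (h x)\<close>.\<close>

lemma positive_definite_imp_amenable:
  fixes F :: "nat \<Rightarrow> 'g \<Rightarrow> complex"
  assumes F: "\<And>n. positive_definite G \<mu> (F n)" "\<And>n. AE x in \<mu>. F n x = 1" "\<And>n. has_bounded_support G \<mu> (F n)"
    and lim: "AE \<gamma> in gpd_measure G \<mu>. (\<lambda>n. F n \<gamma>) \<longlonglongrightarrow> 1"
  shows "amenable G \<mu>"
proof -
  let ?\<nu> = "gpd_measure G \<mu>"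
  have "\<forall>n. \<exists>\<xi>. \<xi> \<in> borel_measurable (arrows G) \<and> coefficient G \<xi> \<in> borel_measurable (arrows G) \<and>
    (AE x in \<mu>. ((\<lambda>\<gamma>. (cmod (\<xi> \<gamma>))\<^sup>2) has_sum 1) (range_fiber G x)) \<and>
    (AE \<gamma> in ?\<nu>. cmod (coefficient G \<xi> \<gamma>) \<le> 1) \<and>
    (AE \<gamma> in ?\<nu>. cmod (coefficient G \<xi> \<gamma> - F n \<gamma>) \<le> 1 / Suc n)"
    by (intro allI positive_definite_imp_coefficient F) simp
  from choice[OF this] obtain \<xi> where "\<forall>n. \<xi> n \<in> borel_measurable (arrows G) \<and> coefficient G (\<xi> n) \<in> borel_measurable (arrows G) \<and>
    (AE x in \<mu>. ((\<lambda>\<gamma>. (cmod (\<xi> n \<gamma>))\<^sup>2) has_sum 1) (range_fiber G x)) \<and>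
    (AE \<gamma> in ?\<nu>. cmod (coefficient G (\<xi> n) \<gamma>) \<le> 1) \<and>
    (AE \<gamma> in ?\<nu>. cmod (coefficient G (\<xi> n) \<gamma> - F n \<gamma>) \<le> 1 / Suc n)" ..
  then have \<xi>: "\<xi> n \<in> borel_measurable (arrows G)" "coefficient G (\<xi> n) \<in> borel_measurable (arrows G)"
    "AE x in \<mu>. ((\<lambda>\<gamma>. (cmod (\<xi> n \<gamma>))\<^sup>2) has_sum 1) (range_fiber G x)"
    "AE \<gamma> in ?\<nu>. cmod (coefficient G (\<xi> n) \<gamma>) \<le> 1"
    "AE \<gamma> in ?\<nu>. cmod (coefficient G (\<xi> n) \<gamma> - F n \<gamma>) \<le> 1 / Suc n" for n
    by blast+
  have borel_eq: "borel_measurable ?\<nu> = (borel_measurable (arrows G) :: ('g \<Rightarrow> complex) set)"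
    by (rule measurable_cong_sets[OF sets_gpd refl])
  have [measurable]: "coefficient G (\<xi> n) \<in> borel_measurable ?\<nu>" for n
    unfolding borel_eq by (rule \<xi>(2))
  have "AE \<gamma> in ?\<nu>. \<forall>n. cmod (coefficient G (\<xi> n) \<gamma> - F n \<gamma>) \<le> 1 / Suc n"
    using \<xi>(5) by (simp add: AE_all_countable)
  then have conv: "AE \<gamma> in ?\<nu>. (\<lambda>n. coefficient G (\<xi> n) \<gamma>) \<longlonglongrightarrow> 1"
    using lim
  proof eventually_elim
    case (elim \<gamma>)
    have "(\<lambda>n. coefficient G (\<xi> n) \<gamma> - F n \<gamma>) \<longlonglongrightarrow> 0"
    proof (rule Lim_null_comparison)
      show "\<forall>\<^sub>F n in sequentially. norm (coefficient G (\<xi> n) \<gamma> - F n \<gamma>) \<le> 1 / real (Suc n)"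
        using elim(1) by (simp add: always_eventually)
      show "(\<lambda>n. 1 / real (Suc n)) \<longlonglongrightarrow> 0"
        using LIMSEQ_inverse_real_of_nat by (simp only: inverse_eq_divide)
    qed
    from tendsto_add[OF this elim(2)] show ?case by simp
  qed
  have "weak_star_tendsto ?\<nu> (\<lambda>n. coefficient G (\<xi> n)) (\<lambda>_. 1)"
    unfolding weak_star_tendsto_def
  proof (intro conjI allI impI)
    show "coefficient G (\<xi> n) \<in> L_infinity ?\<nu>" for n
      unfolding L_infinity_def using \<xi>(4)[of n] by auto
    show "(\<lambda>_. 1) \<in> L_infinity ?\<nu>"
      unfolding L_infinity_def by (auto intro!: exI[of _ 1])
    fix h :: "'g \<Rightarrow> complex" assume h: "integrable ?\<nu> h"
    have [measurable]: "h \<in> borel_measurable ?\<nu>" using h by (rule borel_measurable_integrable)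
    show "(\<lambda>n. integral\<^sup>L ?\<nu> (\<lambda>x. coefficient G (\<xi> n) x * h x)) \<longlonglongrightarrow> integral\<^sup>L ?\<nu> (\<lambda>x. 1 * h x)"
    proof (rule integral_dominated_convergence)
      show "integrable ?\<nu> (\<lambda>x. cmod (h x))" using h by (rule integrable_norm)
      show "AE x in ?\<nu>. (\<lambda>n. coefficient G (\<xi> n) x * h x) \<longlonglongrightarrow> 1 * h x"
        using conv by eventually_elim (intro tendsto_intros)
      show "AE x in ?\<nu>. norm (coefficient G (\<xi> n) x * h x) \<le> cmod (h x)" for n
        using \<xi>(4)[of n] by eventually_elim (simp add: norm_mult mult_left_le_one_le)
    qed measurable
  qed
  then show ?thesis unfolding amenable_def using \<xi>(1,3) by blast
qed

end

theorem theorem7p2: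
  fixes G :: "'g groupoid_data" and \<mu> :: "'g measure"
  assumes "countable_measured_groupoid G \<mu>"
  shows "amenable G \<mu> \<longleftrightarrow>
    (\<exists>F :: nat \<Rightarrow> 'g \<Rightarrow> complex.
       (\<forall>n. positive_definite G \<mu> (F n)) \<and>
       (\<forall>n. AE x in \<mu>. F n x = 1) \<and>
       (\<forall>n. has_bounded_support G \<mu> (F n)) \<and>
       (AE \<gamma> in gpd_measure G \<mu>. (\<lambda>n. F n \<gamma>) \<longlonglongrightarrow> 1))"
proof -
  interpret countable_measured_groupoid G \<mu> by fact
  obtain E :: "nat \<Rightarrow> 'g set" and N0 where E: "N0 \<in> null_sets \<mu>" "\<forall>n. E n \<in> sets (arrows G)" "disjoint_family E"
    "\<forall>n. inj_on (rng G) (E n)" "(\<Union>n. E n) = {y \<in> space (arrows G). rng G y \<notin> N0}"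
    "\<forall>n. \<forall>B\<in>sets (arrows G). rng G ` (E n \<inter> B) \<in> sets \<mu>"
    using decomposition by (elim exE conjE) simp
  interpret sectioned_groupoid G \<mu> E N0
    by unfold_locales (use E in auto)
  show ?thesis
    using amenable_imp_positive_definite positive_definite_imp_amenable by blast
qed

end
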